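(* Let $\mu_{\rm d},\mu_{\rm a}\in\mathcal{M}_F(\mathbb{R}^d)$ be such that $\mu_{\rm d}+\mu_{\rm a}$ is a non-zero measure and let $\gamma,c,\tilde c>0$. Let $\mathcal{Y}=(\mathcal{Y}^{(\rm d)},\mathcal{Y}^{(\rm a)})$ be an $\text{ooSBM}(\gamma,c,\tilde c)$ with initial measure $(\mu_{\rm d},\mu_{\rm a})$. Then, for any $s\ge0$, $$\mathbb{E}(\lVert\mathcal{Y}^{(\rm d)}_s\rVert)=\lVert\mu_{\rm d}\rVert\frac{c+\tilde c e^{-s(c+\tilde c)}}{c+\tilde c}+\lVert\mu_{\rm a}\rVert\frac{c(1-e^{-s(c+\tilde c)})}{c+\tilde c},$$ $$\mathbb{E}(\lVert\mathcal{Y}^{(\rm a)}_s\rVert)=\lVert\mu_{\rm d}\rVert\frac{\tilde c(1-e^{-s(c+\tilde c)})}{c+\tilde c}+\lVert\mu_{\rm a}\rVert\frac{ce^{-s(c+\tilde c)}+\tilde c}{c+\tilde c}.$$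
   Context: $\mathcal{M}_F(\mathbb{R}^d)$ is the space of finite Borel measures on $\mathbb{R}^d$ with the weak topology. For $\nu\in\mathcal{M}_F(\mathbb{R}^d)$, $\lVert\nu\rVert=\nu(\mathbb{R}^d)$. $\text{ooBBM}(\gamma,c,\tilde c)$: each particle is active or dormant. Active particles move as independent Brownian motions in $\mathbb{R}^d$, split into two active particles at rate $\gamma/2$, die at rate $\gamma/2$, and become dormant at rate $c$. Dormant particles do not move, split or die, and become active at rate $\tilde c$. The state is the pair (sum of unit Dirac masses at dormant particles, sum of unit Dirac masses at active particles) in $\mathcal{M}_F(\mathbb{R}^d)^2$. $\text{ooSBM}(\gamma,c,\tilde c)$ started at $(\mu_{\rm d},\mu_{\rm a})$ is the $\mathcal{M}_F(\mathbb{R}^d)^2$-valued Markov process $(\mathcal{Y}^{(\rm d)}_s,\mathcal{Y}^{(\rm a)}_s)_{s\ge0}$ that is the limit in distribution on the Skorokhod space $\mathbb{D}([0,\infty),\mathcal{M}_F(\mathbb{R}^d)^2)$, as $\varepsilon\to0$, of $\varepsilon$ times an $\text{ooBBM}(\gamma/\varepsilon,c,\tilde c)$ whose initial dormant and active configurations are independent Poisson random measures with intensities $\mu_{\rm d}/\varepsilon$ and $\mu_{\rm a}/\varepsilon$. Existence of this limit is known. *)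

theory Defs
  imports "HOL-Probability.Probability"
begin

section \<open>Finite measures with the weak topology\<close>

definition finite_borel_measures :: "'a::topological_space measure set" where
  "finite_borel_measures = {\<mu>. sets \<mu> = sets borel \<and> finite_measure \<mu>}"

definition weak_topology :: "'a::topological_space measure topology" where
  "weak_topology = topology_generated_by
     {{\<mu> \<in> finite_borel_measures. (\<integral>x. f x \<partial>\<mu>) \<in> U} | (f :: 'a \<Rightarrow> real) U.
        continuous_on UNIV f \<and> bounded (range f) \<and> open U}"

lemma topspace_weak_topology: "topspace weak_topology = finite_borel_measures"
proof -
  have "finite_borel_measures \<in>
     {{\<mu> \<in> finite_borel_measures. (\<integral>x. f x \<partial>\<mu>) \<in> U} | (f :: 'a \<Rightarrow> real) U.
        continuous_on UNIV f \<and> bounded (range f) \<and> open U}"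
    by (rule CollectI, rule exI[of _ "\<lambda>_. 0"], rule exI[of _ UNIV]) auto
  then show ?thesis
    unfolding weak_topology_def topology_generated_by_topspace by blast
qed


section \<open>Skorokhod space\<close>

text \<open>Paths are indexed by \<open>real\<close>, but live on \<open>{0..}\<close>: outside they take the value
  \<open>undefined\<close> (as in \<open>PiE\<close>), so that two paths are equal iff they agree on \<open>{0..}\<close>.\<close>

definition cadlag_paths :: "'e topology \<Rightarrow> (real \<Rightarrow> 'e) set" where
  "cadlag_paths E = {x \<in> {0..} \<rightarrow>\<^sub>E topspace E.
     (\<forall>t\<ge>0. limitin E x (x t) (at_right t)) \<and>
     (\<forall>t>0. \<exists>l. limitin E x l (at_left t))}"

text \<open>Convergence in the Skorokhod (J1) topology over a metrizable space \<open>E\<close>. A strictly increasing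
  bijection of \<open>{0..}\<close> is automatically continuous. The notion does not depend on which metric
  \<open>d\<close> compatible with \<open>E\<close> is used; for the weak topology over a Euclidean space one may take
  the Prokhorov or the bounded Lipschitz metric.\<close>

definition skorokhod_convergent :: "'e topology \<Rightarrow> (nat \<Rightarrow> real \<Rightarrow> 'e) \<Rightarrow> (real \<Rightarrow> 'e) \<Rightarrow> bool" where
  "skorokhod_convergent E xs x \<longleftrightarrow>
     (\<exists>d lam. Metric_space (topspace E) d \<and> Metric_space.mtopology (topspace E) d = E \<and>
        (\<forall>n. strict_mono_on {0..} (lam n) \<and> bij_betw (lam n) {0..} {0..}) \<and>
        uniform_limit {0..} lam (\<lambda>s. s) sequentially \<and>
        (\<forall>T. uniform_limit {0..T} (\<lambda>n s. d (xs n (lam n s)) (x s)) (\<lambda>_. 0) sequentially))"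

text \<open>The Skorokhod topology is metrizable, hence it is the sequential topology given by its
  convergent sequences.\<close>

definition skorokhod_topology :: "'e topology \<Rightarrow> (real \<Rightarrow> 'e) topology" where
  "skorokhod_topology E = topology (\<lambda>U. U \<subseteq> cadlag_paths E \<and>
     (\<forall>x\<in>U. \<forall>xs. range xs \<subseteq> cadlag_paths E \<and> skorokhod_convergent E xs x \<longrightarrow>
        eventually (\<lambda>n. xs n \<in> U) sequentially))"

lemma openin_skorokhod_topology:
  "openin (skorokhod_topology E) U \<longleftrightarrow> U \<subseteq> cadlag_paths E \<and>
     (\<forall>x\<in>U. \<forall>xs. range xs \<subseteq> cadlag_paths E \<and> skorokhod_convergent E xs x \<longrightarrow>
        eventually (\<lambda>n. xs n \<in> U) sequentially)"
proof -
  have "istopology (\<lambda>U. U \<subseteq> cadlag_paths E \<and>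
     (\<forall>x\<in>U. \<forall>xs. range xs \<subseteq> cadlag_paths E \<and> skorokhod_convergent E xs x \<longrightarrow>
        eventually (\<lambda>n. xs n \<in> U) sequentially))" (is "istopology ?P")
    unfolding istopology_def
  proof (rule conjI; rule allI; (rule allI)?; rule impI; (rule impI)?; rule conjI)
    fix S T assume S: "?P S" and T: "?P T"
    have "eventually (\<lambda>n. xs n \<in> S \<inter> T) sequentially"
      if "x \<in> S \<inter> T" "range xs \<subseteq> cadlag_paths E \<and> skorokhod_convergent E xs x" for x xs
    proof -
      have "eventually (\<lambda>n. xs n \<in> S) sequentially" "eventually (\<lambda>n. xs n \<in> T) sequentially"
        using S T that by blast+
      then show ?thesis by eventually_elim blast
    qed
    then show "S \<inter> T \<subseteq> cadlag_paths E"
      and "\<forall>x\<in>S \<inter> T. \<forall>xs. range xs \<subseteq> cadlag_paths E \<and> skorokhod_convergent E xs x \<longrightarrow>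
        eventually (\<lambda>n. xs n \<in> S \<inter> T) sequentially"
      using S by blast+
  next
    fix \<K> assume K: "\<forall>K\<in>\<K>. ?P K"
    then show "\<Union>\<K> \<subseteq> cadlag_paths E" by blast
    show "\<forall>x\<in>\<Union>\<K>. \<forall>xs. range xs \<subseteq> cadlag_paths E \<and> skorokhod_convergent E xs x \<longrightarrow>
        eventually (\<lambda>n. xs n \<in> \<Union>\<K>) sequentially"
    proof (intro ballI allI impI)
      fix x xs assume "x \<in> \<Union>\<K>" and c: "range xs \<subseteq> cadlag_paths E \<and> skorokhod_convergent E xs x"
      then obtain S where S: "S \<in> \<K>" "x \<in> S" by blast
      then have "eventually (\<lambda>n. xs n \<in> S) sequentially" using K c by blast
      then show "eventually (\<lambda>n. xs n \<in> \<Union>\<K>) sequentially"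
        by (rule eventually_mono) (use S in blast)
    qed
  qed
  then show ?thesis by (simp add: skorokhod_topology_def)
qed

lemma topspace_skorokhod_topology: "topspace (skorokhod_topology E) = cadlag_paths E"
proof
  show "topspace (skorokhod_topology E) \<subseteq> cadlag_paths E"
    using openin_skorokhod_topology[of E "topspace (skorokhod_topology E)"] by auto
  show "cadlag_paths E \<subseteq> topspace (skorokhod_topology E)"
    by (rule openin_subset) (auto simp: openin_skorokhod_topology intro!: always_eventually)
qed

definition borel_of_topology :: "'e topology \<Rightarrow> 'e measure" where
  "borel_of_topology E = sigma (topspace E) {U. openin E U}"

definition converges_in_distribution ::
  "'e topology \<Rightarrow> ('i \<Rightarrow> 'v measure) \<Rightarrow> ('i \<Rightarrow> 'v \<Rightarrow> 'e) \<Rightarrow> 'w measure \<Rightarrow> ('w \<Rightarrow> 'e) \<Rightarrow> 'i filter \<Rightarrow> bool"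
  where
  "converges_in_distribution E P Z M Y \<F> \<longleftrightarrow>
     (\<forall>F. continuous_map E euclideanreal F \<and> bounded (F ` topspace E) \<longrightarrow>
        ((\<lambda>i. \<integral>\<omega>. F (Z i \<omega>) \<partial>P i) \<longlongrightarrow> (\<integral>\<omega>. F (Y \<omega>) \<partial>M)) \<F>)"


section \<open>Poisson random measures and Brownian motion\<close>

definition generated_events :: "'w measure \<Rightarrow> ('w \<Rightarrow> 'b::topological_space) set \<Rightarrow> 'w set set" where
  "generated_events P Fs = sigma_sets (space P) {f -` A \<inter> space P | f A. f \<in> Fs \<and> A \<in> sets borel}"

text \<open>\<open>\<mu>\<close> is a finite measure here. With \<open>0 ^ 0 = 1\<close> the formula covers sets of intensity zero.\<close>

definition poisson_random_measure ::
  "'w measure \<Rightarrow> ('w \<Rightarrow> 'a::topological_space measure) \<Rightarrow> 'a measure \<Rightarrow> bool" where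
  "poisson_random_measure P \<xi> \<mu> \<longleftrightarrow>
     (\<forall>\<omega>\<in>space P. \<xi> \<omega> \<in> finite_borel_measures) \<and>
     (\<forall>A\<in>sets borel. (\<lambda>\<omega>. measure (\<xi> \<omega>) A) \<in> borel_measurable P \<and>
        (\<forall>k::nat. measure P {\<omega> \<in> space P. measure (\<xi> \<omega>) A = real k}
                    = measure \<mu> A ^ k / fact k * exp (- measure \<mu> A))) \<and>
     (\<forall>n. \<forall>A :: nat \<Rightarrow> 'a set. (\<forall>i<n. A i \<in> sets borel) \<and> disjoint_family_on A {..<n} \<longrightarrow>
        prob_space.indep_vars P (\<lambda>_. borel :: real measure) (\<lambda>i \<omega>. measure (\<xi> \<omega>) (A i)) {..<n})"

definition brownian_motion :: "'w measure \<Rightarrow> (real \<Rightarrow> 'w \<Rightarrow> 'a::euclidean_space) \<Rightarrow> bool" where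
  "brownian_motion P W \<longleftrightarrow>
     (\<forall>t\<ge>0. W t \<in> borel_measurable P) \<and>
     (AE \<omega> in P. W 0 \<omega> = 0 \<and> continuous_on {0..} (\<lambda>t. W t \<omega>)) \<and>
     (\<forall>s t b. 0 \<le> s \<and> s < t \<and> b \<in> Basis \<longrightarrow>
        distributed P lborel (\<lambda>\<omega>. (W t \<omega> - W s \<omega>) \<bullet> b) (normal_density 0 (sqrt (t - s)))) \<and>
     (\<forall>(ts :: nat \<Rightarrow> real) n. 0 \<le> ts 0 \<and> strict_mono ts \<longrightarrow>
        prob_space.indep_vars P (\<lambda>_. borel)
          (\<lambda>(k, b) \<omega>. (W (ts (Suc k)) \<omega> - W (ts k) \<omega>) \<bullet> b) ({..<n} \<times> Basis))"


section \<open>On/off branching Brownian motion\<close>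

datatype activity = Dormant | Active

datatype event = Split | Die | Sleep | Wake

text \<open>Genealogical labels: the initial particles of either activity are numbered by \<open>nat\<close>, and
  \<open>(s, i, k # w)\<close> is the \<open>k\<close>-th child of \<open>(s, i, w)\<close>. A change of activity also gives
  the particle a new label (its only child), which is harmless as all rates are constant.\<close>

type_synonym label = "activity \<times> nat \<times> nat list"

fun child :: "label \<Rightarrow> nat \<Rightarrow> label" where
  "child (s, i, w) k = (s, i, k # w)"

fun possible_events :: "activity \<Rightarrow> event set" where
  "possible_events Active = {Split, Die, Sleep}"
| "possible_events Dormant = {Wake}"

fun displacement :: "activity \<Rightarrow> (label \<Rightarrow> real \<Rightarrow> 'a::zero) \<Rightarrow> label \<Rightarrow> real \<Rightarrow> 'a" where
  "displacement Active B u t = B u t"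
| "displacement Dormant B u t = 0"

text \<open>Deterministic evolution, given the numbers \<open>N\<close> and positions \<open>p\<close> of the initial particles,
  the alarm clocks \<open>T\<close> and the motions \<open>B\<close>: \<open>born N p T B u s t x\<close> means that the particle
  \<open>u\<close> comes into existence at time \<open>t\<close> and position \<open>x\<close> with activity \<open>s\<close>. Of the events which
  are possible for a particle, the one whose clock rings first takes place.\<close>

definition first_event :: "(label \<Rightarrow> event \<Rightarrow> real) \<Rightarrow> label \<Rightarrow> activity \<Rightarrow> event \<Rightarrow> bool" where
  "first_event T u s e \<longleftrightarrow>
     e \<in> possible_events s \<and> (\<forall>e'\<in>possible_events s - {e}. T u e < T u e')"

inductive born ::
  "(activity \<Rightarrow> nat) \<Rightarrow> (activity \<Rightarrow> nat \<Rightarrow> 'a::euclidean_space) \<Rightarrow> (label \<Rightarrow> event \<Rightarrow> real) \<Rightarrow>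
   (label \<Rightarrow> real \<Rightarrow> 'a) \<Rightarrow> label \<Rightarrow> activity \<Rightarrow> real \<Rightarrow> 'a \<Rightarrow> bool"
  for N p T B where
  initial: "i < N s \<Longrightarrow> born N p T B (s, i, []) s 0 (p s i)"
| branch: "born N p T B u Active t x \<Longrightarrow> first_event T u Active Split \<Longrightarrow> k \<in> {0, 1} \<Longrightarrow>
    born N p T B (child u k) Active (t + T u Split) (x + B u (T u Split))"
| fall_asleep: "born N p T B u Active t x \<Longrightarrow> first_event T u Active Sleep \<Longrightarrow>
    born N p T B (child u 0) Dormant (t + T u Sleep) (x + B u (T u Sleep))"
| wake_up: "born N p T B u Dormant t x \<Longrightarrow> first_event T u Dormant Wake \<Longrightarrow>
    born N p T B (child u 0) Active (t + T u Wake) x"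

definition particles ::
  "(activity \<Rightarrow> nat) \<Rightarrow> (activity \<Rightarrow> nat \<Rightarrow> 'a::euclidean_space) \<Rightarrow> (label \<Rightarrow> event \<Rightarrow> real) \<Rightarrow>
   (label \<Rightarrow> real \<Rightarrow> 'a) \<Rightarrow> activity \<Rightarrow> real \<Rightarrow> (label \<times> 'a) set" where
  "particles N p T B s \<tau> = {(u, x + displacement s B u (\<tau> - t)) | u t x.
     born N p T B u s t x \<and> t \<le> \<tau> \<and> (\<forall>e\<in>possible_events s. \<tau> < t + T u e)}"

text \<open>The image of a counting measure is the sum of the unit Dirac masses.\<close>

definition configuration ::
  "(activity \<Rightarrow> nat) \<Rightarrow> (activity \<Rightarrow> nat \<Rightarrow> 'a::euclidean_space) \<Rightarrow> (label \<Rightarrow> event \<Rightarrow> real) \<Rightarrow>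
   (label \<Rightarrow> real \<Rightarrow> 'a) \<Rightarrow> activity \<Rightarrow> real \<Rightarrow> 'a measure" where
  "configuration N p T B s \<tau> = distr (count_space (particles N p T B s \<tau>)) borel snd"

fun event_rate :: "real \<Rightarrow> real \<Rightarrow> real \<Rightarrow> event \<Rightarrow> real" where
  "event_rate \<gamma> c c' Split = \<gamma> / 2"
| "event_rate \<gamma> c c' Die = \<gamma> / 2"
| "event_rate \<gamma> c c' Sleep = c"
| "event_rate \<gamma> c c' Wake = c'"

datatype noise = Initial | Clock label event | Motion label

fun noise_events ::
  "'w measure \<Rightarrow> (activity \<Rightarrow> 'w \<Rightarrow> nat) \<Rightarrow> (activity \<Rightarrow> nat \<Rightarrow> 'w \<Rightarrow> 'a::euclidean_space) \<Rightarrow>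
   (label \<Rightarrow> event \<Rightarrow> 'w \<Rightarrow> real) \<Rightarrow> (label \<Rightarrow> real \<Rightarrow> 'w \<Rightarrow> 'a) \<Rightarrow> noise \<Rightarrow> 'w set set" where
  "noise_events P N p T B Initial =
     sigma_sets (space P) (generated_events P (range N) \<union> generated_events P {p s i | s i. True})"
| "noise_events P N p T B (Clock u e) = generated_events P {T u e}"
| "noise_events P N p T B (Motion u) = generated_events P (B u ` {0..})"

text \<open>The particle system may explode on a null set, hence the \<open>AE\<close> in the last line.
  The first component of the state is the dormant, the second one the active configuration. The
  law of the initial configuration is left open.\<close>

definition ooBBM ::
  "'w measure \<Rightarrow> real \<Rightarrow> real \<Rightarrow> real \<Rightarrow>
   ('w \<Rightarrow> real \<Rightarrow> 'a::euclidean_space measure \<times> 'a measure) \<Rightarrow> bool" where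
  "ooBBM P \<gamma> c c' X \<longleftrightarrow> prob_space P \<and>
     (\<exists>N p T B.
        (\<forall>s. N s \<in> measurable P (count_space UNIV)) \<and>
        (\<forall>s i. p s i \<in> borel_measurable P) \<and>
        (\<forall>u e. distributed P lborel (T u e) (exponential_density (event_rate \<gamma> c c' e))) \<and>
        (\<forall>u. brownian_motion P (B u)) \<and>
        prob_space.indep_sets P (noise_events P N p T B) UNIV \<and>
        (AE \<omega> in P. \<forall>t\<ge>0. X \<omega> t =
           (let Z = configuration (\<lambda>s. N s \<omega>) (\<lambda>s i. p s i \<omega>) (\<lambda>u e. T u e \<omega>) (\<lambda>u r. B u r \<omega>)
            in (Z Dormant t, Z Active t))))"


section \<open>On/off super-Brownian motion\<close>

definition measure_pair_paths ::
  "(real \<Rightarrow> 'a::euclidean_space measure \<times> 'a measure) topology" where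
  "measure_pair_paths = skorokhod_topology (prod_topology weak_topology weak_topology)"

definition rescale ::
  "real \<Rightarrow> (real \<Rightarrow> 'a measure \<times> 'a measure) \<Rightarrow> real \<Rightarrow> 'a measure \<times> 'a measure" where
  "rescale \<epsilon> x = (\<lambda>t\<in>{0..}. (scale_measure (ennreal \<epsilon>) (fst (x t)), scale_measure (ennreal \<epsilon>) (snd (x t))))"

text \<open>The limiting law only depends on the laws of the approximating particle systems, so any
  realisation \<open>X \<epsilon>\<close> on probability spaces \<open>P \<epsilon>\<close> may be used. The argument \<open>TYPE('v)\<close> only
  records the type on which these probability spaces are carried.\<close>

definition ooSBM ::
  "'v itself \<Rightarrow> real \<Rightarrow> real \<Rightarrow> real \<Rightarrow> 'a::euclidean_space measure \<Rightarrow> 'a measure \<Rightarrow> 'w measure \<Rightarrow>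
   ('w \<Rightarrow> real \<Rightarrow> 'a measure \<times> 'a measure) \<Rightarrow> bool" where
  "ooSBM TYPE('v) \<gamma> c c' \<mu>\<^sub>d \<mu>\<^sub>a M Y \<longleftrightarrow>
     prob_space M \<and> Y \<in> measurable M (borel_of_topology measure_pair_paths) \<and>
     (\<exists>(P :: real \<Rightarrow> 'v measure) X.
        (\<forall>\<epsilon>>0.
           ooBBM (P \<epsilon>) (\<gamma> / \<epsilon>) c c' (X \<epsilon>) \<and>
           poisson_random_measure (P \<epsilon>) (\<lambda>\<omega>. fst (X \<epsilon> \<omega> 0)) (scale_measure (ennreal (1 / \<epsilon>)) \<mu>\<^sub>d) \<and>
           poisson_random_measure (P \<epsilon>) (\<lambda>\<omega>. snd (X \<epsilon> \<omega> 0)) (scale_measure (ennreal (1 / \<epsilon>)) \<mu>\<^sub>a) \<and>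
           prob_space.indep_set (P \<epsilon>)
             (generated_events (P \<epsilon>) {\<lambda>\<omega>. measure (fst (X \<epsilon> \<omega> 0)) A | A. A \<in> sets borel})
             (generated_events (P \<epsilon>) {\<lambda>\<omega>. measure (snd (X \<epsilon> \<omega> 0)) A | A. A \<in> sets borel}) \<and>
           (\<lambda>\<omega>. rescale \<epsilon> (X \<epsilon> \<omega>)) \<in> measurable (P \<epsilon>) (borel_of_topology measure_pair_paths)) \<and>
        converges_in_distribution measure_pair_paths P (\<lambda>\<epsilon> \<omega>. rescale \<epsilon> (X \<epsilon> \<omega>)) M Y (at_right 0))"

end

theory Submission
  imports Defs
begin

text \<open>Branching is critical, so that in the particle system with rate \<open>\<gamma> / \<epsilon>\<close> the rescaled expected
  numbers of dormant and active particles solve the linear system \<open>m\<^sub>a' = c (m\<^sub>d - m\<^sub>a)\<close>,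
  \<open>m\<^sub>d' = c' (m\<^sub>a - m\<^sub>d)\<close> in the activity of the ancestor, whatever \<open>\<epsilon>\<close> is. Decomposing at the first
  event of an ancestor gives renewal equations for the first two moments of its progeny; the second
  moment of the progeny of one ancestor is at most \<open>1 + (\<gamma> / \<epsilon>) t\<close>, which bounds the second moments of the
  rescaled total masses uniformly in \<open>\<epsilon> \<le> 1\<close>. Hence truncation of the mass at \<open>K\<close> changes
  its expectation by \<open>O (1 / K)\<close>. The integral of the truncated mass over a short time interval is a
  bounded continuous functional on Skorokhod space, so that its expectation passes to the limit
  \<open>\<epsilon> \<rightarrow> 0\<close>; then the interval shrinks to \<open>s\<close>, by right-continuity, and finally \<open>K \<rightarrow> \<infinity>\<close>.\<close>

section \<open>Genealogy of the particle system\<close>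

text \<open>Two obstacles shape the proof. The first is explosion, which is never ruled out
  beforehand. Populations are therefore counted in \<open>ennreal\<close> and by generations: the
  count within \<open>n\<close> generations is finite, its moments obey recursions in
  \<open>n\<close>, and the supremum over \<open>n\<close> is the total mass even if that is
  infinite. The upper bound on the mean holds for every \<open>n\<close>; the lower bound carries an
  error q^n, where q < 1 depends on \<epsilon>, and this error is removed by letting n tend to
  infinity while \<epsilon> is still fixed. The second obstacle is that convergence in distribution
  only sees bounded continuous functionals of the path, and the mass at time s is neither bounded
  nor continuous. For unboundedness alone one would get an inequality between the means; the uniform
  second moments provide the uniform integrability that makes it an equality. Discontinuity is met
  by averaging over time, because the mass of a fixed path jumps at countably many times
  only.\<close>

fun offspring :: "event \<Rightarrow> nat" where
  "offspring Split = 2"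
| "offspring Die = 0"
| "offspring Sleep = 1"
| "offspring Wake = 1"

text \<open>\<open>Die\<close> leaves no child, so its value here is a mere default.\<close>

fun next_activity :: "event \<Rightarrow> activity" where
  "next_activity Sleep = Dormant"
| "next_activity _ = Active"

text \<open>The particles with activity in \<open>S\<close> which descend from a particle \<open>u\<close> born with activity \<open>a\<close>
  and are alive a time \<open>t\<close> after its birth, fewer than \<open>n\<close> generations below \<open>u\<close>. In contrast to
  \<^const>\<open>born\<close>, the recursion follows the first event of the ancestor, so that the branching property
  becomes a renewal equation.\<close>

primrec descendants ::
  "(label \<Rightarrow> event \<Rightarrow> real) \<Rightarrow> activity set \<Rightarrow> nat \<Rightarrow> label \<Rightarrow> activity \<Rightarrow> real \<Rightarrow> label set" where
  "descendants T S 0 u a t = {}"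
| "descendants T S (Suc n) u a t =
     {v. v = u \<and> a \<in> S \<and> (\<forall>e\<in>possible_events a. t < T u e)} \<union>
     (\<Union>e\<in>{e. first_event T u a e \<and> T u e \<le> t}. \<Union>k<offspring e.
        descendants T S n (child u k) (next_activity e) (t - T u e))"

text \<open>Labels grow at the head of the list, so the descendants of a label are those that have
  its list as a suffix.\<close>

fun subtree :: "label \<Rightarrow> label set" where
  "subtree (s, i, w) = {(s, i, w' @ w) | w'. True}"

lemma self_in_subtree [simp]: "u \<in> subtree u"
  by (cases u) auto

lemma subtree_child: "subtree (child u k) \<subseteq> subtree u"
proof (cases u)
  case (fields s i w)
  have "w' @ k # w = (w' @ [k]) @ w" for w' by simp
  then show ?thesis unfolding fields by (auto simp del: append_assoc)
qed

lemma not_in_subtree_child: "u \<notin> subtree (child u k)"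
  by (cases u) auto

lemma disjoint_subtree_child: "k \<noteq> l \<Longrightarrow> subtree (child u k) \<inter> subtree (child u l) = {}"
proof (cases u)
  case (fields s i w)
  assume "k \<noteq> l"
  have "w1 @ k # w \<noteq> w2 @ l # w" for w1 w2
  proof
    assume "w1 @ k # w = w2 @ l # w"
    then have "(w1 @ [k]) @ w = (w2 @ [l]) @ w" by simp
    then have "w1 @ [k] = w2 @ [l]" by (simp only: append_same_eq)
    with \<open>k \<noteq> l\<close> show False by simp
  qed
  then show ?thesis unfolding fields by auto
qed

lemma disjoint_subtree_root: "(s, i) \<noteq> (s', i') \<Longrightarrow> subtree (s, i, []) \<inter> subtree (s', i', []) = {}"
  by auto

text \<open>The comparison in \<open>first_event\<close> is strict, so two first events would each
  ring before the other; a tie for the earliest ring leaves no first event.\<close>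

lemma first_event_unique: "first_event T u a e \<Longrightarrow> first_event T u a e' \<Longrightarrow> e = e'"
  unfolding first_event_def by (metis Diff_iff less_asym singletonD)

lemma first_event_possible: "first_event T u a e \<Longrightarrow> e \<in> possible_events a"
  by (simp add: first_event_def)

lemma finite_possible_events [simp]: "finite (possible_events a)"
  by (cases a) auto

lemma descendants_subtree: "descendants T S n u a t \<subseteq> subtree u"
proof (induction n arbitrary: u a t)
  case (Suc n)
  have "descendants T S n (child u k) a' t' \<subseteq> subtree u" for k a' t'
    using Suc subtree_child by blast
  then show ?case using self_in_subtree[of u] unfolding descendants.simps by blast
qed simp

lemma finite_descendants: "finite (descendants T S n u a t)"
proof (induction n arbitrary: u a t)
  case (Suc n)
  have "finite {e. first_event T u a e \<and> T u e \<le> t}"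
    by (rule finite_subset[of _ "possible_events a"]) (auto simp: first_event_def)
  with Suc show ?case by auto
qed simp

lemma descendants_mono: "S \<subseteq> S' \<Longrightarrow> descendants T S n u a t \<subseteq> descendants T S' n u a t"
proof (induction n arbitrary: u a t)
  case (Suc n)
  have "descendants T S n (child u k) a' t' \<subseteq> descendants T S' n (child u k) a' t'" for k a' t'
    using Suc by blast
  then show ?case using \<open>S \<subseteq> S'\<close> unfolding descendants.simps by blast
qed simp

lemma descendants_Suc: "descendants T S n u a t \<subseteq> descendants T S (Suc n) u a t"
proof (induction n arbitrary: u a t)
  case (Suc n)
  show ?case
    unfolding descendants.simps(2)[of T S "Suc n" u a t] descendants.simps(2)[of T S n u a t]
    by (intro Un_mono UN_mono order_refl Suc.IH)
qed simp

text \<open>Locality of the recursion, the source of the independence of progenies in disjoint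
  subtrees.\<close>

lemma descendants_cong:
  assumes "\<And>v e. v \<in> subtree u \<Longrightarrow> T v e = T' v e"
  shows "descendants T S n u a t = descendants T' S n u a t"
  using assms
proof (induction n arbitrary: u a t)
  case (Suc n)
  have 1: "T u e = T' u e" for e using Suc.prems by simp
  have 2: "first_event T u a e = first_event T' u a e" for e
    by (simp add: first_event_def 1)
  have 3: "descendants T S n (child u k) a' t' = descendants T' S n (child u k) a' t'" for k a' t'
    using Suc subtree_child by blast
  show ?case by (simp add: 1 2 3)
qed simp

text \<open>The union in the recursion is disjoint: at most one event is first, different children
  have disjoint subtrees, and none of these contains \<open>u\<close>. Indicators replace the case
  distinction so that the formula can be integrated term by term.\<close>

lemma card_descendants_Suc:
  "card (descendants T S (Suc n) u a t) =
     of_bool (a \<in> S \<and> (\<forall>e\<in>possible_events a. t < T u e)) +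
     (\<Sum>e\<in>possible_events a. of_bool (first_event T u a e \<and> T u e \<le> t) *
        (\<Sum>k<offspring e. card (descendants T S n (child u k) (next_activity e) (t - T u e))))"
proof -
  let ?D = "\<lambda>e k. descendants T S n (child u k) (next_activity e) (t - T u e)"
  let ?E = "{e. first_event T u a e \<and> T u e \<le> t}"
  let ?R = "\<Union>e\<in>?E. \<Union>k<offspring e. ?D e k"
  have E: "?E \<subseteq> possible_events a" by (auto simp: first_event_def)
  have "card ?R = (\<Sum>e\<in>?E. card (\<Union>k<offspring e. ?D e k))"
    using first_event_unique[of T u a]
    by (intro card_UN_disjoint) (auto intro: finite_subset[OF E] finite_descendants)
  also have "\<dots> = (\<Sum>e\<in>?E. \<Sum>k<offspring e. card (?D e k))"
  proof (intro sum.cong refl card_UN_disjoint)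
    fix e
    show "\<forall>k\<in>{..<offspring e}. \<forall>l\<in>{..<offspring e}. k \<noteq> l \<longrightarrow> ?D e k \<inter> ?D e l = {}"
      using disjoint_subtree_child descendants_subtree by blast
  qed (auto intro: finite_descendants)
  also have "\<dots> = (\<Sum>e\<in>possible_events a. of_bool (first_event T u a e \<and> T u e \<le> t) *
        (\<Sum>k<offspring e. card (?D e k)))"
    using E by (intro sum.mono_neutral_cong_left) auto
  finally have R: "card ?R = \<dots>" .
  have "u \<notin> ?R"
    using descendants_subtree not_in_subtree_child by blast
  moreover have "finite ?R"
    using finite_subset[OF E] by (auto intro: finite_descendants)
  ultimately have "card (descendants T S (Suc n) u a t) =
      card {v. v = u \<and> a \<in> S \<and> (\<forall>e\<in>possible_events a. t < T u e)} + card ?R"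
    unfolding descendants.simps by (intro card_Un_disjoint) (simp, assumption, blast)
  also have "card {v. v = u \<and> a \<in> S \<and> (\<forall>e\<in>possible_events a. t < T u e)} =
      of_bool (a \<in> S \<and> (\<forall>e\<in>possible_events a. t < T u e))"
    by auto
  finally show ?thesis using R by simp
qed

section \<open>Particle labels as descendants of the initial labels\<close>

lemma child_inject: "child u k = child v l \<longleftrightarrow> u = v \<and> k = l"
  by (cases u; cases v) auto

lemma child_not_root: "child u k \<noteq> (s, i, [])"
  by (cases u) auto

text \<open>A label does not tell which rule created it: the child index 0 arises from splitting,
  falling asleep and waking up. The activity of the parent, fixed by the induction hypothesis, and
  its unique first event decide. Hence counting particles amounts to counting labels.\<close>

lemma born_unique:
  assumes "born N p T B u a t x" and "born N p T B u a' t' x'"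
  shows "a = a' \<and> t = t' \<and> x = x'"
  using assms
proof (induction arbitrary: a' t' x' rule: born.induct)
  case (initial i s)
  from initial(2) show ?case
    by (cases rule: born.cases) (auto simp: child_not_root child_not_root[THEN not_sym])
next
  case (branch u t x k)
  have IH: "\<forall>a' t' x'. born N p T B u a' t' x' \<longrightarrow> Active = a' \<and> t = t' \<and> x = x'"
    using branch.IH by blast
  have E: "\<forall>e. first_event T u Active e \<longrightarrow> e = Split"
    using branch.hyps(2) first_event_unique by blast
  from branch.prems show ?case
    by (cases rule: born.cases) (insert IH E, auto simp: child_not_root child_inject)
next
  case (fall_asleep u t x)
  have IH: "\<forall>a' t' x'. born N p T B u a' t' x' \<longrightarrow> Active = a' \<and> t = t' \<and> x = x'"
    using fall_asleep.IH by blast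
  have E: "\<forall>e. first_event T u Active e \<longrightarrow> e = Sleep"
    using fall_asleep.hyps(2) first_event_unique by blast
  from fall_asleep.prems show ?case
    by (cases rule: born.cases) (insert IH E, auto simp: child_not_root child_inject)
next
  case (wake_up u t x)
  have IH: "\<forall>a' t' x'. born N p T B u a' t' x' \<longrightarrow> Dormant = a' \<and> t = t' \<and> x = x'"
    using wake_up.IH by blast
  have E: "\<forall>e. first_event T u Dormant e \<longrightarrow> e = Wake"
    using wake_up.hyps(2) first_event_unique by blast
  from wake_up.prems show ?case
    by (cases rule: born.cases) (insert IH E, auto simp: child_not_root child_inject)
qed

lemma inj_on_particles: "inj_on fst (particles N p T B s \<tau>)"
  unfolding particles_def by (rule inj_onI) (auto dest: born_unique)

lemma descendants_particles:
  assumes "born N p T B u a t x" and "t \<le> \<tau>"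
  shows "descendants T {b} n u a (\<tau> - t) \<subseteq> fst ` particles N p T B b \<tau>"
  using assms
proof (induction n arbitrary: u a t x)
  case (Suc n)
  have 1: "v \<in> fst ` particles N p T B b \<tau>" if "v = u" "a = b" "\<forall>e\<in>possible_events a. \<tau> - t < T u e" for v
  proof -
    have "(u, x + displacement b B u (\<tau> - t)) \<in> particles N p T B b \<tau>"
      unfolding particles_def using that Suc.prems
      by (intro CollectI exI[of _ u] exI[of _ t] exI[of _ x]) (auto simp: algebra_simps)
    then show ?thesis using that by force
  qed
  have 2: "descendants T {b} n (child u k) (next_activity e) (\<tau> - t - T u e)
      \<subseteq> fst ` particles N p T B b \<tau>"
    if e: "first_event T u a e" "T u e \<le> \<tau> - t" and k: "k < offspring e" for e k
  proof -
    have "\<exists>y. born N p T B (child u k) (next_activity e) (t + T u e) y"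
    proof (cases e)
      case Split
      then show ?thesis using e k Suc.prems(1) born.branch[of N p T B u t x k]
        first_event_possible[OF e(1)] by (cases a) (auto dest!: less_2_cases)
    next
      case Sleep
      then show ?thesis using e k Suc.prems(1) born.fall_asleep[of N p T B u t x]
        first_event_possible[OF e(1)] by (cases a) auto
    next
      case Wake
      then show ?thesis using e k Suc.prems(1) born.wake_up[of N p T B u t x]
        first_event_possible[OF e(1)] by (cases a) auto
    qed (use k in auto)
    then obtain y where "born N p T B (child u k) (next_activity e) (t + T u e) y" by blast
    from Suc.IH[OF this] show ?thesis using e by (simp add: algebra_simps)
  qed
  show ?case using 1 2 by auto
qed simp

lemma descendants_child_subset:
  assumes "first_event T u a e" and "T u e \<le> t" and "k < offspring e"
  shows "descendants T S n (child u k) (next_activity e) (t - T u e) \<subseteq> descendants T S (Suc n) u a t"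
  using assms by auto

text \<open>Each birth on the ancestral line uses up one step of the recursion, whence the offset
  \<open>m\<close>. Positive clocks ensure that the parent of a particle born by time
  \<open>\<tau>\<close> was itself born by then.\<close>

lemma born_descends:
  assumes "born N p T B u a t x" and "t \<le> \<tau>" and pos: "\<And>u e. 0 < T u e"
  shows "\<exists>m s i. i < N s \<and> (\<forall>n S. descendants T S n u a (\<tau> - t) \<subseteq> descendants T S (m + n) (s, i, []) s \<tau>)"
  using assms(1,2)
proof (induction rule: born.induct)
  case (initial i s)
  then show ?case by (intro exI[of _ 0] exI[of _ s] exI[of _ i]) simp
next
  have step: "\<exists>m s i. i < N s \<and> (\<forall>n S. descendants T S n (child u k) (next_activity e) (\<tau> - (t + T u e))
      \<subseteq> descendants T S (m + n) (s, i, []) s \<tau>)"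
    if IH: "t \<le> \<tau> \<Longrightarrow> \<exists>m s i. i < N s \<and>
        (\<forall>n S. descendants T S n u a (\<tau> - t) \<subseteq> descendants T S (m + n) (s, i, []) s \<tau>)"
      and e: "first_event T u a e" and k: "k < offspring e" and le: "t + T u e \<le> \<tau>" for u a e t k
  proof -
    have "t \<le> \<tau>" using pos[of u e] le by simp
    then obtain m s i where "i < N s"
      and m: "\<And>n S. descendants T S n u a (\<tau> - t) \<subseteq> descendants T S (m + n) (s, i, []) s \<tau>"
      using IH by blast
    moreover have "descendants T S n (child u k) (next_activity e) (\<tau> - (t + T u e))
        \<subseteq> descendants T S (Suc m + n) (s, i, []) s \<tau>" for n S
      using descendants_child_subset[OF e _ k, of "\<tau> - t" S n] m[of S "Suc n"] le
      by (simp add: algebra_simps del: descendants.simps)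
    ultimately show ?thesis by blast
  qed
  {
    case (branch u t x k)
    then show ?case using step[of t u Active Split k] by auto
  next
    case (fall_asleep u t x)
    then show ?case using step[of t u Active Sleep 0] by auto
  next
    case (wake_up u t x)
    then show ?case using step[of t u Dormant Wake 0] by auto
  }
qed

text \<open>Extended reals, because the supremum over \<open>n\<close> may be infinite.\<close>

definition population ::
  "(activity \<Rightarrow> nat) \<Rightarrow> (label \<Rightarrow> event \<Rightarrow> real) \<Rightarrow> activity set \<Rightarrow> nat \<Rightarrow> real \<Rightarrow> ennreal" where
  "population N T S n \<tau> = (\<Sum>s\<in>{Dormant, Active}. \<Sum>i<N s. of_nat (card (descendants T S n (s, i, []) s \<tau>)))"

lemma labels_particles:
  assumes pos: "\<And>u e. 0 < T u e" and "0 \<le> \<tau>"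
  shows "fst ` particles N p T B b \<tau> =
    (\<Union>n. \<Union>(s, i)\<in>Sigma {Dormant, Active} (\<lambda>s. {..<N s}). descendants T {b} n (s, i, []) s \<tau>)"
proof
  show "fst ` particles N p T B b \<tau> \<subseteq>
    (\<Union>n. \<Union>(s, i)\<in>Sigma {Dormant, Active} (\<lambda>s. {..<N s}). descendants T {b} n (s, i, []) s \<tau>)"
  proof
    fix v assume "v \<in> fst ` particles N p T B b \<tau>"
    then obtain t x where b: "born N p T B v b t x" "t \<le> \<tau>" and e: "\<forall>e\<in>possible_events b. \<tau> < t + T v e"
      unfolding particles_def by auto
    from born_descends[OF b pos] obtain m s i where "i < N s"
      and m: "\<And>n S. descendants T S n v b (\<tau> - t) \<subseteq> descendants T S (m + n) (s, i, []) s \<tau>"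
      by blast
    have "v \<in> descendants T {b} (Suc 0) v b (\<tau> - t)" using e by (auto simp: algebra_simps)
    then have "v \<in> descendants T {b} (m + Suc 0) (s, i, []) s \<tau>" using m by blast
    moreover have "s \<in> {Dormant, Active}" by (cases s) auto
    ultimately show "v \<in> (\<Union>n. \<Union>(s, i)\<in>Sigma {Dormant, Active} (\<lambda>s. {..<N s}). descendants T {b} n (s, i, []) s \<tau>)"
      using \<open>i < N s\<close> by blast
  qed
next
  have "descendants T {b} n (s, i, []) s \<tau> \<subseteq> fst ` particles N p T B b \<tau>" if "i < N s" for n s i
    using descendants_particles[OF born.initial[of i N s p T B, OF that], of \<tau> b n] \<open>0 \<le> \<tau>\<close> by simp
  then show "(\<Union>n. \<Union>(s, i)\<in>Sigma {Dormant, Active} (\<lambda>s. {..<N s}). descendants T {b} n (s, i, []) s \<tau>)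
    \<subseteq> fst ` particles N p T B b \<tau>" by blast
qed

text \<open>The labels are exhausted by the increasing sets of descendants within \<open>n\<close>
  generations. An exploding configuration simply has infinite mass on both sides.\<close>

lemma emeasure_configuration:
  assumes pos: "\<And>u e. 0 < T u e" and "0 \<le> \<tau>"
  shows "emeasure (configuration N p T B b \<tau>) UNIV = (SUP n. population N T {b} n \<tau>)"
proof -
  let ?P = "particles N p T B b \<tau>"
  let ?I = "Sigma {Dormant, Active} (\<lambda>s. {..<N s})"
  let ?D = "\<lambda>n. \<Union>(s, i)\<in>?I. descendants T {b} n (s, i, []) s \<tau>"
  have "emeasure (configuration N p T B b \<tau>) UNIV = emeasure (count_space ?P) ?P"
    unfolding configuration_def by (subst emeasure_distr) auto
  also have "\<dots> = emeasure (count_space (fst ` ?P)) (fst ` ?P)"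
    using inj_on_particles[of N p T B b \<tau>]
    by (auto simp: emeasure_count_space card_image dest: finite_imageD)
  also have "\<dots> = emeasure (count_space UNIV) (fst ` ?P)"
    by (simp add: emeasure_count_space)
  also have "\<dots> = emeasure (count_space UNIV) (\<Union>n. ?D n)"
    using labels_particles[where N = N and p = p and B = B and b = b, OF assms] by simp
  also have "\<dots> = (SUP n. emeasure (count_space UNIV) (?D n))"
  proof (rule SUP_emeasure_incseq[symmetric])
    have "?D n \<subseteq> ?D (Suc n)" for n
      using descendants_Suc by (intro UN_mono order_refl) (simp add: case_prod_beta del: descendants.simps)
    then show "incseq ?D" by (rule incseq_SucI)
  qed auto
  also have "(\<lambda>n. emeasure (count_space UNIV) (?D n)) = (\<lambda>n. population N T {b} n \<tau>)"
  proof
    fix n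
    have "card (?D n) = (\<Sum>(s, i)\<in>?I. card (descendants T {b} n (s, i, []) s \<tau>))"
    proof (subst card_UN_disjoint)
      show "\<forall>x\<in>?I. \<forall>y\<in>?I. x \<noteq> y \<longrightarrow>
        (case x of (s, i) \<Rightarrow> descendants T {b} n (s, i, []) s \<tau>) \<inter>
        (case y of (s, i) \<Rightarrow> descendants T {b} n (s, i, []) s \<tau>) = {}"
      proof (intro ballI impI)
        fix x y :: "activity \<times> nat" assume "x \<noteq> y"
        then show "(case x of (s, i) \<Rightarrow> descendants T {b} n (s, i, []) s \<tau>) \<inter>
        (case y of (s, i) \<Rightarrow> descendants T {b} n (s, i, []) s \<tau>) = {}"
          using descendants_subtree[of T "{b}" n "(fst x, snd x, [])" "fst x" \<tau>]
            descendants_subtree[of T "{b}" n "(fst y, snd y, [])" "fst y" \<tau>]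
            disjoint_subtree_root[of "fst x" "snd x" "fst y" "snd y"]
          by (simp add: case_prod_beta prod_eq_iff) blast
      qed
    qed (auto intro: finite_descendants simp: case_prod_beta)
    also have "\<dots> = (\<Sum>s\<in>{Dormant, Active}. \<Sum>i<N s. card (descendants T {b} n (s, i, []) s \<tau>))"
      by (subst sum.Sigma) auto
    finally have "card (?D n) = \<dots>" .
    moreover have "finite (?D n)" by (auto intro: finite_descendants)
    ultimately show "emeasure (count_space UNIV) (?D n) = population N T {b} n \<tau>"
      unfolding population_def by (simp add: emeasure_count_space ennreal_of_nat_eq_real_of_nat[symmetric])
  qed
  finally show ?thesis .
qed

section \<open>Renewal equations for the expected number of descendants\<close>

text \<open>Under independence the joint law is the product of the marginal laws, so this is
  Tonelli's theorem, with an independent copy of the sample point in place of image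
  measures.\<close>

lemma (in prob_space) indep_var_nn_integral:
  assumes ind: "indep_var A X B Y" and g[measurable]: "g \<in> borel_measurable (A \<Otimes>\<^sub>M B)"
  shows "(\<integral>\<^sup>+\<omega>. g (X \<omega>, Y \<omega>) \<partial>M) = (\<integral>\<^sup>+\<omega>. \<integral>\<^sup>+\<omega>'. g (X \<omega>, Y \<omega>') \<partial>M \<partial>M)"
proof -
  have X[measurable]: "X \<in> measurable M A" and Y[measurable]: "Y \<in> measurable M B"
    using indep_var_rv1[OF ind] indep_var_rv2[OF ind] by auto
  interpret Y: prob_space "distr M B Y" by (rule prob_space_distr) measurable
  have "(\<integral>\<^sup>+\<omega>. g (X \<omega>, Y \<omega>) \<partial>M) = (\<integral>\<^sup>+z. g z \<partial>distr M (A \<Otimes>\<^sub>M B) (\<lambda>\<omega>. (X \<omega>, Y \<omega>)))"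
    by (subst nn_integral_distr) auto
  also have "\<dots> = (\<integral>\<^sup>+z. g z \<partial>(distr M A X \<Otimes>\<^sub>M distr M B Y))"
    using ind unfolding indep_var_distribution_eq by simp
  also have "\<dots> = (\<integral>\<^sup>+x. \<integral>\<^sup>+y. g (x, y) \<partial>distr M B Y \<partial>distr M A X)"
    by (rule Y.nn_integral_fst[symmetric]) simp
  also have "\<dots> = (\<integral>\<^sup>+x. \<integral>\<^sup>+\<omega>'. g (x, Y \<omega>') \<partial>M \<partial>distr M A X)"
    by (intro nn_integral_cong) (subst nn_integral_distr; simp)
  also have "\<dots> = (\<integral>\<^sup>+\<omega>. \<integral>\<^sup>+\<omega>'. g (X \<omega>, Y \<omega>') \<partial>M \<partial>M)"
    by (subst nn_integral_distr) auto
  finally show ?thesis .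
qed

lemma (in prob_space) indep_var_nn_integral_mult:
  assumes ind: "indep_var A X B Y"
    and f[measurable]: "f \<in> borel_measurable A" and g[measurable]: "g \<in> borel_measurable B"
  shows "(\<integral>\<^sup>+\<omega>. f (X \<omega>) * g (Y \<omega>) \<partial>M) = (\<integral>\<^sup>+\<omega>. f (X \<omega>) \<partial>M) * (\<integral>\<^sup>+\<omega>. g (Y \<omega>) \<partial>M)"
proof -
  have [measurable]: "X \<in> measurable M A" "Y \<in> measurable M B"
    using indep_var_rv1[OF ind] indep_var_rv2[OF ind] by auto
  have "(\<integral>\<^sup>+\<omega>. f (X \<omega>) * g (Y \<omega>) \<partial>M) = (\<integral>\<^sup>+\<omega>. \<integral>\<^sup>+\<omega>'. f (X \<omega>) * g (Y \<omega>') \<partial>M \<partial>M)"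
    using indep_var_nn_integral[OF ind, of "\<lambda>z. f (fst z) * g (snd z)"] by simp
  then show ?thesis by (simp add: nn_integral_cmult nn_integral_multc)
qed

text \<open>A function of a single noise vector, so that measurability on product spaces and
  restriction to blocks of coordinates make sense.\<close>

definition num_descendants ::
  "activity set \<Rightarrow> nat \<Rightarrow> label \<Rightarrow> activity \<Rightarrow> real \<Rightarrow> (noise \<Rightarrow> real) \<Rightarrow> ennreal" where
  "num_descendants S n u a t v = of_nat (card (descendants (\<lambda>u e. v (Clock u e)) S n u a t))"

definition clocks :: "label set \<Rightarrow> noise set" where
  "clocks U = {Clock u e | u e. u \<in> U}"

lemma clocks_mono: "U \<subseteq> U' \<Longrightarrow> clocks U \<subseteq> clocks U'"
  by (auto simp: clocks_def)

lemma Clock_in_clocks [simp]: "Clock u e \<in> clocks U \<longleftrightarrow> u \<in> U"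
  unfolding clocks_def by blast

lemma clocks_disjoint: "U \<inter> U' = {} \<Longrightarrow> clocks U \<inter> clocks U' = {}"
  by (auto simp: clocks_def)

lemma clocks_noise: "clocks U \<subseteq> - range Motion" "Initial \<notin> clocks U"
  by (auto simp: clocks_def)

lemma num_descendants_0 [simp]: "num_descendants S 0 u a t v = 0"
  by (simp add: num_descendants_def)

lemma num_descendants_Suc:
  "num_descendants S (Suc n) u a t v =
     of_bool (a \<in> S) * of_bool (\<forall>e\<in>possible_events a. t < v (Clock u e)) +
     (\<Sum>e\<in>possible_events a.
        of_bool (first_event (\<lambda>u e. v (Clock u e)) u a e \<and> v (Clock u e) \<le> t) *
        (\<Sum>k<offspring e. num_descendants S n (child u k) (next_activity e) (t - v (Clock u e)) v))"
  unfolding num_descendants_def card_descendants_Suc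
  by (simp add: of_nat_sum of_bool_conj)

lemma num_descendants_restrict:
  assumes "clocks (subtree u) \<subseteq> J"
  shows "num_descendants S n u a t (restrict v J) = num_descendants S n u a t v"
proof -
  have "Clock v e \<in> J" if "v \<in> subtree u" for v e using assms that Clock_in_clocks by blast
  then have "descendants (\<lambda>u e. restrict v J (Clock u e)) S n u a t =
      descendants (\<lambda>u e. v (Clock u e)) S n u a t"
    by (intro descendants_cong) auto
  then show ?thesis by (simp add: num_descendants_def)
qed

text \<open>The time argument is a measurable function too, because the recursion shifts it by a
  random amount.\<close>

lemma measurable_num_descendants:
  assumes "clocks (subtree u) \<subseteq> J" and f: "f \<in> borel_measurable N"
    and g: "g \<in> measurable N (PiM J (\<lambda>_. borel))"
  shows "(\<lambda>x. num_descendants S n u a (f x) (g x)) \<in> borel_measurable N"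
  using assms(1,2)
proof (induction n arbitrary: u a f)
  case (Suc n)
  have [measurable]: "f \<in> borel_measurable N" by fact
  have J: "Clock u e \<in> J" for e
    using Suc.prems(1) self_in_subtree[of u] Clock_in_clocks by blast
  have g'[measurable]: "(\<lambda>x. g x (Clock u e)) \<in> borel_measurable N" for e
    using measurable_compose[OF g measurable_component_singleton[OF J]] .
  have IH[measurable]: "(\<lambda>x. num_descendants S n (child u k) a' (f x - g x (Clock u e)) (g x))
      \<in> borel_measurable N" for k a' e
    using Suc.prems(1) clocks_mono[OF subtree_child[of u k]]
    by (intro Suc.IH) auto
  show ?case
    unfolding num_descendants_Suc first_event_def of_bool_def by measurable
qed simp

section \<open>Independent exponential clocks and the renewal operator\<close>

definition total_rate :: "real \<Rightarrow> real \<Rightarrow> real \<Rightarrow> activity \<Rightarrow> real" where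
  "total_rate \<gamma> c c' a = (\<Sum>e\<in>possible_events a. event_rate \<gamma> c c' e)"

lemma total_rate_simps:
  "total_rate \<gamma> c c' Active = \<gamma> + c" "total_rate \<gamma> c c' Dormant = c'"
  by (simp_all add: total_rate_def)

text \<open>Total masses are functions of the clocks and the numbers of ancestors, so every noise
  source outside \<open>range Motion\<close> is represented by one real random variable.\<close>

locale on_off_clocks = prob_space P for P :: "'w measure" +
  fixes \<gamma> c c' :: real and V :: "noise \<Rightarrow> 'w \<Rightarrow> real"
  assumes rates_pos: "0 < \<gamma>" "0 < c" "0 < c'"
    and indep: "indep_vars (\<lambda>_. borel) V (- range Motion)"
    and clock_distributed:
      "\<And>u e. distributed P lborel (V (Clock u e)) (exponential_density (event_rate \<gamma> c c' e))"
begin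

abbreviation rate :: "event \<Rightarrow> real" where "rate \<equiv> event_rate \<gamma> c c'"

abbreviation trate :: "activity \<Rightarrow> real" where "trate \<equiv> total_rate \<gamma> c c'"

definition restricted_noise :: "noise set \<Rightarrow> 'w \<Rightarrow> noise \<Rightarrow> real" where
  "restricted_noise J \<omega> = (\<lambda>i\<in>J. V i \<omega>)"

lemma rate_pos: "0 < rate e"
  using rates_pos by (cases e) auto

lemma measurable_V: "i \<notin> range Motion \<Longrightarrow> V i \<in> borel_measurable P"
  using indep by (auto simp: indep_vars_def)

lemma measurable_clock [measurable]: "V (Clock u e) \<in> borel_measurable P"
  by (rule measurable_V) auto

lemma measurable_restricted_noise: "J \<subseteq> - range Motion \<Longrightarrow> restricted_noise J \<in> measurable P (PiM J (\<lambda>_. borel))"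
  unfolding restricted_noise_def by (intro measurable_restrict measurable_V) auto

lemma indep_restricted_noise:
  "A \<inter> B = {} \<Longrightarrow> A \<subseteq> - range Motion \<Longrightarrow> B \<subseteq> - range Motion \<Longrightarrow>
    indep_var (PiM A (\<lambda>_. borel)) (restricted_noise A) (PiM B (\<lambda>_. borel)) (restricted_noise B)"
  unfolding restricted_noise_def[abs_def] by (rule indep_var_restrict[OF indep])

lemma restricted_noise_apply [simp]: "i \<in> J \<Longrightarrow> restricted_noise J \<omega> i = V i \<omega>"
  by (simp add: restricted_noise_def)

lemma num_descendants_restricted_noise:
  "clocks (subtree u) \<subseteq> J \<Longrightarrow>
    num_descendants S n u a t (restricted_noise J \<omega>) = num_descendants S n u a t (\<lambda>i. V i \<omega>)"
  unfolding restricted_noise_def by (rule num_descendants_restrict)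

lemma measurable_num_descendants_V:
  assumes f: "f \<in> borel_measurable N" and g: "g \<in> measurable N P"
  shows "(\<lambda>x. num_descendants S n u a (f x) (\<lambda>i. V i (g x))) \<in> borel_measurable N"
proof -
  have "(\<lambda>x. num_descendants S n u a (f x) (restricted_noise (clocks (subtree u)) (g x))) \<in> borel_measurable N"
    using measurable_compose[OF g measurable_restricted_noise[OF clocks_noise(1)]]
    by (intro measurable_num_descendants[OF order_refl f])
  then show ?thesis by (simp add: num_descendants_restricted_noise)
qed

text \<open>The minimum of independent exponential clocks is exponential with the sum of the rates.
  A subset \<open>E\<close> is allowed because both all the clocks of a particle and the competitors
  of one of them are considered.\<close>

lemma clocks_gt:
  assumes "0 \<le> r" and "E \<subseteq> possible_events a"
  shows "(\<integral>\<^sup>+\<omega>. of_bool (\<forall>e\<in>E. r < V (Clock u e) \<omega>) \<partial>P) = ennreal (exp (- (\<Sum>e\<in>E. rate e) * r))"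
proof (cases "E = {}")
  \<comment> \<open>Independence is only stated for non-empty index sets; the empty set occurs for a
    dormant particle, whose only clock has no competitor.\<close>
  case True
  then show ?thesis by (simp add: emeasure_space_1)
next
  case False
  have fin: "finite E" using assms(2) finite_subset finite_possible_events by blast
  have "prob (\<Inter>i\<in>Clock u ` E. V i -` {r<..} \<inter> space P) =
      (\<Prod>i\<in>Clock u ` E. prob (V i -` {r<..} \<inter> space P))"
    by (rule indep_varsD[OF indep]) (use False fin in auto)
  then have "prob (\<Inter>e\<in>E. V (Clock u e) -` {r<..} \<inter> space P) =
      (\<Prod>e\<in>E. prob (V (Clock u e) -` {r<..} \<inter> space P))"
    by (simp add: prod.reindex inj_on_def False image_image)
  also have "\<dots> = (\<Prod>e\<in>E. exp (- r * rate e))"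
  proof (rule prod.cong[OF refl])
    fix e
    have "V (Clock u e) -` {r<..} \<inter> space P = {\<omega> \<in> space P. r < V (Clock u e) \<omega>}" by auto
    then show "prob (V (Clock u e) -` {r<..} \<inter> space P) = exp (- r * rate e)"
      using exponential_distributedD_gt[OF clock_distributed[of u e] assms(1) rate_pos] by simp
  qed
  also have "\<dots> = exp (- (\<Sum>e\<in>E. rate e) * r)"
    using fin by (simp add: exp_sum[symmetric] sum_distrib_left sum_negf mult.commute)
  finally have p: "prob (\<Inter>e\<in>E. V (Clock u e) -` {r<..} \<inter> space P) = \<dots>" .
  have "(\<integral>\<^sup>+\<omega>. of_bool (\<forall>e\<in>E. r < V (Clock u e) \<omega>) \<partial>P) =
      (\<integral>\<^sup>+\<omega>. indicator (\<Inter>e\<in>E. V (Clock u e) -` {r<..} \<inter> space P) \<omega> \<partial>P)"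
    by (intro nn_integral_cong) (auto simp: indicator_def of_bool_def)
  also have "\<dots> = emeasure P (\<Inter>e\<in>E. V (Clock u e) -` {r<..} \<inter> space P)"
    using False fin by (intro nn_integral_indicator sets.finite_INT) auto
  finally show ?thesis using p by (simp add: emeasure_eq_measure)
qed

text \<open>The renewal operator: the first event occurs at rate \<open>trate a\<close> and is \<open>e\<close> with probability
  \<open>rate e / trate a\<close>.\<close>

definition kernel :: "activity \<Rightarrow> real \<Rightarrow> (event \<Rightarrow> real \<Rightarrow> ennreal) \<Rightarrow> ennreal" where
  "kernel a t \<phi> = (\<Sum>e\<in>possible_events a. \<integral>\<^sup>+r. ennreal (rate e * exp (- trate a * r)) * indicator {0..t} r * \<phi> e (t - r) \<partial>lborel)"

lemma kernel_mono:
  assumes "\<And>e r. e \<in> possible_events a \<Longrightarrow> 0 \<le> r \<Longrightarrow> r \<le> t \<Longrightarrow> \<phi> e r \<le> \<psi> e r"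
  shows "kernel a t \<phi> \<le> kernel a t \<psi>"
  unfolding kernel_def
proof (intro sum_mono nn_integral_mono)
  fix e r assume "e \<in> possible_events a"
  then show "ennreal (rate e * exp (- trate a * r)) * indicator {0..t} r * \<phi> e (t - r) \<le>
      ennreal (rate e * exp (- trate a * r)) * indicator {0..t} r * \<psi> e (t - r)"
    using assms[of e "t - r"] by (auto simp: indicator_def intro!: mult_left_mono)
qed

text \<open>Variation of constants: \<open>- exp (- trate a * r) * m (t - r)\<close> is a primitive
  of the integrand of the kernel, because the loss term cancels. Solutions of the differential
  equation thus become fixed points of the renewal equation.\<close>

lemma kernel_ode:
  assumes m: "\<And>r. (m has_real_derivative ((\<Sum>e\<in>possible_events a. rate e * g e r) - trate a * m r)) (at r)"
    and g: "\<And>e r. e \<in> possible_events a \<Longrightarrow> 0 \<le> r \<Longrightarrow> 0 \<le> g e r"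
    and g_meas[measurable]: "\<And>e. g e \<in> borel_measurable borel"
    and "0 \<le> t" and "0 \<le> m 0"
  shows "ennreal (exp (- trate a * t) * m 0) + kernel a t (\<lambda>e r. ennreal (g e r)) = ennreal (m t)"
proof -
  let ?h = "\<lambda>r. \<Sum>e\<in>possible_events a. rate e * exp (- trate a * r) * g e (t - r)"
  let ?F = "\<lambda>r. - exp (- trate a * r) * m (t - r)"
  have der: "(?F has_real_derivative ?h r) (at r)" for r
  proof -
    have "((\<lambda>r. m (t - r)) has_real_derivative
        - ((\<Sum>e\<in>possible_events a. rate e * g e (t - r)) - trate a * m (t - r))) (at r)"
      by (rule DERIV_chain2[OF m, THEN DERIV_cong]) (auto intro!: derivative_eq_intros)
    then show ?thesis
      by (auto intro!: derivative_eq_intros simp: algebra_simps sum_distrib_left)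
  qed
  have h0: "0 \<le> ?h r" if "r \<le> t" for r
    using g that rate_pos by (intro sum_nonneg mult_nonneg_nonneg) (auto intro: less_imp_le)
  have "kernel a t (\<lambda>e r. ennreal (g e r)) = (\<integral>\<^sup>+r. (\<Sum>e\<in>possible_events a.
      ennreal (rate e * exp (- trate a * r)) * indicator {0..t} r * ennreal (g e (t - r))) \<partial>lborel)"
    unfolding kernel_def by (subst nn_integral_sum) auto
  also have "\<dots> = (\<integral>\<^sup>+r. ennreal (?h r) * indicator {0..t} r \<partial>lborel)"
  proof (rule nn_integral_cong)
    fix r
    have "ennreal (?h r) = (\<Sum>e\<in>possible_events a. ennreal (rate e * exp (- trate a * r)) * ennreal (g e (t - r)))"
      if "r \<le> t"
      using g that less_imp_le[OF rate_pos]
      by (subst sum_ennreal[symmetric]) (auto intro!: sum.cong mult_nonneg_nonneg simp: ennreal_mult)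
    then show "(\<Sum>e\<in>possible_events a.
      ennreal (rate e * exp (- trate a * r)) * indicator {0..t} r * ennreal (g e (t - r))) =
      ennreal (?h r) * indicator {0..t} r" by (auto simp: indicator_def)
  qed
  also have "\<dots> = (- exp (- trate a * t) * m (t - t)) - (- exp (- trate a * 0) * m (t - 0))"
    by (rule nn_integral_FTC_Icc)
      (use \<open>0 \<le> t\<close> h0 der in \<open>auto simp: has_real_derivative_iff_has_vector_derivative
        intro!: has_vector_derivative_at_within\<close>)
  finally have k: "kernel a t (\<lambda>e r. ennreal (g e r)) = ennreal (m t - exp (- trate a * t) * m 0)"
    by simp
  \<comment> \<open>This says that \<open>m t - exp (- trate a * t) * m 0\<close> is nonnegative, so
    that addition in \<open>ennreal\<close> undoes the subtraction.\<close>
  have "?F 0 \<le> ?F t"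
    by (rule DERIV_nonneg_imp_nondecreasing[OF \<open>0 \<le> t\<close>]) (use h0 der in blast)
  with k show ?thesis using \<open>0 \<le> m 0\<close> by (simp flip: ennreal_plus)
qed

text \<open>Conditioning on the ring time \<open>r\<close> of the clock of \<open>e\<close>: its
  competitors all ring later with probability \<open>exp\<close> of minus \<open>r\<close> times the
  sum of their rates, which turns the density of the clock into
  \<open>rate e * exp (- trate a * r)\<close>. The noise in \<open>B\<close> avoids the clocks at
  \<open>u\<close> and is independent of them.\<close>

lemma first_event_integral:
  assumes e: "e \<in> possible_events a" and B: "B \<subseteq> - range Motion" "\<And>e. Clock u e \<notin> B"
    and H[measurable]: "H \<in> borel_measurable (borel \<Otimes>\<^sub>M PiM B (\<lambda>_. borel))"
  shows "(\<integral>\<^sup>+\<omega>. of_bool (first_event (\<lambda>u e. V (Clock u e) \<omega>) u a e \<and> V (Clock u e) \<omega> \<le> t) *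
      H (t - V (Clock u e) \<omega>, restricted_noise B \<omega>) \<partial>P) =
    (\<integral>\<^sup>+r. ennreal (rate e * exp (- trate a * r)) * indicator {0..t} r *
      (\<integral>\<^sup>+\<omega>. H (t - r, restricted_noise B \<omega>) \<partial>P) \<partial>lborel)"
proof -
  let ?E = "possible_events a - {e}"
  let ?J = "Clock u ` ?E"
  let ?A = "{Clock u e}"
  have dis: "?A \<inter> (?J \<union> B) = {}" "?J \<inter> B = {}" using B(2) by auto
  have sub: "?A \<subseteq> - range Motion" "?J \<union> B \<subseteq> - range Motion" "?J \<subseteq> - range Motion" using B(1) by auto
  have [measurable]: "restricted_noise B \<in> measurable P (PiM B (\<lambda>_. borel))" by (rule measurable_restricted_noise[OF B(1)])
  have [measurable]: "(\<lambda>y. restrict y B) \<in> measurable (PiM (?J \<union> B) (\<lambda>_. borel)) (PiM B (\<lambda>_. borel :: real measure))"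
    by (rule measurable_restrict_subset) auto
  have c1[measurable]: "(\<lambda>x. x (Clock u e)) \<in> borel_measurable (PiM ?A (\<lambda>_. borel :: real measure))"
    by (rule measurable_component_singleton) auto
  have c2[measurable]: "(\<lambda>y. y (Clock u e')) \<in> borel_measurable (PiM (?J \<union> B) (\<lambda>_. borel :: real measure))" if "e' \<in> ?E" for e'
    by (rule measurable_component_singleton) (use that in auto)
  have c3[measurable]: "(\<lambda>y. y (Clock u e')) \<in> borel_measurable (PiM ?J (\<lambda>_. borel :: real measure))" if "e' \<in> ?E" for e'
    by (rule measurable_component_singleton) (use that in auto)
  \<comment> \<open>The integrand as a function of two independent blocks of noise: the clock of
    \<open>e\<close>, and its competitors together with \<open>B\<close>.\<close>
  define g where "g = (\<lambda>(x :: noise \<Rightarrow> real, y :: noise \<Rightarrow> real).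
     of_bool ((\<forall>e'\<in>?E. x (Clock u e) < y (Clock u e')) \<and> x (Clock u e) \<le> t) *
     H (t - x (Clock u e), restrict y B) :: ennreal)"
  have g: "g \<in> borel_measurable (PiM ?A (\<lambda>_. borel) \<Otimes>\<^sub>M PiM (?J \<union> B) (\<lambda>_. borel))"
    unfolding g_def of_bool_def split_beta by measurable
  have res: "restrict (restricted_noise (?J \<union> B) \<omega>) B = restricted_noise B \<omega>" for \<omega> by (auto simp: restricted_noise_def fun_eq_iff)
  \<comment> \<open>The conditional expectation given that the clock of \<open>e\<close> rings at
    time \<open>r\<close>.\<close>
  define k where "k = (\<lambda>r. \<integral>\<^sup>+\<omega>. of_bool ((\<forall>e'\<in>?E. r < V (Clock u e') \<omega>) \<and> r \<le> t) * H (t - r, restricted_noise B \<omega>) \<partial>P)"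
  have k_meas[measurable]: "k \<in> borel_measurable borel"
    unfolding k_def of_bool_def by measurable
  have k: "k r = ennreal (exp (- (\<Sum>e\<in>?E. rate e) * r)) * of_bool (r \<le> t) * (\<integral>\<^sup>+\<omega>. H (t - r, restricted_noise B \<omega>) \<partial>P)"
    if "0 \<le> r" for r
  proof -
    have "k r = (\<integral>\<^sup>+\<omega>. of_bool (\<forall>e'\<in>?E. r < restricted_noise ?J \<omega> (Clock u e')) * (of_bool (r \<le> t) * H (t - r, restricted_noise B \<omega>)) \<partial>P)"
      unfolding k_def by (intro nn_integral_cong) (auto simp: of_bool_def)
    also have "\<dots> = (\<integral>\<^sup>+\<omega>. of_bool (\<forall>e'\<in>?E. r < restricted_noise ?J \<omega> (Clock u e')) \<partial>P) * (\<integral>\<^sup>+\<omega>. (of_bool (r \<le> t) * H (t - r, restricted_noise B \<omega>)) \<partial>P)"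
      by (rule indep_var_nn_integral_mult[OF indep_restricted_noise[OF dis(2) sub(3) B(1)],
          of "\<lambda>y. of_bool (\<forall>e'\<in>?E. r < y (Clock u e'))" "\<lambda>y. of_bool (r \<le> t) * H (t - r, y)"])
        (unfold of_bool_def, measurable)
    also have "(\<integral>\<^sup>+\<omega>. of_bool (\<forall>e'\<in>?E. r < restricted_noise ?J \<omega> (Clock u e')) \<partial>P) = ennreal (exp (- (\<Sum>e\<in>?E. rate e) * r))"
      using clocks_gt[OF that, of ?E a u] by simp
    finally show ?thesis by (simp add: nn_integral_cmult mult.assoc)
  qed
  have "(\<integral>\<^sup>+\<omega>. of_bool (first_event (\<lambda>u e. V (Clock u e) \<omega>) u a e \<and> V (Clock u e) \<omega> \<le> t) *
      H (t - V (Clock u e) \<omega>, restricted_noise B \<omega>) \<partial>P) = (\<integral>\<^sup>+\<omega>. g (restricted_noise ?A \<omega>, restricted_noise (?J \<union> B) \<omega>) \<partial>P)"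
    using e by (intro nn_integral_cong) (auto simp: g_def first_event_def res)
  also have "\<dots> = (\<integral>\<^sup>+\<omega>. \<integral>\<^sup>+\<omega>'. g (restricted_noise ?A \<omega>, restricted_noise (?J \<union> B) \<omega>') \<partial>P \<partial>P)"
    by (rule indep_var_nn_integral[OF indep_restricted_noise[OF dis(1) sub(1,2)] g])
  also have "\<dots> = (\<integral>\<^sup>+\<omega>. k (V (Clock u e) \<omega>) \<partial>P)"
    by (intro nn_integral_cong) (auto simp: g_def res k_def)
  also have "\<dots> = (\<integral>\<^sup>+r. ennreal (exponential_density (rate e) r) * k r \<partial>lborel)"
    by (subst distributed_nn_integral[OF clock_distributed]) auto
  also have "\<dots> = (\<integral>\<^sup>+r. ennreal (rate e * exp (- trate a * r)) * indicator {0..t} r *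
      (\<integral>\<^sup>+\<omega>. H (t - r, restricted_noise B \<omega>) \<partial>P) \<partial>lborel)"
  proof (rule nn_integral_cong)
    fix r
    show "ennreal (exponential_density (rate e) r) * k r = ennreal (rate e * exp (- trate a * r)) * indicator {0..t} r *
      (\<integral>\<^sup>+\<omega>. H (t - r, restricted_noise B \<omega>) \<partial>P)"
    proof (cases "0 \<le> r")
      case True
      have "trate a = rate e + (\<Sum>e\<in>?E. rate e)"
        unfolding total_rate_def using e by (simp add: sum.remove)
      then have "exp (- r * rate e) * exp (- (\<Sum>e\<in>?E. rate e) * r) = exp (- trate a * r)"
        by (simp add: exp_add[symmetric] algebra_simps)
      then have "ennreal (rate e * exp (- trate a * r)) =
          ennreal (rate e * exp (- r * rate e)) * ennreal (exp (- (\<Sum>e\<in>?E. rate e) * r))"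
        using rate_pos[of e] by (simp add: ennreal_mult[symmetric] mult.assoc)
      then show ?thesis using True k[OF True]
        by (auto simp: exponential_density_def indicator_def mult.assoc)
    qed (simp add: exponential_density_def)
  qed
  finally show ?thesis .
qed

end

text \<open>At most one summand is nonzero, so squaring produces no cross terms.\<close>

lemma exclusive_sum_power2:
  fixes b :: "'b::comm_semiring_1"
  assumes "finite A" and b: "b = 0 \<or> b = 1"
    and excl: "\<And>e e'. p e \<Longrightarrow> p e' \<Longrightarrow> e = e'" "\<And>e. e \<in> A \<Longrightarrow> p e \<Longrightarrow> b = 0"
  shows "(b + (\<Sum>e\<in>A. of_bool (p e) * h e))\<^sup>2 = b + (\<Sum>e\<in>A. of_bool (p e) * (h e)\<^sup>2)"
proof (cases "\<exists>e\<in>A. p e")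
  case True
  then obtain e where e: "e \<in> A" "p e" by blast
  have "(\<Sum>x\<in>A. of_bool (p x) * f x) = f e" for f :: "'a \<Rightarrow> 'b"
  proof -
    have "(\<Sum>x\<in>A - {e}. of_bool (p x) * f x) = 0"
      by (rule sum.neutral) (use excl(1) e in auto)
    then show ?thesis
      using sum.remove[OF \<open>finite A\<close> e(1), of "\<lambda>x. of_bool (p x) * f x"] e(2)
      by (simp del: sum_of_bool_mult_eq)
  qed
  then show ?thesis using excl(2)[OF e] by (simp del: sum_of_bool_mult_eq)
next
  case False
  then have "(\<Sum>x\<in>A. of_bool (p x) * f x) = 0" for f :: "'a \<Rightarrow> 'b"
    by (intro sum.neutral) auto
  then show ?thesis using b by (auto simp del: sum_of_bool_mult_eq)
qed

text \<open>Splitting and dying are balanced, so that only the changes of activity contribute to the equations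
  for the expected number \<open>m a t\<close> of descendants with activity in \<open>S\<close>.\<close>

definition mean_solution ::
  "real \<Rightarrow> real \<Rightarrow> activity set \<Rightarrow> (activity \<Rightarrow> real \<Rightarrow> real) \<Rightarrow> bool" where
  "mean_solution c c' S m \<longleftrightarrow>
     (\<forall>r. (m Active has_real_derivative c * (m Dormant r - m Active r)) (at r)) \<and>
     (\<forall>r. (m Dormant has_real_derivative c' * (m Active r - m Dormant r)) (at r)) \<and>
     (\<forall>a. m a 0 = of_bool (a \<in> S)) \<and> (\<forall>a r. 0 \<le> r \<longrightarrow> 0 \<le> m a r \<and> m a r \<le> 1)"

lemma mean_solution_UNIV: "mean_solution c c' UNIV (\<lambda>_ _. 1)"
  by (auto simp: mean_solution_def)

section \<open>First and second moments of the progeny of one ancestor\<close>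

context on_off_clocks
begin

abbreviation mean_num :: "activity set \<Rightarrow> nat \<Rightarrow> label \<Rightarrow> activity \<Rightarrow> real \<Rightarrow> ennreal" where
  "mean_num S n u a t \<equiv> \<integral>\<^sup>+\<omega>. num_descendants S n u a t (\<lambda>i. V i \<omega>) \<partial>P"

lemma measurable_mean_num [measurable]: "mean_num S n u a \<in> borel_measurable borel"
proof -
  have [measurable]: "(\<lambda>x. num_descendants S n u a (fst x) (\<lambda>i. V i (snd x))) \<in> borel_measurable (borel \<Otimes>\<^sub>M P)"
    by (rule measurable_num_descendants_V) auto
  show ?thesis by measurable
qed

lemma measurable_num [measurable]:
  "(\<lambda>\<omega>. num_descendants S n u a t (\<lambda>i. V i \<omega>)) \<in> borel_measurable P"
  by (rule measurable_num_descendants_V) auto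

text \<open>The branching property in integrated form. \<open>\<phi>\<close> will be the identity
  for means and the square for second moments; it is applied to the children of each event
  separately, as at most one event contributes.\<close>

lemma branching_integral:
  assumes t: "0 \<le> t"
    and \<phi>[measurable]: "\<phi> \<in> borel_measurable borel"
  shows "(\<integral>\<^sup>+\<omega>. (of_bool (a \<in> S) * of_bool (\<forall>e\<in>possible_events a. t < V (Clock u e) \<omega>) +
      (\<Sum>e\<in>possible_events a. of_bool (first_event (\<lambda>u e. V (Clock u e) \<omega>) u a e \<and> V (Clock u e) \<omega> \<le> t) *
        \<phi> (\<Sum>k<offspring e. num_descendants S n (child u k) (next_activity e) (t - V (Clock u e) \<omega>) (\<lambda>i. V i \<omega>)))) \<partial>P) =
    ennreal (exp (- trate a * t) * of_bool (a \<in> S)) +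
    kernel a t (\<lambda>e r. \<integral>\<^sup>+\<omega>. \<phi> (\<Sum>k<offspring e. num_descendants S n (child u k) (next_activity e) r (\<lambda>i. V i \<omega>)) \<partial>P)"
proof -
  \<comment> \<open>All the clocks below \<open>u\<close>; those of \<open>u\<close> itself are not
    among them, as \<open>first_event_integral\<close> requires.\<close>
  let ?B = "clocks (\<Union>k. subtree (child u k))"
  have B: "?B \<subseteq> - range Motion" "\<And>e. Clock u e \<notin> ?B"
    using clocks_noise not_in_subtree_child by auto
  have sub: "clocks (subtree (child u k)) \<subseteq> ?B" for k by (rule clocks_mono) auto
  define H where "H = (\<lambda>e (r, y). \<phi> (\<Sum>k<offspring e. num_descendants S n (child u k) (next_activity e) r y))"
  have H: "H e \<in> borel_measurable (borel \<Otimes>\<^sub>M PiM ?B (\<lambda>_. borel))" for e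
  proof -
    have [measurable]: "(\<lambda>x. num_descendants S n (child u k) (next_activity e) (fst x) (snd x))
        \<in> borel_measurable (borel \<Otimes>\<^sub>M PiM ?B (\<lambda>_. borel))" for k
      by (rule measurable_num_descendants[OF sub]) auto
    show ?thesis unfolding H_def split_beta by measurable
  qed
  have HR: "H e (r, restricted_noise ?B \<omega>) = \<phi> (\<Sum>k<offspring e. num_descendants S n (child u k) (next_activity e) r (\<lambda>i. V i \<omega>))"
    for e r \<omega>
    by (simp add: H_def num_descendants_restricted_noise[OF sub])
  have [measurable]: "(\<lambda>\<omega>. num_descendants S n (child u k) (next_activity e) (t - V (Clock u e) \<omega>) (\<lambda>i. V i \<omega>))
      \<in> borel_measurable P" for k e
    by (rule measurable_num_descendants_V) auto
  have "(\<integral>\<^sup>+\<omega>. of_bool (a \<in> S) * of_bool (\<forall>e\<in>possible_events a. t < V (Clock u e) \<omega>) \<partial>P) =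
      ennreal (exp (- trate a * t) * of_bool (a \<in> S))"
    using clocks_gt[OF t order_refl, of a u] by (auto simp: total_rate_def)
  moreover have "(\<integral>\<^sup>+\<omega>. (\<Sum>e\<in>possible_events a. of_bool (first_event (\<lambda>u e. V (Clock u e) \<omega>) u a e \<and> V (Clock u e) \<omega> \<le> t) *
        \<phi> (\<Sum>k<offspring e. num_descendants S n (child u k) (next_activity e) (t - V (Clock u e) \<omega>) (\<lambda>i. V i \<omega>))) \<partial>P) =
    kernel a t (\<lambda>e r. \<integral>\<^sup>+\<omega>. \<phi> (\<Sum>k<offspring e. num_descendants S n (child u k) (next_activity e) r (\<lambda>i. V i \<omega>)) \<partial>P)"
    unfolding kernel_def
    by (subst nn_integral_sum)
      (simp_all add: first_event_integral[OF _ B H, unfolded HR], simp add: first_event_def of_bool_def)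
  ultimately show ?thesis
    by (subst nn_integral_add) (simp_all add: first_event_def of_bool_def)
qed

lemma mean_num_Suc:
  assumes "0 \<le> t"
  shows "mean_num S (Suc n) u a t = ennreal (exp (- trate a * t) * of_bool (a \<in> S)) +
    kernel a t (\<lambda>e r. \<Sum>k<offspring e. mean_num S n (child u k) (next_activity e) r)"
  using branching_integral[OF assms, of "\<lambda>x. x"] by (simp add: num_descendants_Suc nn_integral_sum)

lemma kernel_mean_solution:
  fixes m :: "activity \<Rightarrow> real \<Rightarrow> real"
  assumes m: "mean_solution c c' S m" and "0 \<le> t"
  shows "ennreal (exp (- trate a * t) * of_bool (a \<in> S)) +
    kernel a t (\<lambda>e r. ennreal (offspring e * m (next_activity e) r)) = ennreal (m a t)"
proof -
  have cont: "m a \<in> borel_measurable borel" for a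
  proof -
    have "\<exists>D. (m a has_real_derivative D) (at r)" for r
      using m by (cases a) (auto simp: mean_solution_def)
    then have "continuous_on UNIV (m a)" by (intro continuous_at_imp_continuous_on ballI) (meson DERIV_isCont)
    then show ?thesis by (rule borel_measurable_continuous_onI)
  qed
  have "ennreal (exp (- trate a * t) * m a 0) +
    kernel a t (\<lambda>e r. ennreal (offspring e * m (next_activity e) r)) = ennreal (m a t)"
  proof (rule kernel_ode)
    \<comment> \<open>For an active ancestor the sum is
      \<open>\<gamma> * m Active r + c * m Dormant r\<close>, two children at rate
      \<open>\<gamma> / 2\<close>; its first term cancels against the loss rate
      \<open>\<gamma> + c\<close>.\<close>
    show "(m a has_real_derivative (\<Sum>e\<in>possible_events a. rate e * (offspring e * m (next_activity e) r)) - trate a * m a r) (at r)" for r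
      using m by (cases a) (auto simp: mean_solution_def total_rate_simps algebra_simps elim!: DERIV_cong allE[of _ r])
  qed (use m cont \<open>0 \<le> t\<close> in \<open>auto simp: mean_solution_def\<close>)
  then show ?thesis using m by (simp add: mean_solution_def)
qed

text \<open>The expected counts are iterates of a monotone operator started at 0, and
  \<open>m\<close> is a fixed point, so they stay below it.\<close>

lemma mean_num_le:
  assumes m: "mean_solution c c' S m" and "0 \<le> t"
  shows "mean_num S n u a t \<le> ennreal (m a t)"
  using \<open>0 \<le> t\<close>
proof (induction n arbitrary: u a t)
  case (Suc n)
  have "mean_num S (Suc n) u a t \<le> ennreal (exp (- trate a * t) * of_bool (a \<in> S)) +
      kernel a t (\<lambda>e r. ennreal (offspring e * m (next_activity e) r))"
    unfolding mean_num_Suc[OF Suc.prems]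
  proof (intro add_left_mono kernel_mono)
    fix e r assume r: "0 \<le> r" "r \<le> t"
    have "(\<Sum>k<offspring e. mean_num S n (child u k) (next_activity e) r) \<le> of_nat (card {..<offspring e}) * ennreal (m (next_activity e) r)"
      by (rule sum_bounded_above) (use Suc.IH r in auto)
    then show "(\<Sum>k<offspring e. mean_num S n (child u k) (next_activity e) r) \<le> ennreal (offspring e * m (next_activity e) r)"
      using m r by (simp add: ennreal_mult mean_solution_def ennreal_of_nat_eq_real_of_nat)
  qed
  then show ?case using kernel_mean_solution[OF m Suc.prems] by simp
qed simp

text \<open>The renewal operator is a contraction on \<open>[0, \<tau>]\<close>: with positive probability the
  ancestor has no event before time \<open>\<tau>\<close>.\<close>

lemma mean_num_ge:
  assumes m: "mean_solution c c' S m" and "0 \<le> t" and "t \<le> \<tau>"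
  shows "ennreal (m a t) \<le> mean_num S n u a t + ennreal ((1 - exp (- (\<gamma> + c + c') * \<tau>)) ^ n)"
  using \<open>0 \<le> t\<close> \<open>t \<le> \<tau>\<close>
proof (induction n arbitrary: u a t)
  case 0
  then show ?case using m by (auto simp: mean_solution_def)
next
  case (Suc n)
  \<comment> \<open>\<open>\<gamma> + c + c'\<close> dominates both total rates, and
    \<open>\<tau>\<close> stays fixed while the recursion moves \<open>t\<close>, so the same
    \<open>q\<close> serves every step.\<close>
  define q where "q = 1 - exp (- (\<gamma> + c + c') * \<tau>)"
  have "0 \<le> (\<gamma> + c + c') * \<tau>" using rates_pos Suc.prems by (intro mult_nonneg_nonneg) auto
  then have q: "0 \<le> q" by (simp add: q_def algebra_simps)
  \<comment> \<open>When all activities are counted, the constant 1 solves the mean equations; hence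
    the operator applied to the numbers of offspring yields exactly the probability
    \<open>1 - exp (- trate a * t)\<close> of an event by time \<open>t\<close>.\<close>
  have "kernel a t (\<lambda>e r. ennreal (offspring e * 1)) \<le> ennreal q"
  proof -
    have "ennreal (exp (- trate a * t)) + kernel a t (\<lambda>e r. ennreal (offspring e * 1)) = 1"
      using kernel_mean_solution[OF mean_solution_UNIV Suc.prems(1), of a] by simp
    then have "kernel a t (\<lambda>e r. ennreal (offspring e * 1)) = 1 - ennreal (exp (- trate a * t))"
      by (metis ennreal_add_diff_cancel_left ennreal_neq_top)
    also have "\<dots> = ennreal (1 - exp (- trate a * t))"
      by (subst ennreal_1[symmetric], subst ennreal_minus) auto
    also have "\<dots> \<le> ennreal q"
    proof -
      have "trate a * t \<le> (\<gamma> + c + c') * \<tau>"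
        using rates_pos Suc.prems by (cases a) (auto simp: total_rate_simps intro!: mult_mono)
      then show ?thesis unfolding q_def by (intro ennreal_leI) (simp add: algebra_simps)
    qed
    finally show ?thesis .
  qed
  moreover have "kernel a t (\<lambda>e r. ennreal (offspring e * m (next_activity e) r)) \<le>
      kernel a t (\<lambda>e r. \<Sum>k<offspring e. mean_num S n (child u k) (next_activity e) r) +
      kernel a t (\<lambda>e r. ennreal (offspring e * 1)) * ennreal (q ^ n)"
  proof -
    have "kernel a t (\<lambda>e r. ennreal (offspring e * m (next_activity e) r)) \<le>
        kernel a t (\<lambda>e r. (\<Sum>k<offspring e. mean_num S n (child u k) (next_activity e) r) + ennreal (offspring e * 1) * ennreal (q ^ n))"
    proof (rule kernel_mono)
      fix e r assume r: "0 \<le> r" "r \<le> t"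
      have "of_nat (card {..<offspring e}) * ennreal (m (next_activity e) r) \<le>
          (\<Sum>k<offspring e. mean_num S n (child u k) (next_activity e) r + ennreal (q ^ n))"
        by (rule sum_bounded_below) (use Suc.IH[of r] r Suc.prems in \<open>auto simp: q_def\<close>)
      then show "ennreal (offspring e * m (next_activity e) r) \<le>
          (\<Sum>k<offspring e. mean_num S n (child u k) (next_activity e) r) + ennreal (offspring e * 1) * ennreal (q ^ n)"
        using m r by (simp add: ennreal_mult mean_solution_def ennreal_of_nat_eq_real_of_nat sum.distrib)
    qed
    also have "\<dots> = kernel a t (\<lambda>e r. \<Sum>k<offspring e. mean_num S n (child u k) (next_activity e) r) +
      kernel a t (\<lambda>e r. ennreal (offspring e * 1)) * ennreal (q ^ n)"
      unfolding kernel_def sum_distrib_right sum.distrib[symmetric]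
      by (intro sum.cong refl) (simp add: nn_integral_add[symmetric] nn_integral_multc[symmetric] distrib_left mult.assoc)
    finally show ?thesis .
  qed
  ultimately have "kernel a t (\<lambda>e r. ennreal (offspring e * m (next_activity e) r)) \<le>
      kernel a t (\<lambda>e r. \<Sum>k<offspring e. mean_num S n (child u k) (next_activity e) r) + ennreal q * ennreal (q ^ n)"
    by (meson add_left_mono mult_right_mono order_trans zero_le)
  then have "ennreal (m a t) \<le> mean_num S (Suc n) u a t + ennreal q * ennreal (q ^ n)"
    unfolding mean_num_Suc[OF Suc.prems(1)] kernel_mean_solution[OF m Suc.prems(1), symmetric]
    by (simp add: add_left_mono add.assoc)
  then show ?case using q by (simp add: q_def ennreal_mult[symmetric])
qed

lemma indep_subtrees:
  assumes "subtree u \<inter> subtree v = {}"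
  shows "(\<integral>\<^sup>+\<omega>. num_descendants S n u a t (\<lambda>i. V i \<omega>) * num_descendants S n v b t (\<lambda>i. V i \<omega>) \<partial>P) =
    mean_num S n u a t * mean_num S n v b t"
proof -
  have [measurable]: "num_descendants S n w b t \<in> borel_measurable (PiM (clocks (subtree w)) (\<lambda>_. borel))" for w b
    by (rule measurable_num_descendants[of w, OF order_refl]) auto
  show ?thesis
    using indep_var_nn_integral_mult[OF indep_restricted_noise[OF clocks_disjoint[OF assms] clocks_noise(1) clocks_noise(1)],
        of "num_descendants S n u a t" "num_descendants S n v b t"]
    by (simp add: num_descendants_restricted_noise)
qed

lemma mean_num_total_le: "0 \<le> t \<Longrightarrow> mean_num UNIV n u a t \<le> 1"
  using mean_num_le[OF mean_solution_UNIV] by simp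

text \<open>A split occurs at rate \<open>\<gamma> / 2\<close> and adds to the second moment twice a
  product of two independent progeny means, each at most 1. So the second moment grows at rate at
  most \<open>\<gamma>\<close>, whatever the switching rates are.\<close>

lemma second_moment_le:
  assumes "0 \<le> t"
  shows "(\<integral>\<^sup>+\<omega>. (num_descendants UNIV n u a t (\<lambda>i. V i \<omega>))\<^sup>2 \<partial>P) \<le> ennreal (1 + \<gamma> * t)"
  using assms
proof (induction n arbitrary: u a t)
  case (Suc n)
  let ?Z = "\<lambda>k e r \<omega>. num_descendants UNIV n (child u k) (next_activity e) r (\<lambda>i. V i \<omega>)"
  \<comment> \<open>The summand \<open>\<gamma> / c'\<close> makes \<open>1 + \<gamma> * t\<close> an exact solution also for a dormant ancestor.\<close>
  let ?g = "\<lambda>e r. real (offspring e) * (1 + \<gamma> * r) + (case e of Split \<Rightarrow> 2 | Wake \<Rightarrow> \<gamma> / c' | _ \<Rightarrow> 0)"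
  have "(\<integral>\<^sup>+\<omega>. (num_descendants UNIV (Suc n) u a t (\<lambda>i. V i \<omega>))\<^sup>2 \<partial>P) =
      (\<integral>\<^sup>+\<omega>. (of_bool (a \<in> UNIV) * of_bool (\<forall>e\<in>possible_events a. t < V (Clock u e) \<omega>) +
      (\<Sum>e\<in>possible_events a. of_bool (first_event (\<lambda>u e. V (Clock u e) \<omega>) u a e \<and> V (Clock u e) \<omega> \<le> t) *
        (\<Sum>k<offspring e. ?Z k e (t - V (Clock u e) \<omega>) \<omega>)\<^sup>2)) \<partial>P)"
    unfolding num_descendants_Suc
    by (intro nn_integral_cong exclusive_sum_power2)
      (auto dest: first_event_unique simp: not_less[symmetric])
  also have "\<dots> = ennreal (exp (- trate a * t) * 1) +
      kernel a t (\<lambda>e r. \<integral>\<^sup>+\<omega>. (\<Sum>k<offspring e. ?Z k e r \<omega>)\<^sup>2 \<partial>P)"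
    using branching_integral[OF Suc.prems, of "\<lambda>x. x\<^sup>2" a UNIV u n] by simp
  also have "\<dots> \<le> ennreal (exp (- trate a * t) * 1) + kernel a t (\<lambda>e r. ennreal (?g e r))"
  proof (intro add_left_mono kernel_mono)
    fix e and r :: real assume r: "0 \<le> r"
    then have nn: "0 \<le> 1 + \<gamma> * r" using rates_pos by simp
    have IH: "(\<integral>\<^sup>+\<omega>. (?Z k e r \<omega>)\<^sup>2 \<partial>P) \<le> ennreal (1 + \<gamma> * r)" for k e using Suc.IH[OF r] .
    show "(\<integral>\<^sup>+\<omega>. (\<Sum>k<offspring e. ?Z k e r \<omega>)\<^sup>2 \<partial>P) \<le> ennreal (?g e r)"
    proof (cases e)
      case Split
      have "(\<integral>\<^sup>+\<omega>. ?Z 0 e r \<omega> * ?Z 1 e r \<omega> \<partial>P) \<le> 1 * 1"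
        by (subst indep_subtrees[OF disjoint_subtree_child], simp)
          (intro mult_mono mean_num_total_le r zero_le)
      then have "2 * (\<integral>\<^sup>+\<omega>. ?Z 0 e r \<omega> * ?Z 1 e r \<omega> \<partial>P) \<le> 2 * (1 * 1)"
        by (rule mult_left_mono) simp
      then have "(\<integral>\<^sup>+\<omega>. (?Z 0 e r \<omega>)\<^sup>2 + (?Z 1 e r \<omega>)\<^sup>2 + 2 * (?Z 0 e r \<omega> * ?Z 1 e r \<omega>) \<partial>P) \<le>
          ennreal (1 + \<gamma> * r) + ennreal (1 + \<gamma> * r) + 2 * 1"
        by (auto simp: nn_integral_add nn_integral_cmult intro!: add_mono IH)
      also have "\<dots> = ennreal (?g e r)"
        using nn by (simp add: Split ennreal_plus[symmetric] ennreal_numeral[symmetric] del: ennreal_plus ennreal_numeral)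
      also have "(\<integral>\<^sup>+\<omega>. (?Z 0 e r \<omega>)\<^sup>2 + (?Z 1 e r \<omega>)\<^sup>2 + 2 * (?Z 0 e r \<omega> * ?Z 1 e r \<omega>) \<partial>P) =
          (\<integral>\<^sup>+\<omega>. (\<Sum>k<offspring e. ?Z k e r \<omega>)\<^sup>2 \<partial>P)"
      proof -
        have "(\<Sum>k<(2::nat). f k) = f 0 + f 1" for f :: "nat \<Rightarrow> ennreal" by (simp add: numeral_2_eq_2)
        then show ?thesis by (simp add: Split power2_sum mult.assoc)
      qed
      finally show ?thesis .
    next
      case Wake
      have "ennreal (1 + \<gamma> * r) \<le> ennreal (?g e r)"
        using rates_pos by (intro ennreal_leI) (simp add: Wake)
      then show ?thesis using IH[of 0 e] by (simp add: Wake)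
    next
      case Sleep
      then show ?thesis using IH[of 0 e] by simp
    qed simp
  qed
  also have "\<dots> = ennreal (1 + \<gamma> * t)"
  proof -
    have "ennreal (exp (- trate a * t) * (1 + \<gamma> * 0)) + kernel a t (\<lambda>e r. ennreal (?g e r)) = ennreal (1 + \<gamma> * t)"
    proof (rule kernel_ode[of "\<lambda>t. 1 + \<gamma> * t"])
      show "((\<lambda>t. 1 + \<gamma> * t) has_real_derivative
          (\<Sum>e\<in>possible_events a. rate e * ?g e r) - trate a * (1 + \<gamma> * r)) (at r)" for r
        using rates_pos by (cases a)
          (auto intro!: derivative_eq_intros simp: total_rate_simps field_simps)
      show "0 \<le> ?g e r" if "0 \<le> r" for e r
        using rates_pos that by (cases e) auto
      show "?g e \<in> borel_measurable borel" for e by measurable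
    qed (use Suc.prems in auto)
    then show ?thesis by simp
  qed
  finally show ?case .
qed simp

end

section \<open>Poisson initial configurations\<close>

context on_off_clocks
begin

definition progeny :: "('w \<Rightarrow> nat) \<Rightarrow> activity set \<Rightarrow> nat \<Rightarrow> activity \<Rightarrow> real \<Rightarrow> 'w \<Rightarrow> ennreal" where
  "progeny K S n s t \<omega> = (\<Sum>i<K \<omega>. num_descendants S n (s, i, []) s t (\<lambda>i. V i \<omega>))"

text \<open>The number of ancestors is independent of the clocks, so it can be frozen while the
  progenies are averaged.\<close>

lemma progeny_integral:
  assumes K: "\<And>\<omega>. V Initial \<omega> = real (K \<omega>)"
    and \<phi>[measurable]: "\<phi> \<in> borel_measurable borel"
  shows "(\<integral>\<^sup>+\<omega>. \<phi> (progeny K S n s t \<omega>) \<partial>P) =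
    (\<integral>\<^sup>+\<omega>. (\<integral>\<^sup>+\<omega>'. \<phi> (\<Sum>i<K \<omega>. num_descendants S n (s, i, []) s t (\<lambda>i. V i \<omega>')) \<partial>P) \<partial>P)"
proof -
  let ?B = "clocks UNIV"
  have sub: "clocks (subtree u) \<subseteq> ?B" for u by (rule clocks_mono) auto
  \<comment> \<open>The floor recovers the number of ancestors from its encoding as a real
    coordinate.\<close>
  define g where "g = (\<lambda>(x :: noise \<Rightarrow> real, y). \<phi> (\<Sum>i<nat \<lfloor>x Initial\<rfloor>. num_descendants S n (s, i, []) s t y))"
  have "g \<in> borel_measurable (PiM {Initial} (\<lambda>_. borel) \<Otimes>\<^sub>M PiM ?B (\<lambda>_. borel))"
  proof -
    have [measurable]: "(\<lambda>x. num_descendants S n (s, i, []) s t (snd x))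
        \<in> borel_measurable (PiM {Initial} (\<lambda>_. borel :: real measure) \<Otimes>\<^sub>M PiM ?B (\<lambda>_. borel))" for i
      by (rule measurable_num_descendants[OF sub]) auto
    have "(\<lambda>x. x Initial) \<in> borel_measurable (PiM {Initial} (\<lambda>_. borel :: real measure))"
      by (rule measurable_component_singleton) auto
    then have [measurable]: "(\<lambda>x. nat \<lfloor>fst x Initial\<rfloor>) \<in>
        measurable (PiM {Initial} (\<lambda>_. borel :: real measure) \<Otimes>\<^sub>M PiM ?B (\<lambda>_. borel :: real measure)) (count_space UNIV)"
      by measurable
    show ?thesis
      unfolding g_def split_beta
      by (rule measurable_compose_countable[where f = "\<lambda>k x. \<phi> (\<Sum>i<k. num_descendants S n (s, i, []) s t (snd x))"])
        measurable
  qed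
  then have "(\<integral>\<^sup>+\<omega>. g (restricted_noise {Initial} \<omega>, restricted_noise ?B \<omega>) \<partial>P) = (\<integral>\<^sup>+\<omega>. \<integral>\<^sup>+\<omega>'. g (restricted_noise {Initial} \<omega>, restricted_noise ?B \<omega>') \<partial>P \<partial>P)"
    by (intro indep_var_nn_integral[OF indep_restricted_noise]) (use clocks_noise in auto)
  moreover have "g (restricted_noise {Initial} \<omega>, restricted_noise ?B \<omega>') = \<phi> (\<Sum>i<K \<omega>. num_descendants S n (s, i, []) s t (\<lambda>i. V i \<omega>'))" for \<omega> \<omega>'
    by (simp add: g_def K num_descendants_restricted_noise[OF sub])
  ultimately show ?thesis by (simp add: progeny_def)
qed

lemma measurable_progeny:
  assumes [measurable]: "K \<in> measurable P (count_space UNIV)"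
  shows "(\<lambda>x. progeny K S n s (fst x) (snd x)) \<in> borel_measurable (borel \<Otimes>\<^sub>M P)"
proof -
  have [measurable]: "(\<lambda>x. num_descendants S n (s, i, []) s (fst x) (\<lambda>i. V i (snd x))) \<in> borel_measurable (borel \<Otimes>\<^sub>M P)" for i
    by (rule measurable_num_descendants_V) auto
  show ?thesis
    unfolding progeny_def
    by (rule measurable_compose_countable[where f = "\<lambda>k x. (\<Sum>i<k. num_descendants S n (s, i, []) s (fst x) (\<lambda>i. V i (snd x)))"])
      measurable
qed

text \<open>Wald's identity, with the mean of a single progeny replaced by its upper bound.\<close>

lemma progeny_mean_le:
  assumes K: "\<And>\<omega>. V Initial \<omega> = real (K \<omega>)" and [measurable]: "K \<in> measurable P (count_space UNIV)"
    and m: "mean_solution c c' S m" and t: "0 \<le> t"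
  shows "(\<integral>\<^sup>+\<omega>. progeny K S n s t \<omega> \<partial>P) \<le> (\<integral>\<^sup>+\<omega>. of_nat (K \<omega>) \<partial>P) * ennreal (m s t)"
proof -
  have "(\<integral>\<^sup>+\<omega>. progeny K S n s t \<omega> \<partial>P) =
      (\<integral>\<^sup>+\<omega>. (\<integral>\<^sup>+\<omega>'. (\<Sum>i<K \<omega>. num_descendants S n (s, i, []) s t (\<lambda>i. V i \<omega>')) \<partial>P) \<partial>P)"
    using progeny_integral[OF K, of "\<lambda>x. x"] by simp
  also have "\<dots> \<le> (\<integral>\<^sup>+\<omega>. of_nat (K \<omega>) * ennreal (m s t) \<partial>P)"
  proof (rule nn_integral_mono)
    fix \<omega>
    have "(\<Sum>i<K \<omega>. mean_num S n (s, i, []) s t) \<le> of_nat (card {..<K \<omega>}) * ennreal (m s t)"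
      by (rule sum_bounded_above) (rule mean_num_le[OF m t])
    then show "(\<integral>\<^sup>+\<omega>'. (\<Sum>i<K \<omega>. num_descendants S n (s, i, []) s t (\<lambda>i. V i \<omega>')) \<partial>P) \<le> of_nat (K \<omega>) * ennreal (m s t)"
      by (simp add: nn_integral_sum)
  qed
  finally show ?thesis by (simp add: nn_integral_multc)
qed

lemma progeny_mean_ge:
  assumes K: "\<And>\<omega>. V Initial \<omega> = real (K \<omega>)" and [measurable]: "K \<in> measurable P (count_space UNIV)"
    and m: "mean_solution c c' S m" and t: "0 \<le> t"
  shows "(\<integral>\<^sup>+\<omega>. of_nat (K \<omega>) \<partial>P) * ennreal (m s t) \<le> (\<integral>\<^sup>+\<omega>. progeny K S n s t \<omega> \<partial>P) +
    (\<integral>\<^sup>+\<omega>. of_nat (K \<omega>) \<partial>P) * ennreal ((1 - exp (- (\<gamma> + c + c') * t)) ^ n)"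
proof -
  let ?q = "ennreal ((1 - exp (- (\<gamma> + c + c') * t)) ^ n)"
  have meas: "(\<lambda>\<omega>. \<integral>\<^sup>+\<omega>'. (\<Sum>i<K \<omega>. num_descendants S n (s, i, []) s t (\<lambda>i. V i \<omega>')) \<partial>P) \<in> borel_measurable P"
    by (rule measurable_compose_countable[where f = "\<lambda>k \<omega>. \<integral>\<^sup>+\<omega>'. (\<Sum>i<k. num_descendants S n (s, i, []) s t (\<lambda>i. V i \<omega>')) \<partial>P"])
      measurable
  have "(\<integral>\<^sup>+\<omega>. of_nat (K \<omega>) * ennreal (m s t) \<partial>P) \<le>
    (\<integral>\<^sup>+\<omega>. (\<integral>\<^sup>+\<omega>'. (\<Sum>i<K \<omega>. num_descendants S n (s, i, []) s t (\<lambda>i. V i \<omega>')) \<partial>P) + of_nat (K \<omega>) * ?q \<partial>P)"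
  proof (rule nn_integral_mono)
    fix \<omega>
    have "of_nat (card {..<K \<omega>}) * ennreal (m s t) \<le> (\<Sum>i<K \<omega>. mean_num S n (s, i, []) s t + ?q)"
      by (rule sum_bounded_below) (rule mean_num_ge[OF m t order_refl])
    then show "of_nat (K \<omega>) * ennreal (m s t) \<le>
        (\<integral>\<^sup>+\<omega>'. (\<Sum>i<K \<omega>. num_descendants S n (s, i, []) s t (\<lambda>i. V i \<omega>')) \<partial>P) + of_nat (K \<omega>) * ?q"
      by (simp add: nn_integral_sum sum.distrib)
  qed
  also have "\<dots> = (\<integral>\<^sup>+\<omega>. progeny K S n s t \<omega> \<partial>P) + (\<integral>\<^sup>+\<omega>. of_nat (K \<omega>) \<partial>P) * ?q"
    using progeny_integral[OF K, of "\<lambda>x. x" S n s t] meas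
    by (simp add: nn_integral_add nn_integral_multc)
  finally show ?thesis by (simp add: nn_integral_multc)
qed

text \<open>In the expanded square, products of different progenies have mean at most 1 by
  independence, and only the diagonal feels the growing second moment.\<close>

lemma progeny_second_moment_le:
  assumes K: "\<And>\<omega>. V Initial \<omega> = real (K \<omega>)" and [measurable]: "K \<in> measurable P (count_space UNIV)"
    and t: "0 \<le> t"
  shows "(\<integral>\<^sup>+\<omega>. (progeny K UNIV n s t \<omega>)\<^sup>2 \<partial>P) \<le>
    (\<integral>\<^sup>+\<omega>. of_nat (K \<omega>) \<partial>P) * ennreal (1 + \<gamma> * t) + (\<integral>\<^sup>+\<omega>. (of_nat (K \<omega>))\<^sup>2 \<partial>P)"
proof -
  let ?Z = "\<lambda>i \<omega>. num_descendants UNIV n (s, i, []) s t (\<lambda>i. V i \<omega>)"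
  have ij: "(\<integral>\<^sup>+\<omega>. ?Z i \<omega> * ?Z j \<omega> \<partial>P) \<le> (if i = j then ennreal (1 + \<gamma> * t) else 0) + 1" for i j
  proof (cases "i = j")
    case True
    have "(\<integral>\<^sup>+\<omega>. ?Z j \<omega> * ?Z j \<omega> \<partial>P) \<le> ennreal (1 + \<gamma> * t)"
      using second_moment_le[OF t, of n "(s, j, [])" s] by (simp add: power2_eq_square)
    then show ?thesis using True by (simp add: add_increasing2)
  next
    case False
    then have "(\<integral>\<^sup>+\<omega>. ?Z i \<omega> * ?Z j \<omega> \<partial>P) = mean_num UNIV n (s, i, []) s t * mean_num UNIV n (s, j, []) s t"
      by (intro indep_subtrees disjoint_subtree_root) auto
    also have "\<dots> \<le> 1 * 1" by (intro mult_mono mean_num_total_le t zero_le)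
    finally show ?thesis using False by simp
  qed
  have "(\<integral>\<^sup>+\<omega>. (progeny K UNIV n s t \<omega>)\<^sup>2 \<partial>P) = (\<integral>\<^sup>+\<omega>. (\<integral>\<^sup>+\<omega>'. (\<Sum>i<K \<omega>. ?Z i \<omega>')\<^sup>2 \<partial>P) \<partial>P)"
    by (rule progeny_integral[OF K]) measurable
  also have "\<dots> \<le> (\<integral>\<^sup>+\<omega>. of_nat (K \<omega>) * ennreal (1 + \<gamma> * t) + (of_nat (K \<omega>))\<^sup>2 \<partial>P)"
  proof (rule nn_integral_mono)
    fix \<omega>
    have "(\<integral>\<^sup>+\<omega>'. (\<Sum>i<K \<omega>. ?Z i \<omega>')\<^sup>2 \<partial>P) = (\<Sum>i<K \<omega>. \<Sum>j<K \<omega>. \<integral>\<^sup>+\<omega>'. ?Z i \<omega>' * ?Z j \<omega>' \<partial>P)"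
      by (simp add: power2_eq_square sum_product nn_integral_sum)
    also have "\<dots> \<le> (\<Sum>i<K \<omega>. \<Sum>j<K \<omega>. (if i = j then ennreal (1 + \<gamma> * t) else 0) + 1)"
      by (intro sum_mono ij)
    also have "\<dots> = of_nat (K \<omega>) * ennreal (1 + \<gamma> * t) + (of_nat (K \<omega>))\<^sup>2"
      by (simp add: sum.distrib power2_eq_square distrib_left)
    finally show "(\<integral>\<^sup>+\<omega>'. (\<Sum>i<K \<omega>. ?Z i \<omega>')\<^sup>2 \<partial>P) \<le> \<dots>" .
  qed
  also have "\<dots> = (\<integral>\<^sup>+\<omega>. of_nat (K \<omega>) \<partial>P) * ennreal (1 + \<gamma> * t) + (\<integral>\<^sup>+\<omega>. (of_nat (K \<omega>))\<^sup>2 \<partial>P)"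
    by (simp add: nn_integral_add nn_integral_multc)
  finally show ?thesis .
qed

lemma AE_clocks_pos: "AE \<omega> in P. \<forall>u e. 0 < V (Clock u e) \<omega>"
proof -
  have "AE \<omega> in P. 0 < V (Clock u e) \<omega>" for u e
  proof -
    have "prob {\<omega> \<in> space P. 0 < V (Clock u e) \<omega>} = 1"
      using exponential_distributedD_gt[OF clock_distributed[of u e] order_refl rate_pos] by simp
    then show ?thesis by (subst (asm) prob_Collect_eq_1) auto
  qed
  \<comment> \<open>Indices and lists are countable, activities and events finitely many, so the
    exceptional null sets can be united.\<close>
  then have "AE \<omega> in P. \<forall>i w. \<forall>s\<in>{Dormant, Active}. \<forall>e\<in>{Split, Die, Sleep, Wake}. 0 < V (Clock (s, i, w) e) \<omega>"
    unfolding AE_all_countable by (intro allI AE_finite_allI) auto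
  then show ?thesis
  proof (rule AE_mp, intro AE_I2 impI allI)
    fix \<omega> and u :: label and e
    assume *: "\<forall>i w. \<forall>s\<in>{Dormant, Active}. \<forall>e\<in>{Split, Die, Sleep, Wake}. 0 < V (Clock (s, i, w) e) \<omega>"
    have "fst u \<in> {Dormant, Active}" "e \<in> {Split, Die, Sleep, Wake}"
      by (cases "fst u"; simp) (cases e; simp)
    then show "0 < V (Clock u e) \<omega>" using * by (cases u) auto
  qed
qed

end

section \<open>The particle system as an instance of the clock model\<close>

definition noise_value :: "('w \<Rightarrow> nat) \<Rightarrow> (label \<Rightarrow> event \<Rightarrow> 'w \<Rightarrow> real) \<Rightarrow> noise \<Rightarrow> 'w \<Rightarrow> real" where
  "noise_value K T i \<omega> = (case i of Initial \<Rightarrow> real (K \<omega>) | Clock u e \<Rightarrow> T u e \<omega> | Motion u \<Rightarrow> 0)"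

lemma noise_value_simps [simp]:
  "noise_value K T Initial \<omega> = real (K \<omega>)" "noise_value K T (Clock u e) \<omega> = T u e \<omega>"
  by (simp_all add: noise_value_def)

text \<open>Each \<open>noise_value\<close> generates only events of the corresponding
  \<open>noise_events\<close>, and smaller families stay independent. Under \<open>Initial\<close>
  the numbers of both kinds of ancestors are available, so each kind gives an instance, with the
  same clocks. The value 0 at \<open>Motion\<close> is a default outside the index set.\<close>

lemma on_off_clocks_noise_value:
  assumes "prob_space P" and "0 < \<gamma>" "0 < c" "0 < c'"
    and N[measurable]: "N s \<in> measurable P (count_space UNIV)"
    and T: "\<And>u e. distributed P lborel (T u e) (exponential_density (event_rate \<gamma> c c' e))"
    and ind: "prob_space.indep_sets P (noise_events P N p T B) UNIV"
  shows "on_off_clocks P \<gamma> c c' (noise_value (N s) T)"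
proof -
  interpret prob_space P by fact
  have [measurable]: "T u e \<in> borel_measurable P" for u e
    using distributed_measurable[OF T[of u e]] by simp
  show ?thesis
  proof
    show "indep_vars (\<lambda>_. borel) (noise_value (N s) T) (- range Motion)"
      unfolding indep_vars_def2
    proof
      show "\<forall>i\<in>- range Motion. random_variable borel (noise_value (N s) T i)"
      proof
        fix i assume "i \<in> - range Motion"
        then show "random_variable borel (noise_value (N s) T i)"
          by (cases i) (auto simp: noise_value_def[abs_def])
      qed
      show "indep_sets (\<lambda>i. {noise_value (N s) T i -` A \<inter> space P |A. A \<in> sets borel}) (- range Motion)"
      proof (rule indep_sets_mono[OF ind])
        fix i assume i: "i \<in> - range Motion"
        show "{noise_value (N s) T i -` A \<inter> space P |A. A \<in> sets borel} \<subseteq> noise_events P N p T B i"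
        proof (cases i)
          case Initial
          have "noise_value (N s) T i -` A \<inter> space P \<in> noise_events P N p T B Initial" if "A \<in> sets borel" for A
          proof -
            have "noise_value (N s) T i -` A \<inter> space P = N s -` (real -` A) \<inter> space P"
              using Initial by auto
            also have "\<dots> \<in> generated_events P (range N)"
              unfolding generated_events_def
              by (rule sigma_sets.Basic) (use sets_borel_eq_count_space in auto)
            finally show ?thesis by (auto intro: sigma_sets.Basic)
          qed
          then show ?thesis using Initial by auto
        next
          case (Clock u e)
          then show ?thesis
            by (auto simp: generated_events_def noise_value_def[abs_def] intro: sigma_sets.Basic)
        next
          case (Motion u)
          then show ?thesis using i by auto
        qed
      qed auto
    qed
  qed (use assms in \<open>auto simp: noise_value_def[abs_def]\<close>)
qed

lemma poisson_moments:
  assumes "prob_space P" and [measurable]: "N \<in> measurable P (count_space UNIV)" and "0 \<le> l"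
    and p: "\<And>k. measure P {\<omega> \<in> space P. N \<omega> = k} = l ^ k / fact k * exp (- l)"
  shows "(\<integral>\<^sup>+\<omega>. of_nat (N \<omega>) \<partial>P) = ennreal l"
    and "(\<integral>\<^sup>+\<omega>. (of_nat (N \<omega>))\<^sup>2 \<partial>P) = ennreal (l + l\<^sup>2)"
proof -
  interpret prob_space P by fact
  \<comment> \<open>The factor \<open>exp (- l)\<close> is moved to the other side, so that plain
    exponential series remain to be summed.\<close>
  have *: "(\<integral>\<^sup>+\<omega>. ennreal (f (N \<omega>)) \<partial>P) = ennreal x"
    if f: "\<And>k. 0 \<le> f k" and x: "(\<lambda>k. f k * (l ^ k / fact k)) sums (x * exp l)" for f :: "nat \<Rightarrow> real" and x
  proof -
    have "(\<integral>\<^sup>+\<omega>. ennreal (f (N \<omega>)) \<partial>P) = (\<integral>\<^sup>+\<omega>. (\<Sum>k. ennreal (f k) * indicator {\<omega> \<in> space P. N \<omega> = k} \<omega>) \<partial>P)"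
    proof (rule nn_integral_cong)
      fix \<omega> assume "\<omega> \<in> space P"
      then have "(\<Sum>k. ennreal (f k) * indicator {\<omega> \<in> space P. N \<omega> = k} \<omega>) =
          (\<Sum>k\<in>{N \<omega>}. ennreal (f k) * indicator {\<omega> \<in> space P. N \<omega> = k} \<omega>)"
        by (intro suminf_finite) auto
      then show "ennreal (f (N \<omega>)) = (\<Sum>k. ennreal (f k) * indicator {\<omega> \<in> space P. N \<omega> = k} \<omega>)"
        using \<open>\<omega> \<in> space P\<close> by simp
    qed
    also have "\<dots> = (\<Sum>k. \<integral>\<^sup>+\<omega>. ennreal (f k) * indicator {\<omega> \<in> space P. N \<omega> = k} \<omega> \<partial>P)"
      by (rule nn_integral_suminf) measurable
    also have "\<dots> = (\<Sum>k. ennreal (f k * (l ^ k / fact k) * exp (- l)))"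
      using f p \<open>0 \<le> l\<close> by (simp add: nn_integral_cmult_indicator emeasure_eq_measure ennreal_mult[symmetric] mult.assoc)
    also have "\<dots> = ennreal (x * exp l * exp (- l))"
      using sums_mult2[OF x, of "exp (- l)"] f \<open>0 \<le> l\<close>
      by (intro suminf_ennreal_eq) auto
    finally show ?thesis by (simp add: mult.assoc exp_minus)
  qed
  have e: "(\<lambda>k. l ^ k / fact k) sums exp l"
    using exp_converges[of l] by (simp add: field_simps)
  \<comment> \<open>Shifting the index cancels one factor of the factorial, and the term with index
    0 vanishes; for the squares below, the same shift leaves a combination of series already
    summed.\<close>
  have "(\<lambda>k. real (Suc k) * (l ^ Suc k / fact (Suc k))) sums (l * exp l)"
    using sums_mult[OF e, of l] by (simp add: field_simps del: of_nat_Suc)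
  then have e1: "(\<lambda>k. real k * (l ^ k / fact k)) sums (l * exp l)"
    by (subst (asm) sums_Suc_iff) simp
  have "(\<lambda>k. (real (Suc k))\<^sup>2 * (l ^ Suc k / fact (Suc k))) = (\<lambda>k. l * (real k * (l ^ k / fact k) + l ^ k / fact k))"
  proof
    fix k
    have "(real (Suc k))\<^sup>2 * (l ^ Suc k / fact (Suc k)) = real (Suc k) * (l * (l ^ k / fact k))"
      by (simp add: fact_Suc power2_eq_square del: of_nat_Suc)
    then show "(real (Suc k))\<^sup>2 * (l ^ Suc k / fact (Suc k)) = l * (real k * (l ^ k / fact k) + l ^ k / fact k)"
      by (simp add: algebra_simps add_divide_distrib)
  qed
  then have "(\<lambda>k. (real (Suc k))\<^sup>2 * (l ^ Suc k / fact (Suc k))) sums (l * (l * exp l + exp l))"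
    using sums_mult[OF sums_add[OF e1 e], of l] by simp
  then have e2: "(\<lambda>k. (real k)\<^sup>2 * (l ^ k / fact k)) sums ((l + l\<^sup>2) * exp l)"
    by (subst (asm) sums_Suc_iff) (simp add: algebra_simps power2_eq_square)
  show "(\<integral>\<^sup>+\<omega>. of_nat (N \<omega>) \<partial>P) = ennreal l"
    using *[OF _ e1] by (simp add: ennreal_of_nat_eq_real_of_nat)
  show "(\<integral>\<^sup>+\<omega>. (of_nat (N \<omega>))\<^sup>2 \<partial>P) = ennreal (l + l\<^sup>2)"
    using *[OF _ e2] by (simp add: ennreal_of_nat_eq_real_of_nat ennreal_power)
qed

fun component :: "activity \<Rightarrow> 'b \<times> 'b \<Rightarrow> 'b" where
  "component Dormant z = fst z"
| "component Active z = snd z"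

lemma population_0:
  assumes "\<And>u e. 0 < T u e"
  shows "population N T {s} (Suc n) 0 = of_nat (N s)"
proof -
  have "descendants T {s} (Suc n) u a 0 = {v. v = u \<and> a = s}" for u a
    using assms by (auto simp: not_le[symmetric])
  then have "card (descendants T {s} (Suc n) u a 0) = of_bool (a = s)" for u a
    by auto
  then show ?thesis
    unfolding population_def by (cases s) (simp_all del: descendants.simps)
qed

text \<open>With positive clocks only the ancestors are alive at time 0. This ties their numbers to
  the initial mass, whose law is Poisson.\<close>

lemma SUP_population_0:
  assumes "\<And>u e. 0 < T u e"
  shows "(SUP n. population N T {s} n 0) = of_nat (N s)"
proof (rule antisym)
  have "population N T {s} n 0 \<le> of_nat (N s)" for n
    by (cases n) (simp_all add: population_0[of T, OF assms], simp add: population_def)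
  then show "(SUP n. population N T {s} n 0) \<le> of_nat (N s)" by (rule SUP_least)
  show "of_nat (N s) \<le> (SUP n. population N T {s} n 0)"
    by (rule SUP_upper2[of 1]) (simp_all add: population_0[of T N s 0, OF assms, simplified])
qed

lemma population_mono: "S \<subseteq> S' \<Longrightarrow> population N T S n t \<le> population N T S' n t"
  unfolding population_def by (intro sum_mono of_nat_mono card_mono finite_descendants descendants_mono)

lemma incseq_population: "incseq (\<lambda>n. population N T S n t)"
  unfolding population_def
  by (intro incseq_SucI sum_mono of_nat_mono card_mono finite_descendants descendants_Suc)

lemma ennreal_power2_add_le: "(x + y)\<^sup>2 \<le> 2 * (x\<^sup>2 + y\<^sup>2)" for x y :: ennreal
proof -
  have le: "(x + y)\<^sup>2 \<le> 2 * (x\<^sup>2 + y\<^sup>2)" if "x \<le> y" for x y :: ennreal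
  proof (cases y)
    case top
    then show ?thesis by (simp add: power2_eq_square ennreal_mult_top)
  next
    case (real r)
    with that obtain q where q: "x = ennreal q" "0 \<le> q" by (cases x) (auto simp: top_unique)
    have "(q + r)\<^sup>2 \<le> 2 * (q\<^sup>2 + r\<^sup>2)" using sum_squares_bound[of q r] by (simp add: power2_sum)
    then show ?thesis using q real
      by (simp add: ennreal_power ennreal_plus[symmetric] ennreal_numeral[symmetric] ennreal_mult[symmetric] ennreal_leI
          del: ennreal_plus ennreal_numeral)
  qed
  show ?thesis using le[of x y] le[of y x] by (cases "x \<le> y") (auto simp: add.commute)
qed

text \<open>Positions and motions are discarded here: what remains of the particle system are the
  numbers of ancestors and the clocks. One family \<open>T\<close> of clocks serves both kinds of
  ancestors.\<close>

lemma ooBBM_representation: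
  assumes X: "ooBBM P \<gamma> c c' X" and pos: "0 < \<gamma>" "0 < c" "0 < c'"
  obtains N T where "\<And>s. N s \<in> measurable P (count_space UNIV)"
    and "\<And>s. on_off_clocks P \<gamma> c c' (noise_value (N s) T)"
    and "AE \<omega> in P. \<forall>b. \<forall>t\<ge>0. emeasure (component b (X \<omega> t)) UNIV =
      (SUP n. population (\<lambda>s. N s \<omega>) (\<lambda>u e. T u e \<omega>) {b} n t)"
    and "AE \<omega> in P. \<forall>s. measure (component s (X \<omega> 0)) UNIV = real (N s \<omega>)"
proof -
  obtain N p T B where ps: "prob_space P"
    and N: "\<And>s. N s \<in> measurable P (count_space UNIV)"
    and T: "\<And>u e. distributed P lborel (T u e) (exponential_density (event_rate \<gamma> c c' e))"
    and ind: "prob_space.indep_sets P (noise_events P N p T B) UNIV"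
    and eq: "AE \<omega> in P. \<forall>t\<ge>0. X \<omega> t =
      (let Z = configuration (\<lambda>s. N s \<omega>) (\<lambda>s i. p s i \<omega>) (\<lambda>u e. T u e \<omega>) (\<lambda>u r. B u r \<omega>)
       in (Z Dormant t, Z Active t))"
    using X unfolding ooBBM_def by blast
  have L: "on_off_clocks P \<gamma> c c' (noise_value (N s) T)" for s
    by (rule on_off_clocks_noise_value[OF ps pos N T ind])
  have T_pos: "AE \<omega> in P. \<forall>u e. 0 < T u e \<omega>"
    using on_off_clocks.AE_clocks_pos[OF L[of Active]] by simp
  have conf: "AE \<omega> in P. \<forall>b. \<forall>t\<ge>0. emeasure (component b (X \<omega> t)) UNIV =
      (SUP n. population (\<lambda>s. N s \<omega>) (\<lambda>u e. T u e \<omega>) {b} n t)"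
    using eq T_pos
  proof eventually_elim
    case (elim \<omega>)
    show ?case
    proof (intro allI impI)
      fix b and t :: real assume "0 \<le> t"
      have "component b (X \<omega> t) = configuration (\<lambda>s. N s \<omega>) (\<lambda>s i. p s i \<omega>) (\<lambda>u e. T u e \<omega>) (\<lambda>u r. B u r \<omega>) b t"
        using elim(1) \<open>0 \<le> t\<close> by (cases b) (auto simp: Let_def)
      then show "emeasure (component b (X \<omega> t)) UNIV =
          (SUP n. population (\<lambda>s. N s \<omega>) (\<lambda>u e. T u e \<omega>) {b} n t)"
        using emeasure_configuration[of "\<lambda>u e. T u e \<omega>" t "\<lambda>s. N s \<omega>"] elim(2) \<open>0 \<le> t\<close> by simp
    qed
  qed
  moreover have "AE \<omega> in P. \<forall>s. measure (component s (X \<omega> 0)) UNIV = real (N s \<omega>)"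
    using conf T_pos
  proof eventually_elim
    case (elim \<omega>)
    then have "\<And>u e. 0 < T u e \<omega>" by blast
    then have "(SUP n. population (\<lambda>s. N s \<omega>) (\<lambda>u e. T u e \<omega>) {s} n 0) = of_nat (N s \<omega>)" for s
      by (rule SUP_population_0)
    then show ?case
      using elim(1) by (simp add: measure_def ennreal_of_nat_eq_real_of_nat)
  qed
  ultimately show ?thesis by (rule that[where N = N and T = T, OF N L])
qed

text \<open>Chebyshev's argument: above \<open>K\<close>, x is at most x^2 / K. Thus second moments
  control the error of truncation.\<close>

lemma power2_over_dominates:
  fixes x :: ennreal
  assumes "0 < K"
  shows "x \<le> min x (ennreal K) + x\<^sup>2 / ennreal K"
proof (cases x)
  case (real r)
  have "r \<le> min r K + r\<^sup>2 / K"
  proof (cases "r \<le> K")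
    case False
    then have "r * K \<le> r\<^sup>2" using real by (simp add: power2_eq_square mult_left_mono)
    then have "r \<le> r\<^sup>2 / K" using assms by (simp add: pos_le_divide_eq)
    then show ?thesis using assms False by simp
  qed (use assms in simp)
  moreover have "min (ennreal r) (ennreal K) = ennreal (min r K)"
    using assms real by (auto simp: min_def ennreal_le_iff)
  ultimately show ?thesis
    using real assms by (simp add: ennreal_power divide_ennreal ennreal_plus[symmetric] ennreal_leI del: ennreal_plus)
next
  case top
  then show ?thesis using assms by (simp add: power2_eq_square ennreal_top_divide)
qed

text \<open>\<open>A\<close> is a jointly measurable version of the mass, as integration over time
  will require. For each kind, with \<open>mass s / \<epsilon>\<close> expected ancestors, the
  second moment is at most \<open>mass s / \<epsilon> * (1 + \<gamma> / \<epsilon> * t) + mass s /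
  \<epsilon> + (mass s / \<epsilon>)\<^sup>2\<close>; multiplied by \<epsilon>^2 this becomes
  \<open>mass s * (2 * \<epsilon> + \<gamma> * t) + (mass s)\<^sup>2\<close>, which is bounded for
  \<epsilon> \<le> 1. The outer factor 2 joins the two kinds by
  \<open>ennreal_power2_add_le\<close>.\<close>

lemma ooBBM_moments:
  fixes \<mu> :: "'a::euclidean_space measure \<times> 'a measure"
  defines "mass \<equiv> \<lambda>s. measure (component s \<mu>) UNIV"
  assumes X: "ooBBM P (\<gamma> / \<epsilon>) c c' X" and pos: "0 < \<gamma>" "0 < c" "0 < c'" and \<epsilon>: "0 < \<epsilon>" "\<epsilon> \<le> 1"
    and prm: "\<And>s. poisson_random_measure P (\<lambda>\<omega>. component s (X \<omega> 0)) (scale_measure (ennreal (1 / \<epsilon>)) (component s \<mu>))"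
    and m: "mean_solution c c' {b} m" and K: "0 < K"
  shows "\<exists>A. (\<lambda>x. A (fst x) (snd x)) \<in> borel_measurable (borel \<Otimes>\<^sub>M P) \<and>
    (AE \<omega> in P. \<forall>t\<ge>0. emeasure (component b (X \<omega> t)) UNIV = A t \<omega>) \<and>
    (\<forall>t. 0 \<le> t \<longrightarrow> t \<le> \<tau> \<longrightarrow>
      (\<integral>\<^sup>+\<omega>. ennreal \<epsilon> * A t \<omega> \<partial>P) \<le> ennreal (\<Sum>s\<in>{Dormant, Active}. mass s * m s t) \<and>
      ennreal (\<Sum>s\<in>{Dormant, Active}. mass s * m s t) \<le>
        (\<integral>\<^sup>+\<omega>. min (ennreal \<epsilon> * A t \<omega>) (ennreal K) \<partial>P) +
        ennreal (2 * (\<Sum>s\<in>{Dormant, Active}. mass s * (2 + \<gamma> * \<tau>) + (mass s)\<^sup>2)) / ennreal K)"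
proof -
  have "0 < \<gamma> / \<epsilon>" using pos \<epsilon> by simp
  obtain N T
    where N: "\<And>s. N s \<in> measurable P (count_space UNIV)"
    and L: "\<And>s. on_off_clocks P (\<gamma> / \<epsilon>) c c' (noise_value (N s) T)"
    and conf: "AE \<omega> in P. \<forall>b. \<forall>t\<ge>0. emeasure (component b (X \<omega> t)) UNIV =
      (SUP n. population (\<lambda>s. N s \<omega>) (\<lambda>u e. T u e \<omega>) {b} n t)"
    and init: "AE \<omega> in P. \<forall>s. measure (component s (X \<omega> 0)) UNIV = real (N s \<omega>)"
    by (rule ooBBM_representation[OF X \<open>0 < \<gamma> / \<epsilon>\<close> pos(2,3)]) blast
  interpret prob_space P using X by (simp add: ooBBM_def)
  let ?I = "{Dormant, Active}"
  define pr where "pr = (\<lambda>s. on_off_clocks.progeny (noise_value (N s) T) (N s))"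
  define pop where "pop = (\<lambda>S n t \<omega>. population (\<lambda>s. N s \<omega>) (\<lambda>u e. T u e \<omega>) S n t)"
  define A where "A = (\<lambda>t \<omega>. SUP n. pop {b} n t \<omega>)"
  have pop: "pop S n t \<omega> = (\<Sum>s\<in>?I. pr s S n s t \<omega>)" for S n t \<omega>
    unfolding pop_def population_def pr_def on_off_clocks.progeny_def[OF L] num_descendants_def by simp
  have pr_meas[measurable]: "(\<lambda>x. pr s S n s (fst x) (snd x)) \<in> borel_measurable (borel \<Otimes>\<^sub>M P)" for s S n
    unfolding pr_def by (rule on_off_clocks.measurable_progeny[OF L N])
  have pop_meas[measurable]: "(\<lambda>x. pop S n (fst x) (snd x)) \<in> borel_measurable (borel \<Otimes>\<^sub>M P)" for S n
    unfolding pop by measurable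
  have pr_meas'[measurable]: "pr s S n s t \<in> borel_measurable P" for s S n t
    using measurable_compose[OF measurable_Pair1'[of t borel P] pr_meas] by simp
  have pop_meas'[measurable]: "pop S n t \<in> borel_measurable P" for S n t
    unfolding pop[abs_def] by measurable
  have A_meas: "(\<lambda>x. A (fst x) (snd x)) \<in> borel_measurable (borel \<Otimes>\<^sub>M P)"
    unfolding A_def by measurable
  have A_meas'[measurable]: "A t \<in> borel_measurable P" for t
    unfolding A_def[abs_def] by measurable
  have mass: "0 \<le> mass s" for s by (simp add: mass_def)
  have m0: "0 \<le> m s t" if "0 \<le> t" for s t using m that by (simp add: mean_solution_def)
  have dist: "measure P {\<omega> \<in> space P. N s \<omega> = k} = (mass s / \<epsilon>) ^ k / fact k * exp (- (mass s / \<epsilon>))" for s k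
  proof -
    have "measure P {\<omega> \<in> space P. N s \<omega> = k} =
        measure P {\<omega> \<in> space P. measure (component s (X \<omega> 0)) UNIV = real k}"
    proof (rule measure_eq_AE)
      show "AE \<omega> in P. (\<omega> \<in> {\<omega> \<in> space P. N s \<omega> = k}) =
          (\<omega> \<in> {\<omega> \<in> space P. measure (component s (X \<omega> 0)) UNIV = real k})"
        using init by eventually_elim auto
      show "{\<omega> \<in> space P. N s \<omega> = k} \<in> sets P" using N by measurable
      have [measurable]: "(\<lambda>\<omega>. measure (component s (X \<omega> 0)) UNIV) \<in> borel_measurable P"
        using prm[of s, unfolded poisson_random_measure_def, THEN conjunct2, THEN conjunct1, THEN bspec, of UNIV]
        by simp
      show "{\<omega> \<in> space P. measure (component s (X \<omega> 0)) UNIV = real k} \<in> sets P" by measurable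
    qed
    also have "\<dots> = measure (scale_measure (ennreal (1 / \<epsilon>)) (component s \<mu>)) UNIV ^ k / fact k *
        exp (- measure (scale_measure (ennreal (1 / \<epsilon>)) (component s \<mu>)) UNIV)"
      using prm[of s, unfolded poisson_random_measure_def, THEN conjunct2, THEN conjunct1, THEN bspec, of UNIV]
      by simp
    also have "measure (scale_measure (ennreal (1 / \<epsilon>)) (component s \<mu>)) UNIV = mass s / \<epsilon>"
      using \<epsilon> by (simp add: mass_def measure_scale_measure)
    finally show ?thesis .
  qed
  have lam: "0 \<le> mass s / \<epsilon>" for s using mass \<epsilon> by simp
  note EN = poisson_moments[OF prob_space_axioms N lam dist]
  have V0: "noise_value (N s) T Initial \<omega> = real (N s \<omega>)" for s \<omega> by simp
  let ?\<mu> = "\<lambda>t. \<Sum>s\<in>?I. mass s * m s t"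
  let ?C = "2 * (\<Sum>s\<in>?I. mass s * (2 + \<gamma> * \<tau>) + (mass s)\<^sup>2)"
  have up: "(\<integral>\<^sup>+\<omega>. ennreal \<epsilon> * A t \<omega> \<partial>P) \<le> ennreal (?\<mu> t)" if t: "0 \<le> t" for t
  proof -
    have "(\<integral>\<^sup>+\<omega>. A t \<omega> \<partial>P) = (SUP n. \<integral>\<^sup>+\<omega>. pop {b} n t \<omega> \<partial>P)"
      unfolding A_def
    proof (rule nn_integral_monotone_convergence_SUP)
      show "incseq (\<lambda>n. pop {b} n t)"
        using incseq_population by (auto simp: pop_def incseq_def le_fun_def)
    qed simp
    moreover have "ennreal \<epsilon> * (\<integral>\<^sup>+\<omega>. pop {b} n t \<omega> \<partial>P) \<le> ennreal (?\<mu> t)" for n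
    proof -
      have "(\<integral>\<^sup>+\<omega>. pop {b} n t \<omega> \<partial>P) = (\<Sum>s\<in>?I. \<integral>\<^sup>+\<omega>. pr s {b} n s t \<omega> \<partial>P)"
        unfolding pop by (rule nn_integral_sum) simp
      also have "\<dots> \<le> (\<Sum>s\<in>?I. ennreal (mass s / \<epsilon>) * ennreal (m s t))"
        unfolding EN(1)[symmetric] pr_def
        by (intro sum_mono on_off_clocks.progeny_mean_le[OF L V0 N m t])
      also have "\<dots> = ennreal (\<Sum>s\<in>?I. mass s / \<epsilon> * m s t)"
        using lam m0[OF t] mass \<epsilon> by (simp add: ennreal_mult'[symmetric])
      finally have "ennreal \<epsilon> * (\<integral>\<^sup>+\<omega>. pop {b} n t \<omega> \<partial>P) \<le> ennreal \<epsilon> * \<dots>"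
        by (rule mult_left_mono) simp
      also have "\<dots> = ennreal (?\<mu> t)"
        using \<epsilon> by (simp add: ennreal_mult'[symmetric] distrib_left)
      finally show ?thesis .
    qed
    ultimately show ?thesis
      by (simp add: nn_integral_cmult SUP_mult_left_ennreal SUP_least)
  qed
  have lo: "ennreal (?\<mu> t) \<le> (\<integral>\<^sup>+\<omega>. min (ennreal \<epsilon> * A t \<omega>) (ennreal K) \<partial>P) + ennreal ?C / ennreal K"
    if t: "0 \<le> t" "t \<le> \<tau>" for t
  proof -
    \<comment> \<open>This number depends on \<epsilon>, which does no harm: \<open>n\<close> tends
      to infinity while \<epsilon> is fixed.\<close>
    define q where "q = 1 - exp (- (\<gamma> / \<epsilon> + c + c') * t)"
    have "0 \<le> (\<gamma> / \<epsilon> + c + c') * t" using pos \<epsilon> t by simp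
    then have q: "0 \<le> q" "q < 1" by (simp_all add: q_def algebra_simps)
    have sq: "(\<integral>\<^sup>+\<omega>. (ennreal \<epsilon> * pop UNIV n t \<omega>)\<^sup>2 \<partial>P) \<le> ennreal ?C" for n
    proof -
      have "(\<integral>\<^sup>+\<omega>. (pop UNIV n t \<omega>)\<^sup>2 \<partial>P) \<le> (\<integral>\<^sup>+\<omega>. 2 * (\<Sum>s\<in>?I. (pr s UNIV n s t \<omega>)\<^sup>2) \<partial>P)"
        unfolding pop using ennreal_power2_add_le by (intro nn_integral_mono) simp
      also have "\<dots> = 2 * (\<Sum>s\<in>?I. \<integral>\<^sup>+\<omega>. (pr s UNIV n s t \<omega>)\<^sup>2 \<partial>P)"
        by (subst nn_integral_cmult) (simp_all add: nn_integral_add)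
      also have "\<dots> \<le> 2 * (\<Sum>s\<in>?I. ennreal (mass s / \<epsilon>) * ennreal (1 + \<gamma> / \<epsilon> * t) + ennreal (mass s / \<epsilon> + (mass s / \<epsilon>)\<^sup>2))"
        unfolding EN(1)[symmetric] EN(2)[symmetric] pr_def
        by (intro mult_left_mono sum_mono on_off_clocks.progeny_second_moment_le[OF L V0 N t(1)]) simp
      also have "\<dots> = ennreal (2 * (\<Sum>s\<in>?I. mass s / \<epsilon> * (1 + \<gamma> / \<epsilon> * t) + (mass s / \<epsilon> + (mass s / \<epsilon>)\<^sup>2)))"
      proof -
        have "0 \<le> 1 + \<gamma> / \<epsilon> * t" using pos \<epsilon> t by simp
        then have "ennreal (mass s / \<epsilon>) * ennreal (1 + \<gamma> / \<epsilon> * t) + ennreal (mass s / \<epsilon> + (mass s / \<epsilon>)\<^sup>2) =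
            ennreal (mass s / \<epsilon> * (1 + \<gamma> / \<epsilon> * t) + (mass s / \<epsilon> + (mass s / \<epsilon>)\<^sup>2))"
          and "0 \<le> mass s / \<epsilon> * (1 + \<gamma> / \<epsilon> * t) + (mass s / \<epsilon> + (mass s / \<epsilon>)\<^sup>2)" for s
          using lam[of s] by (simp_all only: ennreal_mult[symmetric] ennreal_plus[symmetric] mult_nonneg_nonneg add_nonneg_nonneg zero_le_power2)
        then show ?thesis
          by (simp only: sum_ennreal ennreal_numeral[symmetric] ennreal_mult[symmetric] sum_nonneg zero_le_numeral)
      qed
      finally have "ennreal (\<epsilon>\<^sup>2) * (\<integral>\<^sup>+\<omega>. (pop UNIV n t \<omega>)\<^sup>2 \<partial>P) \<le> ennreal (\<epsilon>\<^sup>2) * \<dots>"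
        by (rule mult_left_mono) simp
      also have "\<dots> = ennreal (2 * (\<Sum>s\<in>?I. mass s * (2 * \<epsilon> + \<gamma> * t) + (mass s)\<^sup>2))"
      proof -
        have "\<epsilon>\<^sup>2 * (mass s / \<epsilon> * (1 + \<gamma> / \<epsilon> * t) + (mass s / \<epsilon> + (mass s / \<epsilon>)\<^sup>2)) = mass s * (2 * \<epsilon> + \<gamma> * t) + (mass s)\<^sup>2" for s
          using \<epsilon> by (simp add: field_simps power2_eq_square)
        then show ?thesis
          by (simp only: ennreal_mult'[symmetric] zero_le_power2 mult.left_commute[of _ 2] sum_distrib_left[of "\<epsilon>\<^sup>2"])
      qed
      also have "\<dots> \<le> ennreal ?C"
        using pos \<epsilon> t mass by (intro ennreal_leI mult_left_mono sum_mono add_right_mono add_mono) auto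
      finally show ?thesis
        using \<epsilon> by (simp add: power_mult_distrib nn_integral_cmult ennreal_power)
    qed
    have step: "ennreal (?\<mu> t) \<le> (\<integral>\<^sup>+\<omega>. min (ennreal \<epsilon> * A t \<omega>) (ennreal K) \<partial>P) + ennreal ?C / ennreal K
        + ennreal ((\<Sum>s\<in>?I. mass s) * q ^ n)" for n
    proof -
      have "(\<Sum>s\<in>?I. ennreal (mass s / \<epsilon>) * ennreal (m s t)) \<le>
          (\<Sum>s\<in>?I. (\<integral>\<^sup>+\<omega>. pr s {b} n s t \<omega> \<partial>P) + ennreal (mass s / \<epsilon>) * ennreal (q ^ n))"
        unfolding EN(1)[symmetric] pr_def q_def
        by (intro sum_mono on_off_clocks.progeny_mean_ge[OF L V0 N m t(1)])
      also have "\<dots> = (\<integral>\<^sup>+\<omega>. pop {b} n t \<omega> \<partial>P) + ennreal (\<Sum>s\<in>?I. mass s / \<epsilon> * q ^ n)"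
      proof -
        have "(\<integral>\<^sup>+\<omega>. pop {b} n t \<omega> \<partial>P) = (\<Sum>s\<in>?I. \<integral>\<^sup>+\<omega>. pr s {b} n s t \<omega> \<partial>P)"
          unfolding pop by (rule nn_integral_sum) simp
        then show ?thesis
          using lam q by (simp only: sum.distrib ennreal_mult[symmetric] sum_ennreal mult_nonneg_nonneg zero_le_power)
      qed
      also have "(\<Sum>s\<in>?I. ennreal (mass s / \<epsilon>) * ennreal (m s t)) = ennreal (\<Sum>s\<in>?I. mass s / \<epsilon> * m s t)"
        using lam m0[OF t(1)] by (simp only: ennreal_mult[symmetric] sum_ennreal mult_nonneg_nonneg)
      finally have "ennreal \<epsilon> * ennreal (\<Sum>s\<in>?I. mass s / \<epsilon> * m s t) \<le>
          ennreal \<epsilon> * ((\<integral>\<^sup>+\<omega>. pop {b} n t \<omega> \<partial>P) + ennreal (\<Sum>s\<in>?I. mass s / \<epsilon> * q ^ n))"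
        by (rule mult_left_mono) simp
      then have "ennreal (?\<mu> t) \<le> (\<integral>\<^sup>+\<omega>. ennreal \<epsilon> * pop {b} n t \<omega> \<partial>P) + ennreal ((\<Sum>s\<in>?I. mass s) * q ^ n)"
        using \<epsilon> by (simp add: ennreal_mult'[symmetric] distrib_left distrib_right nn_integral_cmult)
      also have "(\<integral>\<^sup>+\<omega>. ennreal \<epsilon> * pop {b} n t \<omega> \<partial>P) \<le>
          (\<integral>\<^sup>+\<omega>. min (ennreal \<epsilon> * A t \<omega>) (ennreal K) + (ennreal \<epsilon> * pop UNIV n t \<omega>)\<^sup>2 / ennreal K \<partial>P)"
      proof (rule nn_integral_mono)
        fix \<omega>
        have "ennreal \<epsilon> * pop {b} n t \<omega> \<le> min (ennreal \<epsilon> * pop {b} n t \<omega>) (ennreal K) + (ennreal \<epsilon> * pop {b} n t \<omega>)\<^sup>2 / ennreal K"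
          by (rule power2_over_dominates[OF K])
        \<comment> \<open>The quadratic error is enlarged to the population of both activities,
          whose second moment has been bounded.\<close>
        also have "\<dots> \<le> min (ennreal \<epsilon> * A t \<omega>) (ennreal K) + (ennreal \<epsilon> * pop UNIV n t \<omega>)\<^sup>2 / ennreal K"
        proof (intro add_mono min.mono order_refl divide_right_mono_ennreal power_mono mult_left_mono zero_le)
          show "pop {b} n t \<omega> \<le> A t \<omega>" unfolding A_def by (rule SUP_upper) simp
          show "pop {b} n t \<omega> \<le> pop UNIV n t \<omega>" unfolding pop_def by (rule population_mono) simp
        qed
        finally show "ennreal \<epsilon> * pop {b} n t \<omega> \<le> \<dots>" .
      qed
      also have "\<dots> = (\<integral>\<^sup>+\<omega>. min (ennreal \<epsilon> * A t \<omega>) (ennreal K) \<partial>P) + (\<integral>\<^sup>+\<omega>. (ennreal \<epsilon> * pop UNIV n t \<omega>)\<^sup>2 \<partial>P) / ennreal K"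
        by (simp add: nn_integral_add nn_integral_divide)
      also have "\<dots> \<le> (\<integral>\<^sup>+\<omega>. min (ennreal \<epsilon> * A t \<omega>) (ennreal K) \<partial>P) + ennreal ?C / ennreal K"
        by (intro add_left_mono divide_right_mono_ennreal sq)
      finally show ?thesis by (simp add: add_right_mono)
    qed
    have "(\<lambda>n. ennreal ((\<Sum>s\<in>?I. mass s) * q ^ n)) \<longlonglongrightarrow> ennreal ((\<Sum>s\<in>?I. mass s) * 0)"
      using q by (intro tendsto_ennrealI tendsto_mult tendsto_const LIMSEQ_realpow_zero)
    then have "(\<lambda>n. (\<integral>\<^sup>+\<omega>. min (ennreal \<epsilon> * A t \<omega>) (ennreal K) \<partial>P) + ennreal ?C / ennreal K + ennreal ((\<Sum>s\<in>?I. mass s) * q ^ n))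
      \<longlonglongrightarrow> (\<integral>\<^sup>+\<omega>. min (ennreal \<epsilon> * A t \<omega>) (ennreal K) \<partial>P) + ennreal ?C / ennreal K + ennreal ((\<Sum>s\<in>?I. mass s) * 0)"
      by (intro tendsto_add tendsto_const)
    then show ?thesis using step by (intro LIMSEQ_le_const) auto
  qed
  have "AE \<omega> in P. \<forall>t\<ge>0. emeasure (component b (X \<omega> t)) UNIV = A t \<omega>"
    using conf unfolding A_def pop_def by eventually_elim auto
  then show ?thesis using A_meas up lo by blast
qed

section \<open>Occupation functionals on Skorokhod space\<close>

text \<open>Rational points in the gaps to the left of the elements of \<open>S\<close> give an
  injection into the rationals.\<close>

lemma countable_left_isolated:
  fixes S :: "real set"
  assumes "\<And>t. t \<in> S \<Longrightarrow> \<exists>\<delta>>0. {t - \<delta><..<t} \<inter> S = {}"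
  shows "countable S"
proof -
  have "\<exists>q. q \<in> \<rat> \<and> q < t \<and> {q<..<t} \<inter> S = {}" if "t \<in> S" for t
  proof -
    from assms[OF that] obtain \<delta> where \<delta>: "0 < \<delta>" "{t - \<delta><..<t} \<inter> S = {}" by blast
    obtain q where "q \<in> \<rat>" "t - \<delta> < q" "q < t" using Rats_dense_in_real[of "t - \<delta>" t] \<delta> by auto
    moreover from this have "{q<..<t} \<subseteq> {t - \<delta><..<t}" by auto
    ultimately show ?thesis using \<delta>(2) by blast
  qed
  then obtain q where q: "\<And>t. t \<in> S \<Longrightarrow> q t \<in> \<rat> \<and> q t < t \<and> {q t<..<t} \<inter> S = {}" by metis
  \<comment> \<open>If t < t', the gap of t' contains no element of \<open>S\<close>, so that q t <
    t \<le> q t'.\<close>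
  have less: "q t \<noteq> q t'" if "t \<in> S" "t' \<in> S" "t < t'" for t t'
    using q[OF that(1)] q[OF that(2)] that by auto
  have "inj_on q S"
  proof (rule inj_onI)
    fix t t' assume "t \<in> S" "t' \<in> S" "q t = q t'"
    then show "t = t'" using less[of t t'] less[of t' t] by (cases t t' rule: linorder_cases) auto
  qed
  moreover have "q ` S \<subseteq> \<rat>" using q by auto
  ultimately show ?thesis
    using countable_rat countable_subset countable_image_inj_on by blast
qed

text \<open>At a jump some rational p separates the left limit from the value. For fixed p and a
  fixed direction such times are isolated from the left: just before one of them the function lies
  on the other side of p.\<close>

lemma countable_jumps:
  fixes g :: "real \<Rightarrow> real"
  assumes "\<And>t. 0 < t \<Longrightarrow> \<exists>l. (g \<longlongrightarrow> l) (at_left t)"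
  shows "countable {t. 0 < t \<and> \<not> (g \<longlongrightarrow> g t) (at_left t)}"
proof -
  let ?A = "\<lambda>p. {t. eventually (\<lambda>r. g r < p) (at_left t) \<and> p < g t}"
  let ?B = "\<lambda>p. {t. eventually (\<lambda>r. p < g r) (at_left t) \<and> g t < p}"
  have ex: "\<exists>\<delta>>0. \<forall>r\<in>{t - \<delta><..<t}. Q r" if "eventually Q (at_left t)" for Q and t :: real
  proof -
    from that obtain b where "b < t" "\<forall>y>b. y < t \<longrightarrow> Q y"
      unfolding eventually_at_left_field by blast
    then show ?thesis by (intro exI[of _ "t - b"]) auto
  qed
  have "countable (?A p)" for p
  proof (rule countable_left_isolated)
    fix t assume "t \<in> ?A p"
    then obtain \<delta> where "0 < \<delta>" "\<forall>r\<in>{t - \<delta><..<t}. g r < p" using ex[of "\<lambda>r. g r < p" t] by auto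
    then show "\<exists>\<delta>>0. {t - \<delta><..<t} \<inter> ?A p = {}"
      by (intro exI[of _ \<delta>]) (auto dest: less_asym)
  qed
  moreover have "countable (?B p)" for p
  proof (rule countable_left_isolated)
    fix t assume "t \<in> ?B p"
    then obtain \<delta> where "0 < \<delta>" "\<forall>r\<in>{t - \<delta><..<t}. p < g r" using ex[of "\<lambda>r. p < g r" t] by auto
    then show "\<exists>\<delta>>0. {t - \<delta><..<t} \<inter> ?B p = {}"
      by (intro exI[of _ \<delta>]) (auto dest: less_asym)
  qed
  ultimately have "countable (\<Union>p\<in>\<rat>. ?A p \<union> ?B p)"
    using countable_rat by auto
  moreover have "{t. 0 < t \<and> \<not> (g \<longlongrightarrow> g t) (at_left t)} \<subseteq> (\<Union>p\<in>\<rat>. ?A p \<union> ?B p)"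
  proof
    fix t assume "t \<in> {t. 0 < t \<and> \<not> (g \<longlongrightarrow> g t) (at_left t)}"
    then obtain l where l: "(g \<longlongrightarrow> l) (at_left t)" and "l \<noteq> g t" using assms[of t] by auto
    then consider "l < g t" | "g t < l" by linarith
    then show "t \<in> (\<Union>p\<in>\<rat>. ?A p \<union> ?B p)"
    proof cases
      case 1
      then obtain p where "p \<in> \<rat>" "l < p" "p < g t" using Rats_dense_in_real by blast
      then show ?thesis using order_tendstoD(2)[OF l, of p] by auto
    next
      case 2
      then obtain p where "p \<in> \<rat>" "g t < p" "p < l" using Rats_dense_in_real by blast
      then show ?thesis using order_tendstoD(1)[OF l, of p] by auto
    qed
  qed
  ultimately show ?thesis by (rule countable_subset[rotated])
qed

section \<open>Total mass along cadlag paths\<close>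

abbreviation measure_pairs :: "('a::euclidean_space measure \<times> 'a measure) topology" where
  "measure_pairs \<equiv> prod_topology weak_topology weak_topology"

definition total_mass :: "activity \<Rightarrow> 'a::euclidean_space measure \<times> 'a measure \<Rightarrow> real" where
  "total_mass b z = measure (component b z) UNIV"

lemma total_mass_nonneg [simp]: "0 \<le> total_mass b z"
  by (simp add: total_mass_def)

lemma norm_truncated_le:
  "0 < K \<Longrightarrow> norm (indicator A r * min (total_mass b z) K) \<le> K * indicator A r"
  by (cases "r \<in> A") (simp_all add: abs_of_nonneg)

text \<open>The total mass integrates the constant 1, which is bounded and continuous.\<close>

lemma continuous_map_total_mass: "continuous_map measure_pairs euclideanreal (total_mass b)"
proof -
  have "continuous_map weak_topology euclideanreal (\<lambda>\<nu>. measure \<nu> (UNIV :: 'a set))"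
    unfolding continuous_map_def
  proof (intro conjI allI impI)
    fix U :: "real set" assume "openin euclideanreal U"
    then have "open U" by simp
    have "{\<nu> \<in> topspace weak_topology. measure \<nu> (UNIV :: 'a set) \<in> U} =
        {\<nu> \<in> finite_borel_measures. (\<integral>x. 1 \<partial>\<nu>) \<in> U}"
      unfolding topspace_weak_topology
      by (auto simp: finite_borel_measures_def dest: sets_eq_imp_space_eq)
    also have "openin weak_topology \<dots>"
      unfolding weak_topology_def
      by (rule topology_generated_by_Basis, rule CollectI, rule exI[of _ "\<lambda>_. 1"], rule exI[of _ U])
        (use \<open>open U\<close> in auto)
    finally show "openin weak_topology {\<nu> \<in> topspace weak_topology. measure \<nu> (UNIV :: 'a set) \<in> U}" .
  qed simp
  then have "continuous_map measure_pairs euclideanreal ((\<lambda>\<nu>. measure \<nu> (UNIV :: 'a set)) \<circ> fst)"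
    and "continuous_map measure_pairs euclideanreal ((\<lambda>\<nu>. measure \<nu> (UNIV :: 'a set)) \<circ> snd)"
    using continuous_map_fst continuous_map_snd continuous_map_compose by blast+
  moreover have "total_mass b = (\<lambda>\<nu>. measure \<nu> (UNIV :: 'a set)) \<circ> (case b of Dormant \<Rightarrow> fst | Active \<Rightarrow> snd)"
    by (cases b) (auto simp: total_mass_def[abs_def])
  ultimately show ?thesis by (cases b) auto
qed

lemma cadlag_total_mass:
  assumes x: "x \<in> cadlag_paths measure_pairs"
  shows "0 \<le> t \<Longrightarrow> ((\<lambda>r. total_mass b (x r)) \<longlongrightarrow> total_mass b (x t)) (at_right t)"
    and "0 < t \<Longrightarrow> \<exists>l. limitin measure_pairs x l (at_left t) \<and> ((\<lambda>r. total_mass b (x r)) \<longlongrightarrow> total_mass b l) (at_left t)"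
proof -
  have lim: "((\<lambda>r. total_mass b (x r)) \<longlongrightarrow> total_mass b l) F" if "limitin measure_pairs x l F" for l F
    using continuous_map_limit[OF continuous_map_total_mass that, of b] by (simp add: o_def)
  show "0 \<le> t \<Longrightarrow> ((\<lambda>r. total_mass b (x r)) \<longlongrightarrow> total_mass b (x t)) (at_right t)"
    using x lim by (auto simp: cadlag_paths_def)
  show "0 < t \<Longrightarrow> \<exists>l. limitin measure_pairs x l (at_left t) \<and> ((\<lambda>r. total_mass b (x r)) \<longlongrightarrow> total_mass b l) (at_left t)"
    using x lim unfolding cadlag_paths_def by blast
qed

lemma cadlag_countable_jumps:
  assumes x: "x \<in> cadlag_paths measure_pairs"
  shows "countable {t. 0 < t \<and> \<not> ((\<lambda>r. total_mass b (x r)) \<longlongrightarrow> total_mass b (x t)) (at_left t)}"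
  by (rule countable_jumps) (use cadlag_total_mass(2)[OF x] in blast)

text \<open>The mass is continuous off its countably many jumps. Paths are \<open>undefined\<close>
  at negative times, hence the cut-off, which makes 0 one more exceptional point.\<close>

lemma measurable_cadlag_total_mass:
  assumes x: "x \<in> cadlag_paths measure_pairs"
  shows "(\<lambda>r. if 0 \<le> r then total_mass b (x r) else 0) \<in> borel_measurable borel" (is "?g \<in> _")
proof (rule borel_measurable_continuous_countable_exceptions)
  let ?J = "insert 0 {t. 0 < t \<and> \<not> ((\<lambda>r. total_mass b (x r)) \<longlongrightarrow> total_mass b (x t)) (at_left t)}"
  show "countable ?J" using cadlag_countable_jumps[OF x] by simp
  show "continuous_on (- ?J) ?g"
  proof (intro continuous_at_imp_continuous_on ballI)
    fix t assume t: "t \<in> - ?J"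
    show "isCont ?g t"
    proof (cases "0 < t")
      case True
      have "eventually (\<lambda>r. total_mass b (x r) = ?g r) (nhds t)"
        by (rule eventually_mono[OF eventually_nhds_in_open[of "{0<..}"]]) (use True in auto)
      then have ev: "eventually (\<lambda>r. total_mass b (x r) = ?g r) (at t)"
        by (rule filter_leD[OF at_within_le_nhds])
      have "((\<lambda>r. total_mass b (x r)) \<longlongrightarrow> total_mass b (x t)) (at t)"
        using t True cadlag_total_mass(1)[OF x, of t b] by (intro filterlim_split_at) auto
      then show ?thesis
        unfolding isCont_def using tendsto_cong[OF ev] True by simp
    next
      case False
      then have "t < 0" using t by auto
      have "eventually (\<lambda>r. ?g r = 0) (nhds t)"
        by (rule eventually_mono[OF eventually_nhds_in_open[of "{..<0}"]]) (use \<open>t < 0\<close> in auto)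
      then show ?thesis using isCont_cong[of ?g "\<lambda>_. 0" t] by simp
    qed
  qed
qed

text \<open>The path \<open>x\<close> itself may jump at \<open>r\<close>, as long as its total mass does not: both one-sided limits
  of \<open>x\<close> at \<open>r\<close> then have the same total mass.\<close>

lemma skorokhod_total_mass_convergent:
  assumes x: "x \<in> cadlag_paths measure_pairs" and xs: "range xs \<subseteq> cadlag_paths measure_pairs"
    and conv: "skorokhod_convergent measure_pairs xs x"
    and r: "0 < r" and left: "((\<lambda>r. total_mass b (x r)) \<longlongrightarrow> total_mass b (x r)) (at_left r)"
  shows "(\<lambda>n. total_mass b (xs n r)) \<longlonglongrightarrow> total_mass b (x r)"
proof (rule topological_tendstoI)
  \<comment> \<open>Keeps \<open>topspace ?E\<close> in the form in which the metric facts are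
    stated.\<close>
  note topspace_prod_topology [simp del]
  fix U :: "real set" assume U: "open U" "total_mass b (x r) \<in> U"
  let ?E = "measure_pairs :: ('a measure \<times> 'a measure) topology"
  obtain d lam where "Metric_space (topspace ?E) d" and top: "Metric_space.mtopology (topspace ?E) d = ?E"
    and bij: "\<And>n. bij_betw (lam n) {0..} {0..}"
    and lam: "uniform_limit {0..} lam (\<lambda>s. s) sequentially"
    and dist: "\<And>T. uniform_limit {0..T} (\<lambda>n s. d (xs n (lam n s)) (x s)) (\<lambda>_. 0) sequentially"
    using conv unfolding skorokhod_convergent_def by blast
  interpret Metric_space "topspace ?E" d by fact
  have x_in: "x t \<in> topspace ?E" if "0 \<le> t" for t using x that by (auto simp: cadlag_paths_def)
  have xs_in: "xs n t \<in> topspace ?E" if "0 \<le> t" for n t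
  proof -
    have "xs n \<in> cadlag_paths ?E" using xs by auto
    then show ?thesis using that by (auto simp: cadlag_paths_def)
  qed
  have ob: "openin ?E (mball z e)" for z e using openin_mball[of z e] unfolding top .
  define W where "W = {z \<in> topspace ?E. total_mass b z \<in> U}"
  have "openin mtopology W"
    unfolding W_def top using continuous_map_total_mass[of b] U(1) by (auto simp: continuous_map_def)
  then have ball: "\<exists>e>0. mball z e \<subseteq> W" if "z \<in> W" for z
    using that unfolding openin_mtopology by blast
  obtain l where l: "limitin ?E x l (at_left r)"
    and gl: "((\<lambda>r. total_mass b (x r)) \<longlongrightarrow> total_mass b l) (at_left r)"
    using cadlag_total_mass(2)[OF x r] by blast
  have "total_mass b l = total_mass b (x r)"
    using tendsto_unique[OF _ gl left] by simp
  then have "l \<in> W" using limitin_topspace[OF l] U(2) by (simp add: W_def)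
  then obtain e2 where e2: "0 < e2" "mball l e2 \<subseteq> W" using ball by blast
  have "x r \<in> W" using x_in[of r] r U(2) by (simp add: W_def)
  then obtain e1 where e1: "0 < e1" "mball (x r) e1 \<subseteq> W" using ball by blast
  have lim_r: "limitin ?E x (x r) (at_right r)" using x r by (simp add: cadlag_paths_def)
  have centre: "x r \<in> mball (x r) (e1 / 2)"
    unfolding centre_in_mball_iff using x_in[OF less_imp_le[OF r]] e1(1) by simp
  have "eventually (\<lambda>s. x s \<in> mball (x r) (e1 / 2)) (at_right r)"
    by (rule limitinD[OF lim_r ob centre])
  then obtain u where u: "r < u" "\<And>s. r < s \<Longrightarrow> s < u \<Longrightarrow> x s \<in> mball (x r) (e1 / 2)"
    unfolding eventually_at_right_field by blast
  have "eventually (\<lambda>s. x s \<in> mball l (e2 / 2)) (at_left r)"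
    by (rule limitinD[OF l ob], unfold centre_in_mball_iff)
      (use limitin_topspace[OF l] e2(1) in simp)
  then obtain v where v: "v < r" "\<And>s. v < s \<Longrightarrow> s < r \<Longrightarrow> x s \<in> mball l (e2 / 2)"
    unfolding eventually_at_left_field by blast
  \<comment> \<open>A time change within \<open>\<delta>\<close> of the identity stays in the
    one-sided neighbourhoods of \<open>r\<close> found above; the bound 1 keeps it below
    \<open>r + 1\<close>, where the distances are controlled.\<close>
  define \<delta> where "\<delta> = min (u - r) (min (r - v) 1)"
  have "0 < \<delta>" using u v by (simp add: \<delta>_def)
  have "eventually (\<lambda>n. \<forall>s\<in>{0..}. \<bar>lam n s - s\<bar> < \<delta>) sequentially"
    using uniform_limitD[OF lam \<open>0 < \<delta>\<close>] by (simp add: dist_real_def)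
  moreover have "eventually (\<lambda>n. \<forall>s\<in>{0..r + 1}. \<bar>d (xs n (lam n s)) (x s)\<bar> < min e1 e2 / 2) sequentially"
    using uniform_limitD[OF dist[of "r + 1"], of "min e1 e2 / 2"] e1 e2 by (simp add: dist_real_def)
  ultimately show "eventually (\<lambda>n. total_mass b (xs n r) \<in> U) sequentially"
  proof eventually_elim
    case (elim n)
    \<comment> \<open>The time which the time change carries to \<open>r\<close>: so
      \<open>xs n r\<close> is close to \<open>x \<sigma>\<close>, with \<open>\<sigma>\<close> near
      \<open>r\<close> on a side that may vary with \<open>n\<close>.\<close>
    define \<sigma> where "\<sigma> = inv_into {0..} (lam n) r"
    have img: "lam n ` {0..} = {0..}" using bij[of n] by (simp add: bij_betw_def)
    have r_in: "r \<in> lam n ` {0..}" using r img by simp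
    have \<sigma>: "0 \<le> \<sigma>" "lam n \<sigma> = r"
      using inv_into_into[OF r_in] f_inv_into_f[OF r_in] by (simp_all add: \<sigma>_def)
    then have near: "\<bar>r - \<sigma>\<bar> < \<delta>" using elim(1) by force
    then have "\<sigma> \<in> {0..r + 1}" using \<sigma> by (auto simp: \<delta>_def)
    then have dd: "d (xs n r) (x \<sigma>) < min e1 e2 / 2" using elim(2) \<sigma> by force
    have ins: "xs n r \<in> topspace ?E" using xs_in r by simp
    have "x \<sigma> \<in> mball (x r) (e1 / 2) \<or> x \<sigma> \<in> mball l (e2 / 2)"
    proof (cases r \<sigma> rule: linorder_cases)
      case less
      then have "\<sigma> < u" using near by (simp add: \<delta>_def)
      then show ?thesis using u(2) less by blast
    next
      case equal
      then show ?thesis using centre by (intro disjI1) (simp only:)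
    next
      case greater
      then have "v < \<sigma>" using near by (simp add: \<delta>_def)
      then show ?thesis using v(2) greater by blast
    qed
    then have "xs n r \<in> mball (x r) e1 \<or> xs n r \<in> mball l e2"
    proof
      assume "x \<sigma> \<in> mball (x r) (e1 / 2)"
      then have *: "x r \<in> topspace ?E" "x \<sigma> \<in> topspace ?E" "d (x r) (x \<sigma>) < e1 / 2" by auto
      have "d (x r) (xs n r) \<le> d (x r) (x \<sigma>) + d (xs n r) (x \<sigma>)"
        using triangle[OF *(1,2) ins] by (simp add: commute)
      then show ?thesis using * ins dd by auto
    next
      assume "x \<sigma> \<in> mball l (e2 / 2)"
      then have *: "l \<in> topspace ?E" "x \<sigma> \<in> topspace ?E" "d l (x \<sigma>) < e2 / 2" by auto
      have "d l (xs n r) \<le> d l (x \<sigma>) + d (xs n r) (x \<sigma>)"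
        using triangle[OF *(1,2) ins] by (simp add: commute)
      then show ?thesis using * ins dd by auto
    qed
    then have "xs n r \<in> W" using e1 e2 by blast
    then show ?case by (simp add: W_def)
  qed
qed

text \<open>Evaluation at a fixed time is not continuous on Skorokhod space, but time averages are.\<close>

definition truncated_occupation ::
  "activity \<Rightarrow> real \<Rightarrow> real \<Rightarrow> real \<Rightarrow> (real \<Rightarrow> 'a::euclidean_space measure \<times> 'a measure) \<Rightarrow> real" where
  "truncated_occupation b s h K x = (\<integral>r. indicator {s..s + h} r * min (total_mass b (x r)) K \<partial>lborel)"

section \<open>Continuity of the truncated occupation functional\<close>

context
  fixes b :: activity and s h K :: real
  assumes s: "0 \<le> s" and h: "0 < h" and K: "0 < K"
begin

lemma measurable_truncated [measurable]:
  assumes "x \<in> cadlag_paths measure_pairs"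
  shows "(\<lambda>r. indicator {s..s + h} r * min (total_mass b (x r)) K) \<in> borel_measurable borel"
proof -
  have [measurable]: "(\<lambda>r. if 0 \<le> r then total_mass b (x r) else 0) \<in> borel_measurable borel"
    by (rule measurable_cadlag_total_mass[OF assms])
  have "(\<lambda>r. indicator {s..s + h} r * min (total_mass b (x r)) K) =
      (\<lambda>r. indicator {s..s + h} r * min (if 0 \<le> r then total_mass b (x r) else 0) K)"
    using s by (auto simp: indicator_def fun_eq_iff)
  then show ?thesis by simp
qed

lemma integrable_truncated:
  assumes "x \<in> cadlag_paths measure_pairs"
  shows "integrable lborel (\<lambda>r. indicator {s..s + h} r * min (total_mass b (x r)) K)"
proof (rule Bochner_Integration.integrable_bound)
  show "integrable lborel (\<lambda>r. K * indicator {s..s + h} r)"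
    using h by (intro integrable_mult_right integrable_real_indicator) auto
  show "(\<lambda>r. indicator {s..s + h} r * min (total_mass b (x r)) K) \<in> borel_measurable lborel"
    using measurable_truncated[OF assms] by simp
  show "AE r in lborel. norm (indicator {s..s + h} r * min (total_mass b (x r)) K) \<le> norm (K * indicator {s..s + h} r)"
    by (intro AE_I2 order_trans[OF norm_truncated_le[OF K]]) simp
qed

lemma truncated_occupation_bounds:
  assumes x: "x \<in> cadlag_paths measure_pairs"
    and bounds: "\<And>r. s \<le> r \<Longrightarrow> r \<le> s + h \<Longrightarrow> lo \<le> min (total_mass b (x r)) K \<and> min (total_mass b (x r)) K \<le> hi"
  shows "h * lo \<le> truncated_occupation b s h K x" "truncated_occupation b s h K x \<le> h * hi"
proof -
  have const: "integrable lborel (\<lambda>r. indicator {s..s + h} r * a)" "(\<integral>r. indicator {s..s + h} r * a \<partial>lborel) = h * a" for a :: real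
    using h by auto
  have "(\<integral>r. indicator {s..s + h} r * lo \<partial>lborel) \<le> truncated_occupation b s h K x"
    unfolding truncated_occupation_def
    by (rule integral_mono[OF const(1) integrable_truncated[OF x]]) (use bounds in \<open>auto simp: indicator_def\<close>)
  then show "h * lo \<le> truncated_occupation b s h K x" by (simp only: const)
  have "truncated_occupation b s h K x \<le> (\<integral>r. indicator {s..s + h} r * hi \<partial>lborel)"
    unfolding truncated_occupation_def
    by (rule integral_mono[OF integrable_truncated[OF x] const(1)]) (use bounds in \<open>auto simp: indicator_def\<close>)
  then show "truncated_occupation b s h K x \<le> h * hi" by (simp only: const)
qed

lemma truncated_occupation_range:
  assumes "x \<in> cadlag_paths measure_pairs"
  shows "0 \<le> truncated_occupation b s h K x" "truncated_occupation b s h K x \<le> h * K"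
  using truncated_occupation_bounds[OF assms, of 0 K] K by simp_all

text \<open>The jump times of the limiting mass form a Lebesgue null set; elsewhere the masses
  converge, and the truncation provides the dominating function.\<close>

lemma truncated_occupation_convergent:
  assumes x: "x \<in> cadlag_paths measure_pairs" and xs: "range xs \<subseteq> cadlag_paths measure_pairs"
    and conv: "skorokhod_convergent measure_pairs xs x"
  shows "(\<lambda>n. truncated_occupation b s h K (xs n)) \<longlonglongrightarrow> truncated_occupation b s h K x"
  unfolding truncated_occupation_def
proof (rule integral_dominated_convergence)
  let ?J = "insert 0 {t. 0 < t \<and> \<not> ((\<lambda>r. total_mass b (x r)) \<longlongrightarrow> total_mass b (x t)) (at_left t)}"
  have "countable ?J" using cadlag_countable_jumps[OF x] by simp
  then have "?J \<in> null_sets lborel" by (rule countable_imp_null_set_lborel)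
  then have "AE r in lborel. r \<notin> ?J" by (rule AE_not_in)
  then show "AE r in lborel. (\<lambda>n. indicator {s..s + h} r * min (total_mass b (xs n r)) K)
      \<longlonglongrightarrow> indicator {s..s + h} r * min (total_mass b (x r)) K"
  proof eventually_elim
    case (elim r)
    show ?case
    proof (cases "r \<in> {s..s + h}")
      case True
      then have "(\<lambda>n. total_mass b (xs n r)) \<longlonglongrightarrow> total_mass b (x r)"
        using elim s by (intro skorokhod_total_mass_convergent[OF x xs conv]) auto
      then show ?thesis by (intro tendsto_mult tendsto_min tendsto_const)
    qed simp
  qed
  show "integrable lborel (\<lambda>r. K * indicator {s..s + h} r)"
    using h by (intro integrable_mult_right integrable_real_indicator) auto
  show "AE r in lborel. norm (indicator {s..s + h} r * min (total_mass b (xs n r)) K) \<le> K * indicator {s..s + h} r" for n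
    by (intro AE_I2 norm_truncated_le K)
  show "(\<lambda>r. indicator {s..s + h} r * min (total_mass b (x r)) K) \<in> borel_measurable lborel"
    using measurable_truncated[OF x] by simp
  show "(\<lambda>r. indicator {s..s + h} r * min (total_mass b (xs n r)) K) \<in> borel_measurable lborel" for n
  proof -
    have "xs n \<in> cadlag_paths measure_pairs" using xs by auto
    from measurable_truncated[OF this] show ?thesis by simp
  qed
qed

text \<open>The Skorokhod topology is defined through its convergent sequences, so sequential
  continuity is enough.\<close>

lemma continuous_map_truncated_occupation:
  "continuous_map measure_pair_paths euclideanreal (truncated_occupation b s h K)"
  unfolding continuous_map_def
proof (intro conjI allI impI)
  fix U :: "real set" assume "openin euclideanreal U"
  then have "open U" by simp
  show "openin measure_pair_paths {x \<in> topspace measure_pair_paths. truncated_occupation b s h K x \<in> U}"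
    unfolding measure_pair_paths_def openin_skorokhod_topology topspace_skorokhod_topology
  proof (intro conjI ballI allI impI)
    fix x xs assume "x \<in> {x \<in> cadlag_paths measure_pairs. truncated_occupation b s h K x \<in> U}"
      and xs: "range xs \<subseteq> cadlag_paths measure_pairs \<and> skorokhod_convergent measure_pairs xs x"
    then have "eventually (\<lambda>n. truncated_occupation b s h K (xs n) \<in> U) sequentially"
      using topological_tendstoD[OF truncated_occupation_convergent \<open>open U\<close>] by auto
    then show "eventually (\<lambda>n. xs n \<in> {x \<in> cadlag_paths measure_pairs. truncated_occupation b s h K x \<in> U}) sequentially"
      by (rule eventually_mono) (use xs in auto)
  qed auto
qed simp

end

lemma borel_measurable_continuous_map:
  assumes "continuous_map E euclideanreal F"
  shows "F \<in> borel_measurable (borel_of_topology E)"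
proof (rule borel_measurableI)
  fix U :: "real set" assume "open U"
  have sub: "{U. openin E U} \<subseteq> Pow (topspace E)" using openin_subset by blast
  have "F -` U \<inter> topspace E = {x \<in> topspace E. F x \<in> U}" by auto
  also have "openin E \<dots>" using assms \<open>open U\<close> by (auto simp: continuous_map_def)
  finally show "F -` U \<inter> space (borel_of_topology E) \<in> sets (borel_of_topology E)"
    unfolding borel_of_topology_def by (simp add: space_measure_of[OF sub] sets_measure_of[OF sub] sigma_sets.Basic)
qed

lemma space_borel_of_topology: "space (borel_of_topology E) = topspace E"
  unfolding borel_of_topology_def by (rule space_measure_of) (use openin_subset in blast)

section \<open>Passage to the limit\<close>

definition mean_mass ::
  "(activity \<Rightarrow> real \<Rightarrow> real) \<Rightarrow> 'a::euclidean_space measure \<times> 'a measure \<Rightarrow> real \<Rightarrow> real" where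
  "mean_mass m \<mu> t = (\<Sum>s\<in>{Dormant, Active}. total_mass s \<mu> * m s t)"

text \<open>The constant of \<open>ooBBM_moments\<close>, which there bounds the second moments of
  the rescaled populations up to time \<open>\<tau>\<close>, uniformly in \<epsilon> \<le>
  1.\<close>

definition moment_bound :: "real \<Rightarrow> real \<Rightarrow> 'a::euclidean_space measure \<times> 'a measure \<Rightarrow> real" where
  "moment_bound \<gamma> \<tau> \<mu> = 2 * (\<Sum>s\<in>{Dormant, Active}. total_mass s \<mu> * (2 + \<gamma> * \<tau>) + (total_mass s \<mu>)\<^sup>2)"

lemma topspace_measure_pair_paths: "topspace measure_pair_paths = cadlag_paths measure_pairs"
  by (simp add: measure_pair_paths_def topspace_skorokhod_topology)

text \<open>\<open>measure\<close> takes the value 0 where \<open>emeasure\<close> is infinite;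
  membership in the path space makes the measures finite, so that an explosion cannot hide behind
  this default.\<close>

lemma ennreal_total_mass_rescale:
  assumes x: "rescale \<epsilon> x \<in> cadlag_paths measure_pairs" and t: "0 \<le> t"
  shows "ennreal (total_mass b (rescale \<epsilon> x t)) = ennreal \<epsilon> * emeasure (component b (x t)) UNIV"
proof -
  have "rescale \<epsilon> x t \<in> topspace measure_pairs"
    using x t by (auto simp: cadlag_paths_def)
  then have "component b (rescale \<epsilon> x t) \<in> finite_borel_measures"
    by (cases b) (auto simp: topspace_weak_topology)
  then interpret finite_measure "component b (rescale \<epsilon> x t)"
    by (simp add: finite_borel_measures_def)
  have "component b (rescale \<epsilon> x t) = scale_measure (ennreal \<epsilon>) (component b (x t))"
    using t by (cases b) (auto simp: rescale_def)
  then show ?thesis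
    using emeasure_eq_measure[of UNIV] by (simp add: total_mass_def)
qed

text \<open>The expected occupation is the time integral of the truncated means. The constants
  \<open>lo\<close> and \<open>hi\<close> enclose the mean mass on the window; being nonnegative,
  they can be handled in \<open>ennreal\<close>.\<close>

lemma ooBBM_occupation_bounds:
  fixes \<mu> :: "'a::euclidean_space measure \<times> 'a measure"
  assumes X: "ooBBM P (\<gamma> / \<epsilon>) c c' X" and pos: "0 < \<gamma>" "0 < c" "0 < c'" and \<epsilon>: "0 < \<epsilon>" "\<epsilon> \<le> 1"
    and prm: "\<And>s. poisson_random_measure P (\<lambda>\<omega>. component s (X \<omega> 0)) (scale_measure (ennreal (1 / \<epsilon>)) (component s \<mu>))"
    and meas: "(\<lambda>\<omega>. rescale \<epsilon> (X \<omega>)) \<in> measurable P (borel_of_topology measure_pair_paths)"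
    and m: "mean_solution c c' {b} m" and K: "0 < K" and s: "0 \<le> s" and h: "0 < h" "s + h \<le> \<tau>"
    and lo: "0 \<le> lo" "\<And>r. s \<le> r \<Longrightarrow> r \<le> s + h \<Longrightarrow> lo \<le> mean_mass m \<mu> r"
    and hi: "0 \<le> hi" "\<And>r. s \<le> r \<Longrightarrow> r \<le> s + h \<Longrightarrow> mean_mass m \<mu> r \<le> hi"
  shows "h * (lo - moment_bound \<gamma> \<tau> \<mu> / K) \<le> (\<integral>\<omega>. truncated_occupation b s h K (rescale \<epsilon> (X \<omega>)) \<partial>P)"
    and "(\<integral>\<omega>. truncated_occupation b s h K (rescale \<epsilon> (X \<omega>)) \<partial>P) \<le> h * hi"
proof -
  interpret prob_space P using X by (simp add: ooBBM_def)
  let ?C = "moment_bound \<gamma> \<tau> \<mu>"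
  let ?F = "\<lambda>\<omega>. truncated_occupation b s h K (rescale \<epsilon> (X \<omega>))"
  let ?ind = "\<lambda>r. indicator {s..s + h} r :: ennreal"
  obtain A where A[measurable]: "(\<lambda>x. A (fst x) (snd x)) \<in> borel_measurable (borel \<Otimes>\<^sub>M P)"
    and AX: "AE \<omega> in P. \<forall>t\<ge>0. emeasure (component b (X \<omega> t)) UNIV = A t \<omega>"
    and bounds: "\<And>t. 0 \<le> t \<Longrightarrow> t \<le> \<tau> \<Longrightarrow>
      (\<integral>\<^sup>+\<omega>. ennreal \<epsilon> * A t \<omega> \<partial>P) \<le> ennreal (mean_mass m \<mu> t) \<and>
      ennreal (mean_mass m \<mu> t) \<le> (\<integral>\<^sup>+\<omega>. min (ennreal \<epsilon> * A t \<omega>) (ennreal K) \<partial>P) + ennreal ?C / ennreal K"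
    using ooBBM_moments[OF X pos \<epsilon> prm m K, of \<tau>]
    unfolding mean_mass_def moment_bound_def total_mass_def by blast
  have A'[measurable]: "A t \<in> borel_measurable P" for t
    using measurable_compose[OF measurable_Pair1'[of t borel P] A] by simp
  have cad: "rescale \<epsilon> (X \<omega>) \<in> cadlag_paths measure_pairs" if "\<omega> \<in> space P" for \<omega>
    using measurable_space[OF meas that] by (simp add: space_borel_of_topology topspace_measure_pair_paths)
  have C: "0 \<le> ?C"
    using pos s h unfolding moment_bound_def
    by (intro mult_nonneg_nonneg sum_nonneg add_nonneg_nonneg) auto
  have F_meas[measurable]: "?F \<in> borel_measurable P"
    using measurable_compose[OF meas borel_measurable_continuous_map[OF continuous_map_truncated_occupation[OF s h(1) K]]] .
  have F_range: "0 \<le> ?F \<omega>" "?F \<omega> \<le> h * K" if "\<omega> \<in> space P" for \<omega>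
    using truncated_occupation_range[OF s h(1) K cad[OF that]] by auto
  have F_int: "integrable P ?F"
    by (rule integrable_const_bound[where B = "h * K"]) (use F_range in \<open>auto intro!: AE_I2 simp: abs_of_nonneg\<close>)
  have "ennreal (\<integral>\<omega>. ?F \<omega> \<partial>P) = (\<integral>\<^sup>+\<omega>. ennreal (?F \<omega>) \<partial>P)"
    by (rule nn_integral_eq_integral[symmetric, OF F_int]) (use F_range in auto)
  also have "\<dots> = (\<integral>\<^sup>+\<omega>. \<integral>\<^sup>+r. ?ind r * min (ennreal \<epsilon> * A r \<omega>) (ennreal K) \<partial>lborel \<partial>P)"
  proof (rule nn_integral_cong_AE)
    show "AE \<omega> in P. ennreal (?F \<omega>) = (\<integral>\<^sup>+r. ?ind r * min (ennreal \<epsilon> * A r \<omega>) (ennreal K) \<partial>lborel)"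
      using AX AE_space
    proof eventually_elim
      case (elim \<omega>)
      have "ennreal (?F \<omega>) = (\<integral>\<^sup>+r. ennreal (indicator {s..s + h} r * min (total_mass b (rescale \<epsilon> (X \<omega>) r)) K) \<partial>lborel)"
        unfolding truncated_occupation_def using K
        by (intro nn_integral_eq_integral[symmetric] integrable_truncated[OF s h(1) K cad[OF elim(2)]] AE_I2) simp
      also have "\<dots> = (\<integral>\<^sup>+r. ?ind r * min (ennreal \<epsilon> * A r \<omega>) (ennreal K) \<partial>lborel)"
      proof (rule nn_integral_cong)
        fix r
        show "ennreal (indicator {s..s + h} r * min (total_mass b (rescale \<epsilon> (X \<omega>) r)) K) =
            ?ind r * min (ennreal \<epsilon> * A r \<omega>) (ennreal K)"
        proof (cases "r \<in> {s..s + h}")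
          case True
          then have "ennreal \<epsilon> * A r \<omega> = ennreal (total_mass b (rescale \<epsilon> (X \<omega>) r))"
            using ennreal_total_mass_rescale[OF cad[OF elim(2)], of r b] elim(1) s by simp
          then show ?thesis using True K by (simp add: min_def ennreal_le_iff)
        qed simp
      qed
      finally show ?case .
    qed
  qed
  \<comment> \<open>The exchange of integrals rests on the joint measurability of
    \<open>A\<close>.\<close>
  also have "\<dots> = (\<integral>\<^sup>+r. \<integral>\<^sup>+\<omega>. ?ind r * min (ennreal \<epsilon> * A r \<omega>) (ennreal K) \<partial>P \<partial>lborel)"
  proof -
    interpret pair_sigma_finite lborel P
      by (intro pair_sigma_finite.intro sigma_finite_lborel sigma_finite_measure_axioms)
    have "(\<lambda>x. ?ind (fst x) * min (ennreal \<epsilon> * A (fst x) (snd x)) (ennreal K)) \<in> borel_measurable (borel \<Otimes>\<^sub>M P)"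
      by measurable
    also have "borel_measurable (borel \<Otimes>\<^sub>M P) = borel_measurable (lborel \<Otimes>\<^sub>M P)"
      by (intro measurable_cong_sets sets_pair_measure_cong) auto
    finally show ?thesis
      by (intro Fubini') (simp add: split_beta)
  qed
  also have "\<dots> = (\<integral>\<^sup>+r. ?ind r * (\<integral>\<^sup>+\<omega>. min (ennreal \<epsilon> * A r \<omega>) (ennreal K) \<partial>P) \<partial>lborel)"
    by (simp add: nn_integral_cmult)
  finally have EF: "ennreal (\<integral>\<omega>. ?F \<omega> \<partial>P) = \<dots>" .
  have const: "(\<integral>\<^sup>+r. ?ind r * a \<partial>lborel) = ennreal h * a" for a
    using h by (simp add: nn_integral_multc)
  have EF0: "0 \<le> (\<integral>\<omega>. ?F \<omega> \<partial>P)" using F_range by (intro integral_nonneg_AE) auto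
  have "ennreal (\<integral>\<omega>. ?F \<omega> \<partial>P) \<le> (\<integral>\<^sup>+r. ?ind r * ennreal hi \<partial>lborel)"
    unfolding EF
  proof (rule nn_integral_mono)
    fix r
    show "?ind r * (\<integral>\<^sup>+\<omega>. min (ennreal \<epsilon> * A r \<omega>) (ennreal K) \<partial>P) \<le> ?ind r * ennreal hi"
    proof (cases "r \<in> {s..s + h}")
      case True
      have "(\<integral>\<^sup>+\<omega>. min (ennreal \<epsilon> * A r \<omega>) (ennreal K) \<partial>P) \<le> (\<integral>\<^sup>+\<omega>. ennreal \<epsilon> * A r \<omega> \<partial>P)"
        by (intro nn_integral_mono) simp
      also have "\<dots> \<le> ennreal (mean_mass m \<mu> r)" using bounds[of r] True s h by simp
      also have "\<dots> \<le> ennreal hi" using hi(2) True by (intro ennreal_leI) simp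
      finally show ?thesis using True by simp
    qed simp
  qed
  then show "(\<integral>\<omega>. ?F \<omega> \<partial>P) \<le> h * hi"
    using h hi(1) by (simp add: const ennreal_mult[symmetric] ennreal_le_iff)
  have "(\<integral>\<^sup>+r. ?ind r * ennreal lo \<partial>lborel) \<le>
      (\<integral>\<^sup>+r. ?ind r * (\<integral>\<^sup>+\<omega>. min (ennreal \<epsilon> * A r \<omega>) (ennreal K) \<partial>P) + ?ind r * (ennreal ?C / ennreal K) \<partial>lborel)"
  proof (rule nn_integral_mono)
    fix r
    show "?ind r * ennreal lo \<le>
        ?ind r * (\<integral>\<^sup>+\<omega>. min (ennreal \<epsilon> * A r \<omega>) (ennreal K) \<partial>P) + ?ind r * (ennreal ?C / ennreal K)"
    proof (cases "r \<in> {s..s + h}")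
      case True
      then have "ennreal lo \<le> ennreal (mean_mass m \<mu> r)" using lo(2) by (intro ennreal_leI) simp
      also have "\<dots> \<le> (\<integral>\<^sup>+\<omega>. min (ennreal \<epsilon> * A r \<omega>) (ennreal K) \<partial>P) + ennreal ?C / ennreal K"
        using bounds[of r] True s h by simp
      finally show ?thesis using True by simp
    qed simp
  qed
  also have "\<dots> = ennreal (\<integral>\<omega>. ?F \<omega> \<partial>P) + ennreal h * (ennreal ?C / ennreal K)"
  proof -
    have "(\<lambda>r. \<integral>\<^sup>+\<omega>. min (ennreal \<epsilon> * A r \<omega>) (ennreal K) \<partial>P) \<in> borel_measurable borel"
      by measurable
    then show ?thesis unfolding EF const[symmetric] by (subst nn_integral_add) auto
  qed
  finally have "ennreal h * ennreal lo \<le> ennreal (\<integral>\<omega>. ?F \<omega> \<partial>P) + ennreal h * ennreal (?C / K)"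
    using K C by (simp only: const divide_ennreal)
  then have "ennreal (h * lo) \<le> ennreal ((\<integral>\<omega>. ?F \<omega> \<partial>P) + h * (?C / K))"
    using h lo(1) K C EF0
    by (simp only: ennreal_mult[symmetric] ennreal_plus[symmetric] less_imp_le divide_nonneg_pos mult_nonneg_nonneg)
  then show "h * (lo - ?C / K) \<le> (\<integral>\<omega>. ?F \<omega> \<partial>P)"
    using h K C EF0 by (subst (asm) ennreal_le_iff) (auto simp: algebra_simps)
qed

text \<open>The bounds are free of \<epsilon> and the functional is bounded and continuous, so they
  survive the limit in distribution.\<close>

lemma ooSBM_occupation_bounds:
  fixes \<mu> :: "'a::euclidean_space measure \<times> 'a measure"
  assumes Y: "ooSBM TYPE('v) \<gamma> c c' (fst \<mu>) (snd \<mu>) M Y" and pos: "0 < \<gamma>" "0 < c" "0 < c'"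
    and m: "mean_solution c c' {b} m" and K: "0 < K" and s: "0 \<le> s" and h: "0 < h" "s + h \<le> \<tau>"
    and lo: "0 \<le> lo" "\<And>r. s \<le> r \<Longrightarrow> r \<le> s + h \<Longrightarrow> lo \<le> mean_mass m \<mu> r"
    and hi: "0 \<le> hi" "\<And>r. s \<le> r \<Longrightarrow> r \<le> s + h \<Longrightarrow> mean_mass m \<mu> r \<le> hi"
  shows "h * (lo - moment_bound \<gamma> \<tau> \<mu> / K) \<le> (\<integral>\<omega>. truncated_occupation b s h K (Y \<omega>) \<partial>M)"
    and "(\<integral>\<omega>. truncated_occupation b s h K (Y \<omega>) \<partial>M) \<le> h * hi"
proof -
  obtain P :: "real \<Rightarrow> 'v measure" and X where
    X: "\<And>\<epsilon>. 0 < \<epsilon> \<Longrightarrow> ooBBM (P \<epsilon>) (\<gamma> / \<epsilon>) c c' (X \<epsilon>)"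
    and pd: "\<And>\<epsilon>. 0 < \<epsilon> \<Longrightarrow> poisson_random_measure (P \<epsilon>) (\<lambda>\<omega>. fst (X \<epsilon> \<omega> 0)) (scale_measure (ennreal (1 / \<epsilon>)) (fst \<mu>))"
    and pa: "\<And>\<epsilon>. 0 < \<epsilon> \<Longrightarrow> poisson_random_measure (P \<epsilon>) (\<lambda>\<omega>. snd (X \<epsilon> \<omega> 0)) (scale_measure (ennreal (1 / \<epsilon>)) (snd \<mu>))"
    and meas: "\<And>\<epsilon>. 0 < \<epsilon> \<Longrightarrow> (\<lambda>\<omega>. rescale \<epsilon> (X \<epsilon> \<omega>)) \<in> measurable (P \<epsilon>) (borel_of_topology measure_pair_paths)"
    and conv: "converges_in_distribution measure_pair_paths P (\<lambda>\<epsilon> \<omega>. rescale \<epsilon> (X \<epsilon> \<omega>)) M Y (at_right 0)"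
    using Y unfolding ooSBM_def by blast
  have prm: "poisson_random_measure (P \<epsilon>) (\<lambda>\<omega>. component s (X \<epsilon> \<omega> 0)) (scale_measure (ennreal (1 / \<epsilon>)) (component s \<mu>))"
    if "0 < \<epsilon>" for \<epsilon> s
    using pd[OF that] pa[OF that] by (cases s) auto
  have "bounded (truncated_occupation b s h K ` topspace (measure_pair_paths :: (real \<Rightarrow> 'a measure \<times> 'a measure) topology))"
    unfolding topspace_measure_pair_paths bounded_iff
    by (rule exI[of _ "h * K"]) (auto simp: abs_of_nonneg truncated_occupation_range[OF s h(1) K])
  then have lim: "((\<lambda>\<epsilon>. \<integral>\<omega>. truncated_occupation b s h K (rescale \<epsilon> (X \<epsilon> \<omega>)) \<partial>P \<epsilon>) \<longlongrightarrow>
      (\<integral>\<omega>. truncated_occupation b s h K (Y \<omega>) \<partial>M)) (at_right 0)"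
    using conv continuous_map_truncated_occupation[OF s h(1) K, of b]
    unfolding converges_in_distribution_def by blast
  have ev: "eventually (\<lambda>\<epsilon>::real. 0 < \<epsilon> \<and> \<epsilon> \<le> 1) (at_right 0)"
    unfolding eventually_at_right_field by (intro exI[of _ 1]) auto
  show "h * (lo - moment_bound \<gamma> \<tau> \<mu> / K) \<le> (\<integral>\<omega>. truncated_occupation b s h K (Y \<omega>) \<partial>M)"
    by (rule tendsto_lowerbound[OF lim eventually_mono[OF ev]])
      (use ooBBM_occupation_bounds(1)[OF X pos _ _ prm meas m K s h lo hi] in auto)
  show "(\<integral>\<omega>. truncated_occupation b s h K (Y \<omega>) \<partial>M) \<le> h * hi"
    by (rule tendsto_upperbound[OF lim eventually_mono[OF ev]])
      (use ooBBM_occupation_bounds(2)[OF X pos _ _ prm meas m K s h lo hi] in auto)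
qed

text \<open>The windows lie to the right of \<open>s\<close>, so right-continuity suffices even if
  the path jumps at \<open>s\<close>.\<close>

lemma truncated_occupation_average_tendsto:
  assumes x: "x \<in> cadlag_paths measure_pairs" and s: "0 \<le> s" and K: "0 < K"
  shows "(\<lambda>j. truncated_occupation b s (inverse (real (Suc j))) K x / inverse (real (Suc j)))
    \<longlonglongrightarrow> min (total_mass b (x s)) K"
proof (rule LIMSEQ_I)
  let ?f = "\<lambda>r. min (total_mass b (x r)) K"
  fix e :: real assume "0 < e"
  have "(?f \<longlongrightarrow> ?f s) (at_right s)"
    by (intro tendsto_min tendsto_const cadlag_total_mass(1)[OF x s])
  from tendstoD[OF this, of "e / 2"] \<open>0 < e\<close>
  obtain u where u: "s < u" "\<And>r. s < r \<Longrightarrow> r < u \<Longrightarrow> \<bar>?f r - ?f s\<bar> < e / 2"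
    unfolding eventually_at_right_field dist_real_def by auto
  have "eventually (\<lambda>j. inverse (real (Suc j)) < u - s) sequentially"
    using LIMSEQ_inverse_real_of_nat u(1) by (intro order_tendstoD(2)) auto
  then obtain n where n: "\<And>j. n \<le> j \<Longrightarrow> inverse (real (Suc j)) < u - s"
    unfolding eventually_sequentially by blast
  show "\<exists>n. \<forall>j\<ge>n. norm (truncated_occupation b s (inverse (real (Suc j))) K x / inverse (real (Suc j)) - ?f s) < e"
  proof (intro exI[of _ n] allI impI)
    fix j assume "n \<le> j"
    define h where "h = inverse (real (Suc j))"
    have h: "0 < h" "h < u - s" using n[OF \<open>n \<le> j\<close>] by (simp_all add: h_def)
    have near: "?f s - e / 2 \<le> ?f r \<and> ?f r \<le> ?f s + e / 2" if "s \<le> r" "r \<le> s + h" for r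
    proof -
      have "\<bar>?f r - ?f s\<bar> < e / 2"
        using u(2)[of r] that h \<open>0 < e\<close> by (cases "r = s") auto
      then show ?thesis by (intro conjI) linarith+
    qed
    have "h * (?f s - e / 2) \<le> truncated_occupation b s h K x" "truncated_occupation b s h K x \<le> h * (?f s + e / 2)"
      using truncated_occupation_bounds[OF s h(1) K x near] by auto
    then have "?f s - e / 2 \<le> truncated_occupation b s h K x / h" "truncated_occupation b s h K x / h \<le> ?f s + e / 2"
      using h(1) by (simp_all add: pos_le_divide_eq pos_divide_le_eq mult.commute)
    then show "norm (truncated_occupation b s (inverse (real (Suc j))) K x / inverse (real (Suc j)) - ?f s) < e"
      using \<open>0 < e\<close> unfolding h_def[symmetric] by (simp add: abs_less_iff)
  qed
qed

text \<open>The windows shrink to \<open>s\<close> while \<open>K\<close> is fixed, so an error of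
  order 1 / K is still present. The horizon \<open>s + 1\<close> covers all windows, since their
  lengths are at most 1.\<close>

lemma ooSBM_truncated_mean:
  fixes \<mu> :: "'a::euclidean_space measure \<times> 'a measure"
  assumes Y: "ooSBM TYPE('v) \<gamma> c c' (fst \<mu>) (snd \<mu>) M Y" and pos: "0 < \<gamma>" "0 < c" "0 < c'"
    and m: "mean_solution c c' {b} m" and K: "0 < K" and s: "0 \<le> s"
  shows "integrable M (\<lambda>\<omega>. min (total_mass b (Y \<omega> s)) K)"
    and "mean_mass m \<mu> s - moment_bound \<gamma> (s + 1) \<mu> / K \<le> (\<integral>\<omega>. min (total_mass b (Y \<omega> s)) K \<partial>M)"
    and "(\<integral>\<omega>. min (total_mass b (Y \<omega> s)) K \<partial>M) \<le> mean_mass m \<mu> s"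
proof -
  have "prob_space M" and Y_meas: "Y \<in> measurable M (borel_of_topology measure_pair_paths)"
    using Y unfolding ooSBM_def by auto
  interpret prob_space M by fact
  have cad: "Y \<omega> \<in> cadlag_paths measure_pairs" if "\<omega> \<in> space M" for \<omega>
    using measurable_space[OF Y_meas that] by (simp add: space_borel_of_topology topspace_measure_pair_paths)
  define h where "h = (\<lambda>j. inverse (real (Suc j)))"
  have h: "0 < h j" "h j \<le> 1" for j by (simp_all add: h_def inverse_le_1_iff)
  define G where "G = (\<lambda>j \<omega>. truncated_occupation b s (h j) K (Y \<omega>) / h j)"
  have [measurable]: "(\<lambda>\<omega>. truncated_occupation b s (h j) K (Y \<omega>)) \<in> borel_measurable M" for j
    using measurable_compose[OF Y_meas borel_measurable_continuous_map[OF continuous_map_truncated_occupation[OF s h(1) K]]] .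
  have G_meas[measurable]: "G j \<in> borel_measurable M" for j
    unfolding G_def by measurable
  have G_range: "0 \<le> G j \<omega>" "G j \<omega> \<le> K" if "\<omega> \<in> space M" for j \<omega>
    using truncated_occupation_range[OF s h(1)[of j] K cad[OF that], of b] h(1)[of j]
    by (simp_all add: G_def pos_divide_le_eq mult.commute)
  have G_lim: "(\<lambda>j. G j \<omega>) \<longlonglongrightarrow> min (total_mass b (Y \<omega> s)) K" if "\<omega> \<in> space M" for \<omega>
    using truncated_occupation_average_tendsto[OF cad[OF that] s K] by (simp add: G_def h_def)
  \<comment> \<open>Evaluation at time \<open>s\<close> is measurable as a pointwise limit of
    averages, which are continuous functionals of the path.\<close>
  have meas: "(\<lambda>\<omega>. min (total_mass b (Y \<omega> s)) K) \<in> borel_measurable M"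
    by (rule borel_measurable_LIMSEQ_real[OF G_lim G_meas])
  show "integrable M (\<lambda>\<omega>. min (total_mass b (Y \<omega> s)) K)"
    by (rule integrable_const_bound[where B = K, OF _ meas]) (use K in \<open>auto simp: abs_of_nonneg\<close>)
  have EG_lim: "(\<lambda>j. \<integral>\<omega>. G j \<omega> \<partial>M) \<longlonglongrightarrow> (\<integral>\<omega>. min (total_mass b (Y \<omega> s)) K \<partial>M)"
    by (rule integral_dominated_convergence[where w = "\<lambda>_. K"])
      (use meas G_lim G_range in \<open>auto intro!: AE_I2 simp: abs_of_nonneg\<close>)
  have "isCont (m a) s" for a
    using m by (cases a) (auto simp: mean_solution_def intro: DERIV_isCont)
  then have "isCont (mean_mass m \<mu>) s" unfolding mean_mass_def by (intro continuous_intros)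
  have mu0: "0 \<le> mean_mass m \<mu> r" if "0 \<le> r" for r
    using m that unfolding mean_mass_def by (intro sum_nonneg mult_nonneg_nonneg) (auto simp: mean_solution_def)
  have ev: "eventually (\<lambda>j. mean_mass m \<mu> s - e - moment_bound \<gamma> (s + 1) \<mu> / K \<le> (\<integral>\<omega>. G j \<omega> \<partial>M) \<and>
      (\<integral>\<omega>. G j \<omega> \<partial>M) \<le> mean_mass m \<mu> s + e) sequentially" if e: "0 < e" for e
  proof -
    obtain d where d: "0 < d" "\<And>r. \<bar>r - s\<bar> < d \<Longrightarrow> \<bar>mean_mass m \<mu> r - mean_mass m \<mu> s\<bar> < e"
      using \<open>isCont (mean_mass m \<mu>) s\<close> e unfolding continuous_at_eps_delta dist_real_def by metis
    have "eventually (\<lambda>j. h j < d) sequentially"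
      unfolding h_def using LIMSEQ_inverse_real_of_nat d(1) by (intro order_tendstoD(2)) auto
    then show ?thesis
    proof eventually_elim
      case (elim j)
      \<comment> \<open>The maximum with 0 meets the requirement \<open>0 \<le> lo\<close> of
        \<open>ooSBM_occupation_bounds\<close>.\<close>
      have near: "max 0 (mean_mass m \<mu> s - e) \<le> mean_mass m \<mu> r" "mean_mass m \<mu> r \<le> mean_mass m \<mu> s + e"
        if "s \<le> r" "r \<le> s + h j" for r
        using d(2)[of r] mu0[of r] that elim s by (auto simp: abs_less_iff)
      have "s + h j \<le> s + 1" "0 \<le> max 0 (mean_mass m \<mu> s - e)" "0 \<le> mean_mass m \<mu> s + e"
        using h(2)[of j] mu0[OF s] e by auto
      note B = ooSBM_occupation_bounds[OF Y pos m K s h(1)[of j] this(1,2) near(1) this(3) near(2)]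
      have EG: "(\<integral>\<omega>. G j \<omega> \<partial>M) = (\<integral>\<omega>. truncated_occupation b s (h j) K (Y \<omega>) \<partial>M) / h j"
        unfolding G_def by simp
      have "max 0 (mean_mass m \<mu> s - e) - moment_bound \<gamma> (s + 1) \<mu> / K \<le> (\<integral>\<omega>. G j \<omega> \<partial>M)"
        unfolding EG using B(1) h(1)[of j] by (simp add: pos_le_divide_eq mult.commute)
      moreover have "(\<integral>\<omega>. G j \<omega> \<partial>M) \<le> mean_mass m \<mu> s + e"
        unfolding EG using B(2) h(1)[of j] by (simp add: pos_divide_le_eq mult.commute)
      ultimately show ?case by simp
    qed
  qed
  show "mean_mass m \<mu> s - moment_bound \<gamma> (s + 1) \<mu> / K \<le> (\<integral>\<omega>. min (total_mass b (Y \<omega> s)) K \<partial>M)"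
  proof (rule field_le_epsilon)
    fix e :: real assume "0 < e"
    have "mean_mass m \<mu> s - e - moment_bound \<gamma> (s + 1) \<mu> / K \<le> (\<integral>\<omega>. min (total_mass b (Y \<omega> s)) K \<partial>M)"
      by (rule tendsto_lowerbound[OF EG_lim eventually_mono[OF ev[OF \<open>0 < e\<close>]]]) auto
    then show "mean_mass m \<mu> s - moment_bound \<gamma> (s + 1) \<mu> / K \<le> (\<integral>\<omega>. min (total_mass b (Y \<omega> s)) K \<partial>M) + e"
      by simp
  qed
  show "(\<integral>\<omega>. min (total_mass b (Y \<omega> s)) K \<partial>M) \<le> mean_mass m \<mu> s"
  proof (rule field_le_epsilon)
    fix e :: real assume "0 < e"
    show "(\<integral>\<omega>. min (total_mass b (Y \<omega> s)) K \<partial>M) \<le> mean_mass m \<mu> s + e"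
      by (rule tendsto_upperbound[OF EG_lim eventually_mono[OF ev[OF \<open>0 < e\<close>]]]) auto
  qed
qed

text \<open>Monotone convergence in the truncation level gives integrability and the value of the
  mean at once.\<close>

lemma ooSBM_mean_total_mass:
  fixes \<mu> :: "'a::euclidean_space measure \<times> 'a measure"
  assumes Y: "ooSBM TYPE('v) \<gamma> c c' (fst \<mu>) (snd \<mu>) M Y" and pos: "0 < \<gamma>" "0 < c" "0 < c'"
    and m: "mean_solution c c' {b} m" and s: "0 \<le> s"
  shows "has_bochner_integral M (\<lambda>\<omega>. total_mass b (Y \<omega> s)) (mean_mass m \<mu> s)"
proof (rule has_bochner_integral_monotone_convergence)
  \<comment> \<open>The successor keeps the truncation level positive.\<close>
  let ?f = "\<lambda>j \<omega>. min (total_mass b (Y \<omega> s)) (real (Suc j))"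
  note T = ooSBM_truncated_mean[OF Y pos m _ s]
  show int: "integrable M (?f j)" for j using T(1)[of "real (Suc j)"] by simp
  show "AE \<omega> in M. mono (\<lambda>j. ?f j \<omega>)" by (intro AE_I2 monoI) auto
  have lim: "(\<lambda>j. ?f j \<omega>) \<longlonglongrightarrow> total_mass b (Y \<omega> s)" for \<omega>
  proof (rule tendsto_eventually)
    obtain n where "total_mass b (Y \<omega> s) \<le> real n" using real_arch_simple by blast
    then show "eventually (\<lambda>j. ?f j \<omega> = total_mass b (Y \<omega> s)) sequentially"
      unfolding eventually_sequentially by (intro exI[of _ n]) (auto simp: min_def)
  qed
  then show "AE \<omega> in M. (\<lambda>j. ?f j \<omega>) \<longlonglongrightarrow> total_mass b (Y \<omega> s)" by simp
  show "(\<lambda>\<omega>. total_mass b (Y \<omega> s)) \<in> borel_measurable M"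
    by (rule borel_measurable_LIMSEQ_real[OF lim borel_measurable_integrable[OF int]])
  have "(\<lambda>j. moment_bound \<gamma> (s + 1) \<mu> * inverse (real (Suc j))) \<longlonglongrightarrow> moment_bound \<gamma> (s + 1) \<mu> * 0"
    by (intro tendsto_mult tendsto_const LIMSEQ_inverse_real_of_nat)
  then have "(\<lambda>j. mean_mass m \<mu> s - moment_bound \<gamma> (s + 1) \<mu> / real (Suc j)) \<longlonglongrightarrow> mean_mass m \<mu> s - moment_bound \<gamma> (s + 1) \<mu> * 0"
    unfolding divide_inverse by (intro tendsto_diff tendsto_const)
  then have low: "(\<lambda>j. mean_mass m \<mu> s - moment_bound \<gamma> (s + 1) \<mu> / real (Suc j)) \<longlonglongrightarrow> mean_mass m \<mu> s"
    by simp
  show "(\<lambda>j. integral\<^sup>L M (?f j)) \<longlonglongrightarrow> mean_mass m \<mu> s"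
  proof (rule tendsto_sandwich[OF _ _ low tendsto_const])
    show "eventually (\<lambda>j. mean_mass m \<mu> s - moment_bound \<gamma> (s + 1) \<mu> / real (Suc j) \<le> integral\<^sup>L M (?f j)) sequentially"
      by (intro always_eventually allI T(2)) simp
    show "eventually (\<lambda>j. integral\<^sup>L M (?f j) \<le> mean_mass m \<mu> s) sequentially"
      by (intro always_eventually allI T(3)) simp
  qed
qed

text \<open>The formulas come from two combinations of the equations:
  \<open>m Dormant - m Active\<close> decays at rate \<open>c + c'\<close>, and
  \<open>c * m Dormant + c' * m Active\<close> is conserved.\<close>

lemma mean_solution_Dormant:
  assumes "0 < c" "0 < c'"
  shows "mean_solution c c' {Dormant} (\<lambda>a t. case a of
    Dormant \<Rightarrow> (c + c' * exp (- t * (c + c'))) / (c + c') | Active \<Rightarrow> c * (1 - exp (- t * (c + c'))) / (c + c'))"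
proof -
  have "exp (- t * (c + c')) \<le> 1" if "0 \<le> t" for t
    using assms that by simp
  then show ?thesis
    using assms unfolding mean_solution_def
    by (auto intro!: derivative_eq_intros simp: field_simps split: activity.split)
qed

text \<open>The complement to 1 of the solution for dormant descendants: by criticality the expected
  total number of descendants is always 1.\<close>

lemma mean_solution_Active:
  assumes "0 < c" "0 < c'"
  shows "mean_solution c c' {Active} (\<lambda>a t. case a of
    Dormant \<Rightarrow> c' * (1 - exp (- t * (c + c'))) / (c + c') | Active \<Rightarrow> (c * exp (- t * (c + c')) + c') / (c + c'))"
proof -
  have "exp (- t * (c + c')) \<le> 1" if "0 \<le> t" for t
    using assms that by simp
  then show ?thesis
    using assms unfolding mean_solution_def
    by (auto intro!: derivative_eq_intros simp: field_simps split: activity.split)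
qed

theorem theorem1p11:
  fixes \<mu>\<^sub>d \<mu>\<^sub>a :: "(real ^ 'n) measure"
    and \<gamma> c c' s :: real
    and M :: "'w measure"
    and Y :: "'w \<Rightarrow> real \<Rightarrow> (real ^ 'n) measure \<times> (real ^ 'n) measure"
  assumes "\<mu>\<^sub>d \<in> finite_borel_measures" and "\<mu>\<^sub>a \<in> finite_borel_measures"
    and "\<exists>A\<in>sets borel. emeasure \<mu>\<^sub>d A + emeasure \<mu>\<^sub>a A \<noteq> 0"
    and "\<gamma> > 0" and "c > 0" and "c' > 0"
    and "ooSBM TYPE('v) \<gamma> c c' \<mu>\<^sub>d \<mu>\<^sub>a M Y"
    and "s \<ge> 0"
  shows "has_bochner_integral M (\<lambda>\<omega>. measure (fst (Y \<omega> s)) UNIV)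
           (measure \<mu>\<^sub>d UNIV * ((c + c' * exp (- s * (c + c'))) / (c + c'))
            + measure \<mu>\<^sub>a UNIV * (c * (1 - exp (- s * (c + c'))) / (c + c')))
       \<and> has_bochner_integral M (\<lambda>\<omega>. measure (snd (Y \<omega> s)) UNIV)
           (measure \<mu>\<^sub>d UNIV * (c' * (1 - exp (- s * (c + c'))) / (c + c'))
            + measure \<mu>\<^sub>a UNIV * ((c * exp (- s * (c + c')) + c') / (c + c')))"
proof -
  have Y: "ooSBM TYPE('v) \<gamma> c c' (fst (\<mu>\<^sub>d, \<mu>\<^sub>a)) (snd (\<mu>\<^sub>d, \<mu>\<^sub>a)) M Y" using assms(7) by simp
  show ?thesis
    using ooSBM_mean_total_mass[OF Y assms(4-6) mean_solution_Dormant[OF assms(5,6)] assms(8)]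
      ooSBM_mean_total_mass[OF Y assms(4-6) mean_solution_Active[OF assms(5,6)] assms(8)]
    by (simp add: mean_mass_def total_mass_def)
qed

end
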